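(* Let $n\ge 1$. Call a triple $(V,c,f)$ admissible if $c>0$; $V\in C^2(\mathbb{R}^n)$ is radial, satisfies $\nabla^2V(x)-cI_n\ge 0$ for all $x\in\mathbb{R}^n$, and $\mathrm{d}\mu_V=e^{-V}\,\mathrm{d}x$ is a probability measure on $\mathbb{R}^n$; and $f\in W^{1,2}(\mathbb{R}^n,\mu_V)$ is positive, log-concave and radial. (i) (Stability) There exists a constant $C_n>0$ depending only on $n$ such that for every admissible triple $(V,c,f)$, $$\int_{\mathbb{R}^n}\left|\frac{f^2(x)}{\alpha}-1\right|\,\mathrm{d}\mu_V(x)\le C_n\cdot\left(\delta^{\sf LSI}_{\mu_V}(f)\right)^{\frac12},\qquad \alpha=\int_{\mathbb{R}^n}f^2\,\mathrm{d}\mu_V.$$ (ii) (Optimality) The exponent $\frac12$ in (i) cannot be replaced by a larger absolute constant: there do not exist an absolute constant $\eta>\frac12$ and a constant $C_n>0$ depending only on $n$ such that $$\int_{\mathbb{R}^n}\left|\frac{f^2(x)}{\alpha}-1\right|\,\mathrm{d}\mu_V(x)\le C_n\cdot\left(\delta^{\sf LSI}_{\mu_V}(f)\right)^{\eta},\qquad \alpha=\int_{\mathbb{R}^n}f^2\,\mathrm{d}\mu_V,$$ for every admissible triple $(V,c,f)$.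
   Context: $I_n$ is the $n\times n$ identity matrix, $\nabla^2V$ is the Hessian of $V$, and $A\ge 0$ means that the symmetric matrix $A$ is positive semi-definite. A function $h$ on $\mathbb{R}^n$ is radial if $h(\tau x)=h(x)$ for all $x\in\mathbb{R}^n$ and all $\tau\in O(n)$. $W^{1,2}(\mathbb{R}^n,\mu_V)$ is the family of functions $f\in L^2(\mathbb{R}^n,\mu_V)$ with $|\nabla f|\in L^2(\mathbb{R}^n,\mu_V)$. The entropy of $f^2$ with respect to $\mu_V$ is $$\mathrm{Ent}_{\mu_V}(f^2)=\int_{\mathbb{R}^n}f^2\log f^2\,\mathrm{d}\mu_V-\left(\int_{\mathbb{R}^n}f^2\,\mathrm{d}\mu_V\right)\log\left(\int_{\mathbb{R}^n}f^2\,\mathrm{d}\mu_V\right).$$ The Bakry--Émery log-Sobolev deficit of $f\in W^{1,2}(\mathbb{R}^n,\mu_V)\setminus\{0\}$ (with respect to the given constant $c$) is $$\delta^{\sf LSI}_{\mu_V}(f)=\frac{\frac{2}{c}\int_{\mathbb{R}^n}|\nabla f|^2\,\mathrm{d}\mu_V-\mathrm{Ent}_{\mu_V}(f^2)}{\int_{\mathbb{R}^n}f^2\,\mathrm{d}\mu_V},$$ which is nonnegative by the Bakry--Émery log-Sobolev inequality. *)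

theory Defs
  imports "HOL-Probability.Probability"
begin

definition partial_derivative :: "'n \<Rightarrow> (real^'n::finite \<Rightarrow> real) \<Rightarrow> real^'n \<Rightarrow> real" where
  "partial_derivative i h x = frechet_derivative h (at x) (axis i 1)"

primrec C_k :: "nat \<Rightarrow> (real^'n::finite \<Rightarrow> real) \<Rightarrow> bool" where
  "C_k 0 h \<longleftrightarrow> continuous_on UNIV h"
| "C_k (Suc k) h \<longleftrightarrow> h differentiable_on UNIV \<and> (\<forall>i. C_k k (partial_derivative i h))"

definition hessian :: "(real^'n::finite \<Rightarrow> real) \<Rightarrow> real^'n \<Rightarrow> real^'n^'n" where
  "hessian h x = (\<chi> i j. partial_derivative i (partial_derivative j h) x)"

definition pos_semidef :: "real^'n^'n::finite \<Rightarrow> bool" where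
  "pos_semidef A \<longleftrightarrow> transpose A = A \<and> (\<forall>v. v \<bullet> (A *v v) \<ge> 0)"

definition radial :: "(real^'n::finite \<Rightarrow> real) \<Rightarrow> bool" where
  "radial h \<longleftrightarrow> (\<forall>\<tau>. orthogonal_transformation \<tau> \<longrightarrow> (\<forall>x. h (\<tau> x) = h x))"

definition log_concave :: "(real^'n::finite \<Rightarrow> real) \<Rightarrow> bool" where
  "log_concave f \<longleftrightarrow> concave_on UNIV (\<lambda>x. ln (f x))"
  \<comment> \<open>only meaningful for functions that are positive everywhere\<close>

definition \<mu> :: "(real^'n::finite \<Rightarrow> real) \<Rightarrow> (real^'n) measure" where
  "\<mu> V = density lborel (\<lambda>x. ennreal (exp (- V x)))"

definition locally_integrable :: "(real^'n::finite \<Rightarrow> 'b::euclidean_space) \<Rightarrow> bool" where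
  "locally_integrable h \<longleftrightarrow> h \<in> borel_measurable borel \<and> (\<forall>K. compact K \<longrightarrow> set_integrable lborel K h)"

text \<open>
  The gradient is the distributional one. Test functions are compactly supported and of class
  \<open>C\<^sup>1\<close>; by mollification these give the same notion as smooth ones.
\<close>

definition has_weak_gradient :: "(real^'n::finite \<Rightarrow> real) \<Rightarrow> (real^'n \<Rightarrow> real^'n) \<Rightarrow> bool" where
  "has_weak_gradient f g \<longleftrightarrow> locally_integrable f \<and> locally_integrable g \<and>
     (\<forall>\<phi>. C_k 1 \<phi> \<and> compact (closure {x. \<phi> x \<noteq> 0}) \<longrightarrow>
       (\<forall>i. (LINT x|lborel. f x * partial_derivative i \<phi> x) = - (LINT x|lborel. g x $ i * \<phi> x)))"

text \<open>
  A weak gradient is unique up to null sets, so integrals of the representative chosen here do not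
  depend on the choice.
\<close>

definition weak_grad :: "(real^'n::finite \<Rightarrow> real) \<Rightarrow> real^'n \<Rightarrow> real^'n" where
  "weak_grad f = (SOME g. has_weak_gradient f g)"

definition L2 :: "(real^'n::finite) measure \<Rightarrow> (real^'n \<Rightarrow> real) set" where
  "L2 M = {f. f \<in> borel_measurable M \<and> integrable M (\<lambda>x. (f x)\<^sup>2)}"

definition W12 :: "(real^'n::finite) measure \<Rightarrow> (real^'n \<Rightarrow> real) set" where
  "W12 M = {f \<in> L2 M. (\<exists>g. has_weak_gradient f g) \<and> (\<lambda>x. norm (weak_grad f x)) \<in> L2 M}"

text \<open>Entropy of \<open>f\<^sup>2\<close>, as a function of \<open>f\<close>.\<close>

definition Ent_sq :: "(real^'n::finite) measure \<Rightarrow> (real^'n \<Rightarrow> real) \<Rightarrow> real" where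
  "Ent_sq M f = (LINT x|M. (f x)\<^sup>2 * ln ((f x)\<^sup>2))
                - (LINT x|M. (f x)\<^sup>2) * ln (LINT x|M. (f x)\<^sup>2)"

definition LSI_deficit :: "(real^'n::finite \<Rightarrow> real) \<Rightarrow> real \<Rightarrow> (real^'n \<Rightarrow> real) \<Rightarrow> real" where
  "LSI_deficit V c f =
     (2 / c * (LINT x|\<mu> V. (norm (weak_grad f x))\<^sup>2) - Ent_sq (\<mu> V) f) / (LINT x|\<mu> V. (f x)\<^sup>2)"

definition admissible :: "(real^'n::finite \<Rightarrow> real) \<Rightarrow> real \<Rightarrow> (real^'n \<Rightarrow> real) \<Rightarrow> bool" where
  "admissible V c f \<longleftrightarrow>
     c > 0 \<and>
     C_k 2 V \<and> radial V \<and> (\<forall>x. pos_semidef (hessian V x - c *\<^sub>R mat 1)) \<and> prob_space (\<mu> V) \<and>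
     f \<in> W12 (\<mu> V) \<and> (\<forall>x. f x > 0) \<and> log_concave f \<and> radial f"

definition L1_distance :: "(real^'n::finite \<Rightarrow> real) \<Rightarrow> (real^'n \<Rightarrow> real) \<Rightarrow> real" where
  "L1_distance V f =
     (let \<alpha> = (LINT x|\<mu> V. (f x)\<^sup>2) in LINT x|\<mu> V. \<bar>(f x)\<^sup>2 / \<alpha> - 1\<bar>)"

end

theory Submission
  imports Defs
begin

text \<open>
  Both parts concern radial functions, so the problem lives on the half-line. Write
  \<open>V x = v \<bar>x\<bar>\<close> and \<open>f\<^sup>2 / \<alpha> = exp (- w \<bar>x\<bar>)\<close>, where \<open>v\<close> and \<open>w\<close> are convex and nondecreasing
  on the half-line, let \<open>\<nu>\<close> be the probability measure with density \<open>f\<^sup>2 / \<alpha>\<close> with respect to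
  \<open>\<mu> = \<mu> V\<close>, and let \<open>g\<close> and \<open>p\<close> be the densities of \<open>\<bar>x\<bar>\<close> under \<open>\<mu>\<close> and \<open>\<nu>\<close>. Then the deficit is
  \<open>\<integral> (w'\<^sup>2 / (2 c) + w) d\<nu>\<close>: the first term is the Fisher information over \<open>2 c\<close>, the
  second one is minus the relative entropy of \<open>\<nu>\<close> with respect to \<open>\<mu>\<close>.

  Stability. Let \<open>T\<close> be the increasing map of the half-line that transports \<open>p\<close> to \<open>g\<close>. The map
  \<open>x \<mapsto> T \<bar>x\<bar> x / \<bar>x\<bar>\<close> is the optimal transport map from \<open>\<nu>\<close> to \<open>\<mu>\<close>; its derivative has the
  eigenvalue \<open>T'\<close> once and the eigenvalue \<open>T r / r\<close> with multiplicity \<open>n - 1\<close>. Taking the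
  logarithm of \<open>g (T r) T' r = p r\<close>, using the \<open>c\<close>-convexity of \<open>v\<close>, integrating by parts and
  completing a square in \<open>w'\<close>, which is the transport proof of the log-Sobolev inequality, gives
  \<open>deficit \<ge> \<integral> (\<phi> (T') + (n - 1) \<phi> (T r / r)) p dr\<close> with \<open>\<phi> x = x - 1 - ln x \<ge> 0\<close>.

  The right-hand side controls the square of \<open>D\<close>, half of the \<open>L\<^sup>1\<close> distance. As \<open>w\<close> is
  nondecreasing, the balls \<open>B\<close> around the origin are superlevel sets of the density of \<open>\<nu>\<close>, and this
  forces \<open>\<nu> B - \<mu> B \<ge> D \<nu> B (1 - \<nu> B)\<close> for each of them (lemma \<open>superlevel_excess\<close>). For the
  ball of radius \<open>r\<close> the left-hand side is the \<open>\<mu>\<close>-mass of the shell between \<open>r\<close> and \<open>T r\<close>, which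
  is at most \<open>n ln (T r / r)\<close> because \<open>r g r \<le> n\<close>. If \<open>n \<ge> 2\<close> this suffices, as
  \<open>\<phi> x \<ge> (ln x)\<^sup>2 / 2\<close> for \<open>x \<ge> 1\<close>. If \<open>n = 1\<close> only \<open>T'\<close> is available; there a linear lower
  bound of \<open>\<phi>\<close> with a weight adapted to \<open>p\<close>, followed by an integration by parts, replaces \<open>T'\<close> by
  the displacement \<open>T r - r\<close>. The weight is bounded because \<open>p\<close> is log-concave. The outcome is the
  explicit bound of theorem \<open>LSI_deficit_ge_L1_distance_square\<close>.

  To apply this to \<open>f\<close>, the weak gradient has to be identified: weak gradients are unique almost
  everywhere (\<open>weak_gradient_unique\<close>), and a locally Lipschitz radial function has its classical
  radial derivative as a weak gradient (\<open>radial_has_weak_gradient\<close>).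

  Optimality. For \<open>V = \<bar>x\<bar>\<^sup>2 + const\<close>, \<open>c = 2\<close> and \<open>f\<^sup>2 = exp (- \<epsilon> \<bar>x\<bar>\<^sup>2)\<close> the Dirichlet energy is of
  order \<open>\<epsilon>\<^sup>2\<close> and the entropy is nonnegative, so the deficit is at most of order \<open>\<epsilon>\<^sup>2\<close>, whereas the
  \<open>L\<^sup>1\<close> distance is at least of order \<open>\<epsilon>\<close>.
\<close>

section \<open>Convex and Lipschitz functions of one variable\<close>

lemma convex_subgradient:
  fixes w :: "real \<Rightarrow> real"
  assumes "convex_on UNIV w"
  obtains q where "\<And>x y. w y \<ge> w x + q x * (y - x)"
proof
  fix x y
  show "w y \<ge> w x + (\<lambda>x. Inf ((\<lambda>t. (w x - w t) / (x - t)) ` ({x<..} \<inter> UNIV))) x * (y - x)"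
    using convex_le_Inf_differential[OF assms, of x y] by simp
qed

lemma subgradient_mono:
  fixes w q :: "real \<Rightarrow> real"
  assumes sub: "\<And>x y. w y \<ge> w x + q x * (y - x)"
  shows "mono q"
proof (rule monoI)
  fix x y :: real assume "x \<le> y"
  show "q x \<le> q y"
  proof (cases "x = y")
    case False
    have "q x * (y - x) \<le> q y * (y - x)"
      using sub[of x y] sub[of y x] by (simp add: algebra_simps)
    then show ?thesis using False \<open>x \<le> y\<close> by simp
  qed simp
qed

text \<open>
  The difference quotient of \<open>w\<close> between \<open>x\<close> and \<open>y\<close> lies between \<open>q x\<close> and \<open>q y\<close>. Since a monotone
  function has only countably many discontinuities, a convex function is differentiable off a
  countable set, with any subgradient selection as its derivative.
\<close>

lemma subgradient_DERIV:
  fixes w q :: "real \<Rightarrow> real"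
  assumes sub: "\<And>x y. w y \<ge> w x + q x * (y - x)" and "isCont q x"
  shows "(w has_real_derivative q x) (at x)"
proof -
  have "((\<lambda>y. (w y - w x) / (y - x)) \<longlongrightarrow> q x) (at x)"
  proof (rule real_tendsto_sandwich)
    have lim: "(q \<longlongrightarrow> q x) (at x)"
      using assms(2) by (simp add: isCont_def)
    have lim2: "((\<lambda>y. q x) \<longlongrightarrow> q x) (at x)" by simp
    show "((\<lambda>y. min (q x) (q y)) \<longlongrightarrow> q x) (at x)"
      using tendsto_min[OF lim2 lim] by simp
    show "((\<lambda>y. max (q x) (q y)) \<longlongrightarrow> q x) (at x)"
      using tendsto_max[OF lim2 lim] by simp
    have *: "min (q x) (q y) \<le> (w y - w x) / (y - x) \<and> (w y - w x) / (y - x) \<le> max (q x) (q y)"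
      if "y \<noteq> x" for y
    proof -
      have a: "q x * (y - x) \<le> w y - w x" and b: "w y - w x \<le> q y * (y - x)"
        using sub[of x y] sub[of y x] by (simp_all add: algebra_simps)
      show ?thesis
      proof (cases "y > x")
        case True
        then have "q x \<le> (w y - w x) / (y - x)" "(w y - w x) / (y - x) \<le> q y"
          using a b by (simp_all add: field_simps)
        then show ?thesis by auto
      next
        case False
        then have "y < x" using that by simp
        then have "q x \<ge> (w y - w x) / (y - x)" "(w y - w x) / (y - x) \<ge> q y"
          using a b by (simp_all add: field_simps)
        then show ?thesis by auto
      qed
    qed
    show "\<forall>\<^sub>F y in at x. min (q x) (q y) \<le> (w y - w x) / (y - x)"
      "\<forall>\<^sub>F y in at x. (w y - w x) / (y - x) \<le> max (q x) (q y)"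
      using * by (auto simp: eventually_at_filter)
  qed
  then show ?thesis by (simp add: has_field_derivative_iff)
qed

lemma subgradient_lipschitz:
  fixes w q :: "real \<Rightarrow> real"
  assumes sub: "\<And>x y. w y \<ge> w x + q x * (y - x)"
  shows "(max \<bar>q a\<bar> \<bar>q b\<bar>)-lipschitz_on {a..b} w"
proof (rule lipschitz_onI)
  fix x y assume xy: "x \<in> {a..b}" "y \<in> {a..b}"
  have m: "mono q" by (rule subgradient_mono[OF sub])
  have bd: "\<bar>q z\<bar> \<le> max \<bar>q a\<bar> \<bar>q b\<bar>" if "z \<in> {a..b}" for z
    using monoD[OF m, of a z] monoD[OF m, of z b] that by auto
  have a: "q x * (y - x) \<le> w y - w x" and b: "w y - w x \<le> q y * (y - x)"
    using sub[of x y] sub[of y x] by (simp_all add: algebra_simps)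
  have "\<bar>w y - w x\<bar> \<le> max \<bar>q x * (y - x)\<bar> \<bar>q y * (y - x)\<bar>"
    using a b by linarith
  also have "\<dots> \<le> max \<bar>q a\<bar> \<bar>q b\<bar> * \<bar>y - x\<bar>"
    using bd[OF xy(1)] bd[OF xy(2)] by (simp only: abs_mult max.bounded_iff) (simp add: mult_right_mono)
  finally show "dist (w x) (w y) \<le> max \<bar>q a\<bar> \<bar>q b\<bar> * dist x y"
    by (simp add: dist_real_def abs_minus_commute)
qed (auto simp: le_max_iff_disj)

lemma subgradient_continuous:
  fixes w q :: "real \<Rightarrow> real"
  assumes sub: "\<And>x y. w y \<ge> w x + q x * (y - x)"
  shows "isCont w x"
proof -
  have "continuous_on {x-1..x+1} w"
    using subgradient_lipschitz[OF sub] lipschitz_on_continuous_on by blast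
  then show ?thesis by (rule continuous_on_interior) auto
qed

text \<open>
  The increments \<open>(X (x + h) - X x) / h\<close> integrate over \<open>{a..b}\<close> to a difference of two averages of
  \<open>X\<close>, over \<open>{b..b + h}\<close> and \<open>{a..a + h}\<close>, which tends to \<open>X b - X a\<close>. The Lipschitz bound
  dominates them, so the limit may be taken under the integral. The room \<open>b < b'\<close> keeps \<open>x + h\<close> inside
  the interval of control.
\<close>

lemma lipschitz_FTC:
  fixes X X' :: "real \<Rightarrow> real"
  assumes ab: "a \<le> b" "b < b'" and lip: "L-lipschitz_on {a..b'} X"
    and der: "AE x in lborel. x \<in> {a..b} \<longrightarrow> (X has_real_derivative X' x) (at x)"
    and [measurable]: "X' \<in> borel_measurable borel"
  shows "set_integrable lborel {a..b} X'" "(LBINT x:{a..b}. X' x) = X b - X a"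
proof -
  define h where "h n = (b' - b) / real (Suc n)" for n
  have h: "0 < h n" "h n \<le> b' - b" for n
    using ab by (auto simp: h_def field_simps mult_right_mono)
  have h0: "h \<longlonglongrightarrow> 0"
    unfolding h_def by real_asymp
  have cont: "continuous_on {a..b'} X" using lip by (rule lipschitz_on_continuous_on)
  define Y where "Y x = X (min b' (max a x))" for x
  have contY: "continuous_on UNIV Y"
    unfolding Y_def by (rule continuous_on_compose2[OF cont]) (use ab in \<open>auto intro!: continuous_intros\<close>)
  then have [measurable]: "Y \<in> borel_measurable borel"
    by (rule borel_measurable_continuous_onI)
  have Yeq: "Y x = X x" if "x \<in> {a..b'}" for x using that by (auto simp: Y_def)
  let ?f = "\<lambda>n x. indicator {a..b} x *\<^sub>R ((Y (x + h n) - Y x) / h n)"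
  have bd: "norm (?f n x) \<le> indicator {a..b} x *\<^sub>R L" for n x
  proof (cases "x \<in> {a..b}")
    case True
    have "\<bar>X (x + h n) - X x\<bar> \<le> L * \<bar>h n\<bar>"
      using lipschitz_onD[OF lip, of "x + h n" x] True h[of n] ab by (auto simp: dist_real_def)
    then show ?thesis using True h[of n] ab by (auto simp: Yeq field_simps)
  qed auto
  have conv: "AE x in lborel. (\<lambda>n. ?f n x) \<longlonglongrightarrow> indicator {a..b} x *\<^sub>R X' x"
    using der AE_lborel_singleton[of b] AE_lborel_singleton[of a]
  proof eventually_elim
    case (elim x)
    show ?case
    proof (cases "x \<in> {a..b}")
      case True
      then have D: "(X has_real_derivative X' x) (at x)" using elim by auto
      have "((\<lambda>y. (X (x + y) - X x) / y) \<longlongrightarrow> X' x) (at 0)"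
        using D by (simp add: DERIV_def)
      moreover have "filterlim h (at 0) sequentially"
        using h0 h(1) by (auto simp: filterlim_at less_imp_neq[symmetric])
      ultimately have "(\<lambda>n. (X (x + h n) - X x) / h n) \<longlonglongrightarrow> X' x"
        by (rule filterlim_compose)
      moreover have "Y (x + h n) = X (x + h n)" "Y x = X x" for n
        using True h[of n] ab by (auto intro!: Yeq)
      ultimately show ?thesis using True by simp
    qed simp
  qed
  have intL: "integrable lborel (\<lambda>x. indicator {a..b} x *\<^sub>R L)"
    by (intro integrable_scaleR_left) (auto simp: integrable_indicator_iff emeasure_lborel_Icc_eq)
  have "integrable lborel (\<lambda>x. indicator {a..b} x *\<^sub>R X' x)"
    "(\<lambda>n. LINT x|lborel. ?f n x) \<longlonglongrightarrow> (LINT x|lborel. indicator {a..b} x *\<^sub>R X' x)"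
    by (rule integrable_dominated_convergence[OF _ _ intL conv] integral_dominated_convergence[OF _ _ intL conv];
        use bd in auto)+
  moreover have "(LINT x|lborel. ?f n x) = (integral {b..b + h n} X) / h n - (integral {a..a + h n} X) / h n" for n
  proof -
    have i: "set_integrable lborel {u..v} Y" for u v
      by (rule borel_integrable_atLeastAtMost') (rule continuous_on_subset[OF contY], simp)
    have i2: "set_integrable lborel {a..b} (\<lambda>x. Y (x + h n))"
      by (rule borel_integrable_atLeastAtMost') (intro continuous_on_compose2[OF contY] continuous_intros, auto)
    have io: "Y integrable_on {u..v}" for u v
      by (rule integrable_continuous_real) (rule continuous_on_subset[OF contY], simp)
    have "(LINT x|lborel. ?f n x) = (LBINT x:{a..b}. (Y (x + h n) - Y x)) / h n"
      unfolding set_lebesgue_integral_def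
      by (simp only: integral_divide_zero[symmetric] real_scaleR_def times_divide_eq_right)
    also have "(LBINT x:{a..b}. (Y (x + h n) - Y x)) = (LBINT x:{a..b}. Y (x + h n)) - (LBINT x:{a..b}. Y x)"
      using i i2 by (rule set_integral_diff(2)[rotated])
    also have "(LBINT x:{a..b}. Y (x + h n)) = integral {a..b} (\<lambda>x. Y (x + h n))"
      by (rule set_borel_integral_eq_integral(2)[OF i2])
    also have "\<dots> = integral {a + h n..b + h n} Y"
      using has_integral_affinity'[of Y _ "a + h n" "b + h n" 1 "h n"]
        integrable_integral[OF io[of "a + h n" "b + h n"]] by (auto intro!: integral_unique)
    also have "(LBINT x:{a..b}. Y x) = integral {a..b} Y"
      by (rule set_borel_integral_eq_integral(2)[OF i])
    also have "integral {a + h n..b + h n} Y - integral {a..b} Y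
       = integral {b..b + h n} Y - integral {a..a + h n} Y"
      using Henstock_Kurzweil_Integration.integral_combine[of a b "b + h n" Y, OF _ _ io] ab h[of n]
        Henstock_Kurzweil_Integration.integral_combine[of a "a + h n" "b + h n" Y, OF _ _ io] by auto
    also have "integral {b..b + h n} Y = integral {b..b + h n} X"
      by (rule Henstock_Kurzweil_Integration.integral_cong) (use h[of n] ab in \<open>auto intro!: Yeq\<close>)
    also have "integral {a..a + h n} Y = integral {a..a + h n} X"
      by (rule Henstock_Kurzweil_Integration.integral_cong) (use h[of n] ab in \<open>auto intro!: Yeq\<close>)
    finally show ?thesis by (simp add: diff_divide_distrib)
  qed
  moreover have "(\<lambda>n. (integral {c..c + h n} X) / h n) \<longlonglongrightarrow> X c" if c: "a \<le> c" "c \<le> b" for c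
  proof -
    have "((\<lambda>x. integral {c..x} X) has_real_derivative X c) (at c within {c..b'})"
      using c ab by (intro integral_has_real_derivative continuous_on_subset[OF cont]) auto
    then have "((\<lambda>x. (integral {c..x} X - integral {c..c} X) / (x - c)) \<longlongrightarrow> X c) (at c within {c..b'})"
      by (simp add: has_field_derivative_iff)
    moreover have "filterlim (\<lambda>n. c + h n) (at c within {c..b'}) sequentially"
    proof -
      have "c \<le> c + h n" "c + h n \<le> b'" "c + h n \<noteq> c" for n
        using h[of n] c by linarith+
      moreover have "(\<lambda>n. c + h n) \<longlonglongrightarrow> c"
        using tendsto_add[OF tendsto_const[of c] h0] by simp
      ultimately show ?thesis by (simp add: filterlim_at)
    qed
    ultimately show ?thesis
      by (drule_tac filterlim_compose) auto
  qed
  ultimately show "set_integrable lborel {a..b} X'" "(LBINT x:{a..b}. X' x) = X b - X a"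
    using ab unfolding set_integrable_def set_lebesgue_integral_def
    by (auto intro!: LIMSEQ_unique[of "\<lambda>n. LINT x|lborel. ?f n x"] tendsto_diff)
qed

lemma C1_imp_lipschitz:
  fixes f f' :: "real \<Rightarrow> real"
  assumes "\<And>x. x \<in> {a..b} \<Longrightarrow> (f has_real_derivative f' x) (at x)" "continuous_on {a..b} f'"
  shows "\<exists>L. L-lipschitz_on {a..b} f"
proof -
  have "bounded (f' ` {a..b})"
    using assms(2) by (intro compact_imp_bounded compact_continuous_image) auto
  then obtain B where B: "\<And>x. x \<in> {a..b} \<Longrightarrow> norm (f' x) \<le> B" unfolding bounded_iff by (metis image_eqI)
  have "(max 0 B)-lipschitz_on {a..b} f"
  proof (rule lipschitz_onI)
    fix x y assume "x \<in> {a..b}" "y \<in> {a..b}"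
    then have "norm (f x - f y) \<le> max 0 B * norm (x - y)"
      by (intro field_differentiable_bound[where S="{a..b}" and f'=f'])
        (use assms(1) B in \<open>auto intro: has_field_derivative_at_within simp: le_max_iff_disj\<close>)
    then show "dist (f x) (f y) \<le> max 0 B * dist x y" by (simp add: dist_norm)
  qed simp
  then show ?thesis by blast
qed

lemma lipschitz_mult:
  fixes f h :: "real \<Rightarrow> real"
  assumes "\<exists>L. L-lipschitz_on {a..b} f" "\<exists>L. L-lipschitz_on {a..b} h"
  shows "\<exists>L. L-lipschitz_on {a..b} (\<lambda>x. f x * h x)"
proof -
  from assms obtain K L where K: "K-lipschitz_on {a..b} f" and L: "L-lipschitz_on {a..b} h" by blast
  have "bounded (f ` {a..b})" "bounded (h ` {a..b})"
    using K L by (auto intro!: compact_imp_bounded compact_continuous_image lipschitz_on_continuous_on)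
  then obtain A B where A: "\<And>x. x \<in> {a..b} \<Longrightarrow> norm (f x) \<le> A" and B: "\<And>x. x \<in> {a..b} \<Longrightarrow> norm (h x) \<le> B"
    unfolding bounded_iff by (metis image_eqI)
  have "(max 0 A * L + max 0 B * K)-lipschitz_on {a..b} (\<lambda>x. f x * h x)"
  proof (rule lipschitz_onI)
    fix x y assume xy: "x \<in> {a..b}" "y \<in> {a..b}"
    have "f x * h x - f y * h y = f x * (h x - h y) + h y * (f x - f y)" by (simp add: algebra_simps)
    then have "\<bar>f x * h x - f y * h y\<bar> \<le> \<bar>f x\<bar> * \<bar>h x - h y\<bar> + \<bar>h y\<bar> * \<bar>f x - f y\<bar>"
      by (metis abs_mult abs_triangle_ineq)
    also have "\<dots> \<le> max 0 A * (L * \<bar>x - y\<bar>) + max 0 B * (K * \<bar>x - y\<bar>)"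
      using A[OF xy(1)] B[OF xy(2)] lipschitz_onD[OF K xy] lipschitz_onD[OF L xy]
      by (intro add_mono mult_mono) (auto simp: dist_real_def)
    finally show "dist (f x * h x) (f y * h y) \<le> (max 0 A * L + max 0 B * K) * dist x y"
      by (simp add: dist_real_def algebra_simps)
  qed (use lipschitz_on_nonneg[OF K] lipschitz_on_nonneg[OF L] in auto)
  then show ?thesis by blast
qed

lemma lipschitz_exp_minus:
  fixes w :: "real \<Rightarrow> real"
  assumes "L-lipschitz_on {a..b} w"
  shows "\<exists>K. K-lipschitz_on {a..b} (\<lambda>x. exp (- w x))"
proof -
  have "bounded (w ` {a..b})"
    using assms by (auto intro!: compact_imp_bounded compact_continuous_image lipschitz_on_continuous_on)
  then obtain B where B: "\<And>x. x \<in> {a..b} \<Longrightarrow> norm (w x) \<le> B" unfolding bounded_iff by (metis image_eqI)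
  have "\<exists>K. K-lipschitz_on {-B..B} (\<lambda>x. exp (- x))"
    by (rule C1_imp_lipschitz[where f'="\<lambda>x. - exp (- x)"])
      (auto intro!: derivative_eq_intros continuous_intros)
  then obtain K where "K-lipschitz_on {-B..B} (\<lambda>x. exp (- x))" ..
  then have "K-lipschitz_on (w ` {a..b}) (\<lambda>x. exp (- x))"
    by (rule lipschitz_on_subset) (use B in \<open>force simp: abs_le_iff\<close>)
  from lipschitz_on_compose2[OF assms this] show ?thesis by blast
qed

text \<open>
  A supporting line at \<open>r\<close> lies below \<open>u\<close> at both \<open>s\<close> and \<open>- s\<close>, where \<open>u\<close> has the same value; one of
  the two ends of the line is at least as high as \<open>u r\<close>.
\<close>

lemma even_convex_mono:
  fixes u d :: "real \<Rightarrow> real"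
  assumes sub: "\<And>x y. u x + d x * (y - x) \<le> u y" and even: "\<And>x. u (- x) = u x" and "0 \<le> r" "r \<le> s"
  shows "u r \<le> u s"
proof (cases "0 \<le> d r")
  case True
  then have "0 \<le> d r * (s - r)" using assms by simp
  then show ?thesis using sub[of r s] by linarith
next
  case False
  then have "0 \<le> d r * (- s - r)" using assms by (intro mult_nonpos_nonpos) auto
  then show ?thesis using sub[of r "- s"] even[of s] by linarith
qed

section \<open>Superlevel sets and total variation\<close>

lemma integral_strict_pos:
  fixes h :: "'a \<Rightarrow> real"
  assumes "integrable M h" "\<And>x. 0 < h x" "emeasure M (space M) \<noteq> 0"
  shows "0 < (LINT x|M. h x)"
proof (rule ccontr)
  assume "\<not> 0 < (LINT x|M. h x)"
  moreover have "0 \<le> (LINT x|M. h x)" using assms(2) by (simp add: less_imp_le)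
  ultimately have "(LINT x|M. h x) = 0" by simp
  then have "AE x in M. h x = 0"
    using assms(1,2) by (subst (asm) integral_nonneg_eq_0_iff_AE) (auto simp: less_imp_le)
  then have "AE x in M. False" by eventually_elim (use assms(2) in \<open>metis less_irrefl\<close>)
  then have "emeasure M (space M) = 0"
    by (subst AE_iff_measurable[symmetric, where P="\<lambda>_. False"]) auto
  then show False using assms(3) by simp
qed

text \<open>
  The set \<open>A\<close> is a superlevel set of \<open>h\<close>, at level \<open>y\<close>, and \<open>D\<close> is the total variation distance
  between \<open>M\<close> and the measure with density \<open>h\<close>. The set where \<open>h > 1\<close> has excess mass exactly \<open>D\<close>;
  the lemma says that every other superlevel set retains a definite part of it. If \<open>y \<ge> 1\<close>, the excess
  of \<open>A\<close> misses at most \<open>(1 - 1 / y) (1 - nu)\<close> of \<open>D\<close> and is itself at least \<open>(1 - 1 / y) nu\<close>; adding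
  these two bounds with weights \<open>nu\<close> and \<open>1 - nu\<close> gives the claim. If \<open>y < 1\<close>, the deficiency of
  the complement is treated in the same way with \<open>1 - y\<close>.
\<close>

lemma superlevel_excess:
  fixes h :: "'a \<Rightarrow> real"
  assumes "prob_space M" and int: "integrable M h" and one: "(LINT x|M. h x) = 1"
    and A[measurable]: "A \<in> sets M" and y: "y > 0"
    and hi: "\<And>x. x \<in> A \<Longrightarrow> h x \<ge> y" and lo: "\<And>x. x \<in> space M \<Longrightarrow> x \<notin> A \<Longrightarrow> h x \<le> y"
    and nonneg: "\<And>x. h x \<ge> 0"
    and D: "D = (LINT x|M. \<bar>h x - 1\<bar>) / 2" and nu: "nu = (LINT x|M. indicator A x * h x)"
  shows "D * (nu * (1 - nu)) \<le> nu - measure M A" "D \<le> 1" "0 \<le> nu" "nu \<le> 1" "0 \<le> D" "measure M A \<le> nu"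
proof -
  interpret prob_space M by fact
  let ?m = "measure M A"
  have [measurable]: "h \<in> borel_measurable M" using int by simp
  define P where "P = (\<lambda>x. max 0 (h x - 1))"
  have iP: "integrable M P" unfolding P_def using int by (intro integrable_max) auto
  have iA: "integrable M (\<lambda>x. indicator A x * h x)" using integrable_mult_indicator[OF A int] by simp
  have iPA: "integrable M (\<lambda>x. indicator A x * P x)" using integrable_mult_indicator[OF A iP] by simp
  have iI: "integrable M (indicator A :: _ \<Rightarrow> real)" by (simp add: integrable_indicator_iff emeasure_eq_measure)
  have D0: "0 \<le> D" unfolding D by simp
  have "\<bar>h x - 1\<bar> = 2 * P x - (h x - 1)" for x by (simp add: P_def abs_if max_def)
  then have DP: "D = (LINT x|M. P x)" unfolding D using iP int one by (simp add: prob_space)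
  show "0 \<le> D" by fact
  have "(LINT x|M. P x) \<le> (LINT x|M. h x)"
    by (rule integral_mono[OF iP int]) (use nonneg in \<open>auto simp: P_def\<close>)
  then show "D \<le> 1" using DP one by simp
  show nu0: "0 \<le> nu" unfolding nu using nonneg by simp
  have "nu \<le> (LINT x|M. h x)" unfolding nu
    by (rule integral_mono[OF iA int]) (use nonneg in \<open>auto simp: indicator_def\<close>)
  then show nu1: "nu \<le> 1" using one by simp
  have m1: "?m \<le> 1" "0 \<le> ?m" by auto
  have compl: "(LINT x|M. (1 - indicator A x) * h x) = 1 - nu"
    using int iA one by (simp add: nu left_diff_distrib)
  have Delta: "(LINT x|M. indicator A x * (h x - 1)) = nu - ?m"
    using iA iI by (simp add: nu right_diff_distrib emeasure_eq_measure)
  have main: "?m \<le> nu \<and> D * (nu * (1 - nu)) \<le> nu - ?m"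
  proof (cases "y \<ge> 1")
    case True
    \<comment> \<open>Both estimates below rewrite \<open>h - 1\<close> as \<open>(1 - 1 / h) h\<close> and compare \<open>1 / h\<close> with \<open>1 / y\<close>.\<close>
    define k where "k = 1 - 1 / y"
    have k: "0 \<le> k" using True by (simp add: k_def)
    have "D = (LINT x|M. indicator A x * (h x - 1)) + (LINT x|M. (1 - indicator A x) * P x)"
    proof -
      have "(\<lambda>x. indicator A x * (h x - 1)) = (\<lambda>x. indicator A x * P x)"
        using hi True by (fastforce simp: P_def indicator_def)
      then show ?thesis unfolding DP using iP iPA by (simp only:) (simp add: left_diff_distrib)
    qed
    also have "(LINT x|M. (1 - indicator A x) * P x) \<le> (LINT x|M. k * ((1 - indicator A x) * h x))"
    proof (rule integral_mono)
      fix x assume "x \<in> space M"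
      show "(1 - indicator A x) * P x \<le> k * ((1 - indicator A x) * h x)"
      proof (cases "x \<in> A")
        case False
        have "h x / y \<le> 1" using lo[OF \<open>x \<in> space M\<close> False] y by simp
        moreover have "h x / y \<le> h x / 1" using nonneg[of x] True by (intro divide_left_mono) auto
        ultimately show ?thesis using False by (simp add: P_def k_def left_diff_distrib)
      qed simp
    qed (use iP iPA int iA in \<open>auto simp: left_diff_distrib right_diff_distrib\<close>)
    also have "\<dots> = k * (1 - nu)" using compl by simp
    finally have 1: "D \<le> (nu - ?m) + k * (1 - nu)" using Delta by simp
    have "k * nu = (LINT x|M. k * (indicator A x * h x))" unfolding nu by simp
    also have "\<dots> \<le> (LINT x|M. indicator A x * (h x - 1))"
    proof (rule integral_mono)
      fix x assume "x \<in> space M"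
      show "k * (indicator A x * h x) \<le> indicator A x * (h x - 1)"
      proof (cases "x \<in> A")
        case t: True
        have "h x / y \<ge> 1" using hi[OF t] y by simp
        then show ?thesis using t by (simp add: k_def algebra_simps)
      qed simp
    qed (use iA iI in \<open>auto simp: right_diff_distrib\<close>)
    finally have 2: "k * nu \<le> nu - ?m" using Delta by simp
    have "D * nu \<le> (nu - ?m) * nu + (k * nu) * (1 - nu)"
      using mult_right_mono[OF 1 nu0] by (simp add: algebra_simps)
    also have "\<dots> \<le> (nu - ?m) * nu + (nu - ?m) * (1 - nu)"
      using mult_right_mono[OF 2, of "1 - nu"] nu1 by simp
    finally have 3: "D * nu \<le> nu - ?m" by (simp add: algebra_simps)
    have "D * (nu * (1 - nu)) \<le> D * nu"
      using D0 nu0 nu1 by (intro mult_left_mono) (auto simp: mult_left_le)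
    moreover have "?m \<le> nu" using 2 k nu0 mult_nonneg_nonneg[OF k nu0] by linarith
    ultimately show ?thesis using 3 by simp
  next
    case False
    define k where "k = 1 - y"
    have k: "0 \<le> k" "k \<le> 1" using False y by (auto simp: k_def)
    define N where "N = (\<lambda>x. max 0 (1 - h x))"
    have iN: "integrable M N" unfolding N_def using int by (intro integrable_max) auto
    have iNA: "integrable M (\<lambda>x. indicator A x * N x)" using integrable_mult_indicator[OF A iN] by simp
    have "P = (\<lambda>x. N x + h x - 1)" by (simp add: P_def N_def max_def fun_eq_iff)
    then have DN: "D = (LINT x|M. N x)" unfolding DP using iN int one by (simp add: prob_space)
    have c2: "(LINT x|M. (1 - indicator A x) * (1 - h x)) = nu - ?m"
      using iA iI int one by (simp add: nu algebra_simps prob_space emeasure_eq_measure)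
    have "D = (LINT x|M. (1 - indicator A x) * (1 - h x)) + (LINT x|M. indicator A x * N x)"
    proof -
      have "(LINT x|M. (1 - indicator A x) * (1 - h x)) = (LINT x|M. (1 - indicator A x) * N x)"
      proof (rule Bochner_Integration.integral_cong)
        fix x assume "x \<in> space M"
        then show "(1 - indicator A x) * (1 - h x) = (1 - indicator A x) * N x"
          using lo[of x] False by (cases "x \<in> A") (auto simp: N_def max_def)
      qed simp
      then show ?thesis unfolding DN using iN iNA by (simp add: left_diff_distrib)
    qed
    also have "(LINT x|M. indicator A x * N x) \<le> (LINT x|M. k * indicator A x)"
    proof (rule integral_mono)
      fix x
      show "indicator A x * N x \<le> k * indicator A x"
        using hi[of x] k by (auto simp: N_def k_def indicator_def)
    qed (use iNA iI in auto)
    also have "\<dots> = k * ?m" by (simp add: emeasure_eq_measure)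
    finally have 1: "D \<le> (nu - ?m) + k * ?m" using c2 by simp
    have "k * (1 - ?m) = (LINT x|M. k * (1 - indicator A x))"
      by (simp add: prob_space emeasure_eq_measure)
    also have "\<dots> \<le> (LINT x|M. (1 - indicator A x) * (1 - h x))"
    proof (rule integral_mono)
      fix x assume "x \<in> space M"
      then show "k * (1 - indicator A x) \<le> (1 - indicator A x) * (1 - h x)"
        using lo[of x] by (auto simp: k_def indicator_def)
    qed (use iA iI int in \<open>auto simp: algebra_simps\<close>)
    finally have 2: "k * (1 - ?m) \<le> nu - ?m" using c2 by simp
    have ge: "?m \<le> nu" using 2 k m1 mult_nonneg_nonneg[of k "1 - ?m"] by linarith
    have "D * (1 - ?m) \<le> (nu - ?m) * (1 - ?m) + (k * (1 - ?m)) * ?m"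
      using mult_right_mono[OF 1, of "1 - ?m"] m1 by (simp add: algebra_simps)
    also have "\<dots> \<le> (nu - ?m) * (1 - ?m) + (nu - ?m) * ?m"
      using mult_right_mono[OF 2, of ?m] m1 by simp
    finally have 3: "D * (1 - ?m) \<le> nu - ?m" by (simp add: algebra_simps)
    have "D * (nu * (1 - nu)) \<le> D * (1 - ?m)"
    proof (rule mult_left_mono[OF _ D0])
      have "nu * (1 - nu) \<le> 1 * (1 - nu)" using nu1 by (intro mult_right_mono) auto
      then show "nu * (1 - nu) \<le> 1 - ?m" using ge by simp
    qed
    then show ?thesis using 3 ge by simp
  qed
  then show "D * (nu * (1 - nu)) \<le> nu - ?m" "?m \<le> nu" by auto
qed

section \<open>Monotone transport between densities on the half-line\<close>

text \<open>
  The density is a continuous function on the whole line, but only its restriction to the positive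
  half-line counts as a density. This keeps one-sided continuity at the origin out of the way.
\<close>

locale half_line_density =
  fixes d :: "real \<Rightarrow> real"
  assumes cont: "continuous_on UNIV d" and pos: "\<And>x. 0 < x \<Longrightarrow> 0 < d x"
    and prob_law: "prob_space (density lborel (\<lambda>r. ennreal (indicator {0<..} r * d r)))"
begin

definition "law = density lborel (\<lambda>r. ennreal (indicator {0<..} r * d r))"

abbreviation "F \<equiv> cdf law"

lemma meas[measurable]: "d \<in> borel_measurable borel"
  using cont by (rule borel_measurable_continuous_onI)

sublocale law: real_distribution law
  using prob_law by (auto simp: real_distribution_def real_distribution_axioms_def law_def)

lemma AE_law_pos: "AE x in law. 0 < x"
proof -
  have "AE x in lborel. 0 < ennreal (indicator {0<..} x * d x) \<longrightarrow> 0 < x"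
    by (auto simp: indicator_def)
  then show ?thesis unfolding law_def by (subst AE_density) auto
qed

lemma cdf_diff_integral:
  assumes "0 \<le> a" "a \<le> b"
  shows "F b - F a = integral {a..b} d"
proof (cases "a = b")
  case False
  then have ab: "a < b" using assms by simp
  have i: "set_integrable lborel {a..b} d"
    by (rule borel_integrable_atLeastAtMost') (rule continuous_on_subset[OF cont], simp)
  have "emeasure law {a<..b} = (\<integral>\<^sup>+x. ennreal (indicator {0<..} x * d x) * indicator {a<..b} x \<partial>lborel)"
    unfolding law_def by (subst emeasure_density) auto
  also have "\<dots> = (\<integral>\<^sup>+x. ennreal (indicator {a..b} x *\<^sub>R d x) \<partial>lborel)"
    using AE_lborel_singleton[of a] assms
    by (intro nn_integral_cong_AE) (auto elim!: eventually_mono simp: indicator_def)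
  also have "\<dots> = ennreal (LINT x:{a..b}|lborel. d x)"
    unfolding set_lebesgue_integral_def
  proof (rule nn_integral_eq_integral)
    show "integrable lborel (\<lambda>x. indicator {a..b} x *\<^sub>R d x)"
      using i by (simp add: set_integrable_def)
    show "AE x in lborel. 0 \<le> indicator {a..b} x *\<^sub>R d x"
      using AE_lborel_singleton[of 0]
      by eventually_elim (use pos assms in \<open>auto simp: indicator_def intro!: less_imp_le\<close>)
  qed
  also have "(LINT x:{a..b}|lborel. d x) = integral {a..b} d"
    by (rule set_borel_integral_eq_integral(2)[OF i])
  finally have "emeasure law {a<..b} = ennreal (integral {a..b} d)" .
  moreover have "0 \<le> integral {a..b} d"
  proof (rule integral_nonneg)
    show "d integrable_on {a..b}" using set_borel_integral_eq_integral(1)[OF i] .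
    have "0 \<le> d 0"
    proof (rule tendsto_lowerbound)
      show "(d \<longlongrightarrow> d 0) (at_right 0)"
        using cont by (simp add: continuous_on_eq_continuous_at continuous_at filterlim_at_split)
      show "\<forall>\<^sub>F i in at_right 0. 0 \<le> d i"
        using pos by (auto simp: eventually_at_filter intro!: always_eventually less_imp_le)
    qed simp
    then show "0 \<le> d x" if "x \<in> {a..b}" for x
      using pos[of x] that assms by (cases "x = 0") auto
  qed
  ultimately have "measure law {a<..b} = integral {a..b} d"
    by (simp add: measure_def)
  then show ?thesis using law.cdf_diff_eq[OF ab] by simp
qed simp

lemma cdf_nonpos: "x \<le> 0 \<Longrightarrow> F x = 0"
proof -
  assume "x \<le> 0"
  have "AE y in law. \<not> y \<le> x"
    using AE_law_pos by eventually_elim (use \<open>x \<le> 0\<close> in auto)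
  then have "emeasure law {..x} = 0"
    by (subst AE_iff_measurable[symmetric, where P="\<lambda>y. \<not> y \<le> x"]) auto
  then show ?thesis by (simp add: cdf_def measure_def)
qed

lemma cdf_isCont: "isCont F x"
proof -
  have "emeasure law {x} = (\<integral>\<^sup>+y. ennreal (indicator {0<..} y * d y) * indicator {x} y \<partial>lborel)"
    unfolding law_def by (subst emeasure_density) auto
  also have "\<dots> = (\<integral>\<^sup>+(y::real). 0 \<partial>lborel)"
  proof (rule nn_integral_cong_AE)
    show "AE y in lborel. ennreal (indicator {0<..} y * d y) * indicator {x} y = 0"
      using AE_lborel_singleton[of x] by eventually_elim auto
  qed
  finally show ?thesis by (simp add: law.isCont_cdf measure_def)
qed

lemma cdf_DERIV:
  assumes "0 < r"
  shows "(F has_real_derivative d r) (at r)"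
proof -
  have "((\<lambda>x. integral {0..x} d) has_real_derivative d r) (at r within {0..r+1})"
    using assms by (intro integral_has_real_derivative continuous_on_subset[OF cont]) auto
  then have "((\<lambda>x. integral {0..x} d) has_real_derivative d r) (at r)"
    using assms at_within_interior[of r "{0..r+1}"] by simp
  then show ?thesis
  proof (rule has_field_derivative_transform_within_open[where S="{0<..}"])
    show "integral {0..x} d = F x" if "x \<in> {0<..}" for x
      using cdf_diff_integral[of 0 x] cdf_nonpos[of 0] that by simp
  qed (use assms in auto)
qed

lemma cdf_strict_mono:
  assumes "0 \<le> a" "a < b" shows "F a < F b"
proof (rule DERIV_pos_imp_increasing_open[OF assms(2)])
  show "\<exists>y. (F has_real_derivative y) (at x) \<and> 0 < y" if "a < x" "x < b" for x
    using cdf_DERIV[of x] pos[of x] that assms by auto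
  show "continuous_on {a..b} F" using cdf_isCont by (simp add: continuous_at_imp_continuous_on)
qed

lemma cdf_pos: "0 < r \<Longrightarrow> 0 < F r"
  using cdf_strict_mono[of 0 r] cdf_nonpos[of 0] by simp

lemma cdf_less_one: "F r < 1"
proof (cases "r \<ge> 0")
  case True
  then show ?thesis using cdf_strict_mono[of r "r+1"] law.cdf_bounded_prob[of "r+1"] by linarith
qed (simp add: cdf_nonpos)

definition "quantile y = (THE s. 0 < s \<and> F s = y)"

lemma quantile_cdf:
  assumes "0 < s" shows "quantile (F s) = s"
  unfolding quantile_def
proof (rule the_equality)
  show "s' = s" if "0 < s' \<and> F s' = F s" for s'
    using that assms cdf_strict_mono[of s s'] cdf_strict_mono[of s' s]
    by (cases s s' rule: linorder_cases) auto
qed (use assms in simp)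

lemma quantile:
  assumes "0 < y" "y < 1" shows "0 < quantile y" "F (quantile y) = y"
proof -
  have "\<forall>\<^sub>F x in at_top. y < F x"
    using order_tendstoD(1)[OF law.cdf_lim_at_top_prob] assms by auto
  then obtain b where b: "y < F b" "0 \<le> b"
    by (metis eventually_at_top_linorder linorder_linear max.cobounded2 max.cobounded1)
  have "\<exists>s\<ge>0. s \<le> b \<and> F s = y"
    by (rule IVT) (use b assms cdf_nonpos[of 0] cdf_isCont in auto)
  then obtain s where s: "0 \<le> s" "F s = y" by auto
  then have "0 < s" using assms cdf_nonpos[of 0] by (cases "s = 0") auto
  then show "0 < quantile y" "F (quantile y) = y" using quantile_cdf[of s] s by auto
qed

lemma quantile_DERIV:
  assumes "0 < y" "y < 1"
  shows "(quantile has_real_derivative 1 / d (quantile y)) (at y)"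
proof -
  let ?s = "quantile y"
  note s = quantile[OF assms]
  have "isCont quantile (F ?s)"
  proof (rule isCont_inverse_function[where d="?s/2" and f=F and x="?s"])
    show "quantile (F z) = z" if "\<bar>z - ?s\<bar> \<le> ?s / 2" for z
      by (rule quantile_cdf) (use that s in \<open>auto simp: abs_if split: if_splits\<close>)
  qed (use s cdf_isCont in auto)
  then have "isCont quantile y" using s by simp
  then have "(quantile has_real_derivative inverse (d ?s)) (at y)"
    using assms pos[OF s(1)] cdf_DERIV[OF s(1)] quantile(2)
    by (auto intro: DERIV_inverse_function[where a=0 and b=1 and f=F])
  then show ?thesis by (simp add: inverse_eq_divide)
qed

end

text \<open>
  The increasing map from the law with density \<open>p\<close> to the law with density \<open>g\<close> is the composition of a
  distribution function with a quantile function; as \<open>p\<close> and \<open>g\<close> are continuous and positive it is a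
  \<open>C\<^sup>1\<close> map of the open half-line.
\<close>

locale monotone_transport = src: half_line_density p + tgt: half_line_density g for p g
begin

definition "T r = tgt.quantile (src.F r)"

lemma T_transports:
  assumes "0 < r" shows "0 < T r" "tgt.F (T r) = src.F r"
  unfolding T_def using tgt.quantile src.cdf_pos src.cdf_less_one assms by auto

lemma T_DERIV:
  assumes "0 < r" shows "(T has_real_derivative p r / g (T r)) (at r)"
proof -
  have "(tgt.quantile has_real_derivative 1 / g (T r)) (at (src.F r))"
    unfolding T_def by (rule tgt.quantile_DERIV) (use src.cdf_pos src.cdf_less_one assms in auto)
  from DERIV_chain2[OF this src.cdf_DERIV[OF assms]] show ?thesis
    by (simp add: T_def[abs_def])
qed

lemma T_less_iff:
  assumes "0 < r" "0 < s" shows "T r < s \<longleftrightarrow> src.F r < tgt.F s"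
  using T_transports[OF assms(1)] assms tgt.cdf_strict_mono[of "T r" s] tgt.law.cdf_nondecreasing[of s "T r"]
  by (metis less_imp_le not_less)

lemma T_tendsto_0: "(T \<longlongrightarrow> 0) (at_right 0)"
proof (rule tendstoI)
  fix e :: real assume e: "0 < e"
  have "(src.F \<longlongrightarrow> 0) (at_right 0)"
    using src.cdf_isCont[of 0] src.cdf_nonpos[of 0] by (simp add: continuous_at filterlim_at_split)
  then have "\<forall>\<^sub>F r in at_right 0. src.F r < tgt.F e"
    using order_tendstoD(2) tgt.cdf_pos[OF e] by blast
  moreover have "\<forall>\<^sub>F r::real in at_right 0. 0 < r"
    by (simp add: eventually_at_filter)
  ultimately show "\<forall>\<^sub>F r in at_right 0. dist (T r) 0 < e"
  proof eventually_elim
    case (elim r)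
    then show ?case using T_less_iff[OF _ e, of r] T_transports(1)[of r] by simp
  qed
qed

end

section \<open>The deficit inequality on the half-line\<close>

lemma half_square_le_log_gap:
  assumes "(1::real) \<le> x" shows "(ln x)\<^sup>2 / 2 \<le> x - 1 - ln x"
  using exp_lower_Taylor_quadratic[of "ln x"] assms by simp

text \<open>
  By convexity \<open>x - 1 - ln x\<close> is the supremum over \<open>a\<close> of \<open>a (x - 1) + a + ln (1 - a)\<close>, and
  \<open>a + ln (1 - a) \<ge> - 2 a\<^sup>2\<close> for \<open>0 \<le> a \<le> 1 / 2\<close>.
\<close>

lemma linear_le_log_gap:
  fixes a x :: real
  assumes "0 < x" "0 \<le> a" "a \<le> 1/2" shows "a * (x - 1) - 2 * a\<^sup>2 \<le> x - 1 - ln x"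
proof -
  have "ln x + ln (1 - a) = ln ((1 - a) * x)" using assms by (simp add: ln_mult)
  also have "\<dots> \<le> (1 - a) * x - 1" using assms by (intro ln_le_minus_one) auto
  finally have "ln x + ln (1 - a) \<le> (1 - a) * x - 1" .
  moreover have "- a - 2 * a\<^sup>2 \<le> ln (1 - a)" by (rule ln_one_minus_pos_lower_bound) (use assms in auto)
  ultimately show ?thesis by (simp add: algebra_simps)
qed

text \<open>
  The radial picture of an admissible triple: \<open>v\<close> is the profile of the potential, \<open>exp (- w)\<close> is the
  profile of \<open>f\<^sup>2 / \<alpha>\<close>, and \<open>g\<close> and \<open>p\<close> are the densities of the distance to the origin under the two
  measures, where \<open>\<kappa>\<close> is the area of the unit sphere in the application. A convex profile \<open>w\<close> has corners in general, so it comes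
  with a subgradient selection \<open>q\<close> and a countable set \<open>N\<close> off which \<open>q\<close> is its derivative.
\<close>

locale radial_transport =
  fixes n :: nat and \<kappa> c :: real and v dv w q g p :: "real \<Rightarrow> real" and N :: "real set"
  assumes n: "1 \<le> n" and kappa: "0 < \<kappa>" and c: "0 < c"
    and v_deriv: "\<And>r. (v has_real_derivative dv r) (at r)"
    and dv_cont: "continuous_on UNIV dv"
    and v_convex: "\<And>r s. v r + dv r * (s - r) + c / 2 * (s - r)\<^sup>2 \<le> v s"
    and v_mono: "\<And>r s. 0 \<le> r \<Longrightarrow> r \<le> s \<Longrightarrow> v r \<le> v s"
    and w_sub: "\<And>r s. w r + q r * (s - r) \<le> w s"
    and w_mono: "\<And>r s. 0 \<le> r \<Longrightarrow> r \<le> s \<Longrightarrow> w r \<le> w s"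
    and N: "countable N" "\<And>r. r \<notin> N \<Longrightarrow> (w has_real_derivative q r) (at r)"
    and g_def: "g = (\<lambda>r. \<kappa> * r ^ (n - 1) * exp (- v r))"
    and p_def: "p = (\<lambda>r. g r * exp (- w r))"
    and prob_g: "prob_space (density lborel (\<lambda>r. ennreal (indicator {0<..} r * g r)))"
    and prob_p: "prob_space (density lborel (\<lambda>r. ennreal (indicator {0<..} r * p r)))"
    and moment: "integrable lborel (\<lambda>r. indicator {0<..} r * (r * g r))"
begin

lemma g_eq: "g r = \<kappa> * r ^ (n - 1) * exp (- v r)" and p_eq: "p r = g r * exp (- w r)"
  by (simp_all add: g_def p_def)

lemma v_cont: "continuous_on UNIV v"
  using v_deriv by (meson DERIV_isCont continuous_at_imp_continuous_on)

lemma w_cont: "continuous_on UNIV w"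
  using subgradient_continuous[OF w_sub] by (simp add: continuous_at_imp_continuous_on)

lemma g_cont: "continuous_on UNIV g"
  unfolding g_def by (intro continuous_intros v_cont)

lemma p_cont: "continuous_on UNIV p"
  unfolding p_def by (intro continuous_intros g_cont w_cont)

lemma g_pos: "0 < r \<Longrightarrow> 0 < g r" and p_pos: "0 < r \<Longrightarrow> 0 < p r"
  using kappa by (auto simp: g_eq p_eq)

sublocale monotone_transport p g
  by (intro monotone_transport.intro half_line_density.intro g_cont p_cont prob_g prob_p)
    (erule p_pos g_pos)+

abbreviation "\<mu>\<^sub>g \<equiv> tgt.law"
abbreviation "Fg \<equiv> tgt.F"
abbreviation "Fp \<equiv> src.F"

lemma w_meas[measurable]: "w \<in> borel_measurable borel"
  using w_cont by (rule borel_measurable_continuous_onI)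

lemma q_meas[measurable]: "q \<in> borel_measurable borel"
  by (rule borel_measurable_mono) (rule subgradient_mono[OF w_sub])

lemma law_p: "src.law = density \<mu>\<^sub>g (\<lambda>r. ennreal (exp (- w r)))"
proof -
  have "density \<mu>\<^sub>g (\<lambda>r. ennreal (exp (- w r)))
     = density lborel (\<lambda>r. ennreal (indicator {0<..} r * g r) * ennreal (exp (- w r)))"
    unfolding tgt.law_def by (rule density_density_eq) auto
  also have "(\<lambda>r. ennreal (indicator {0<..} r * g r) * ennreal (exp (- w r)))
     = (\<lambda>r. ennreal (indicator {0<..} r * p r))"
  proof
    fix r
    show "ennreal (indicator {0<..} r * g r) * ennreal (exp (- w r)) = ennreal (indicator {0<..} r * p r)"
      using g_pos[of r] by (cases "0 < r") (simp_all add: p_eq ennreal_mult'[symmetric])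
  qed
  finally show ?thesis unfolding src.law_def ..
qed

definition "D = (LINT r|\<mu>\<^sub>g. \<bar>exp (- w r) - 1\<bar>) / 2"

lemma integral_h: "integrable \<mu>\<^sub>g (\<lambda>r. exp (- w r))" "(LINT r|\<mu>\<^sub>g. exp (- w r)) = 1"
proof -
  have "integrable src.law (\<lambda>r. 1 :: real)" by simp
  then show "integrable \<mu>\<^sub>g (\<lambda>r. exp (- w r))" unfolding law_p
    by (subst (asm) integrable_density) auto
  have "(LINT r|src.law. 1 :: real) = 1" using src.law.prob_space by simp
  then show "(LINT r|\<mu>\<^sub>g. exp (- w r)) = 1" unfolding law_p
    by (subst (asm) integral_density) auto
qed

text \<open>
  The balls around the origin are the superlevel sets of \<open>exp (- w)\<close>, which is nonincreasing on the
  half-line, so this is an instance of the statement on superlevel sets.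
\<close>

lemma cdf_excess:
  assumes "0 < r"
  shows "D * (Fp r * (1 - Fp r)) \<le> Fp r - Fg r" "Fg r \<le> Fp r" "0 \<le> D" "D \<le> 1"
proof -
  \<comment> \<open>The functions \<open>h\<close> and \<open>exp (- w)\<close> agree on the half-line; freezing the value left of the origin makes \<open>{..r}\<close> a superlevel set.\<close>
  define h where "h = (\<lambda>s. exp (- w (max 0 s)))"
  have eq: "AE s in \<mu>\<^sub>g. h s = exp (- w s)"
    using tgt.AE_law_pos by eventually_elim (simp add: h_def)
  have [measurable]: "h \<in> borel_measurable \<mu>\<^sub>g" unfolding h_def by simp
  have m: "(\<lambda>s. exp (- w s)) \<in> borel_measurable \<mu>\<^sub>g" "h \<in> borel_measurable \<mu>\<^sub>g" by measurable
  have one: "(LINT s|\<mu>\<^sub>g. h s) = 1"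
    unfolding integral_cong_AE[OF m(2,1) eq] by (rule integral_h(2))
  have int: "integrable \<mu>\<^sub>g h"
    unfolding integrable_cong_AE[OF m(2,1) eq] by (rule integral_h(1))
  have D: "D = (LINT s|\<mu>\<^sub>g. \<bar>h s - 1\<bar>) / 2"
  proof -
    have "AE s in \<mu>\<^sub>g. \<bar>exp (- w s) - 1\<bar> = \<bar>h s - 1\<bar>"
      using eq by eventually_elim simp
    then have "(LINT s|\<mu>\<^sub>g. \<bar>exp (- w s) - 1\<bar>) = (LINT s|\<mu>\<^sub>g. \<bar>h s - 1\<bar>)"
      by (intro integral_cong_AE) simp_all
    then show ?thesis by (simp add: D_def)
  qed
  have nu: "Fp r = (LINT s|\<mu>\<^sub>g. indicator {..r} s * h s)"
  proof -
    have "Fp r = (LINT s|src.law. indicator {..r} s)" by (simp add: cdf_def)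
    also have "\<dots> = (LINT s|\<mu>\<^sub>g. exp (- w s) * indicator {..r} s)"
      unfolding law_p by (subst integral_density) auto
    also have "\<dots> = (LINT s|\<mu>\<^sub>g. indicator {..r} s * h s)"
    proof (rule integral_cong_AE)
      show "AE s in \<mu>\<^sub>g. exp (- w s) * indicator {..r} s = indicator {..r} s * h s"
        using eq by eventually_elim simp
    qed simp_all
    finally show ?thesis .
  qed
  have lev: "exp (- w r) \<le> h s" if "s \<in> {..r}" for s
    using w_mono[of "max 0 s" r] that assms by (auto simp: h_def)
  have lev2: "h s \<le> exp (- w r)" if "s \<notin> {..r}" for s
    using w_mono[of r s] that assms by (auto simp: h_def)
  note S = superlevel_excess[OF tgt.law.prob_space_axioms int one _ _ lev lev2 _ D nu]
  show "D * (Fp r * (1 - Fp r)) \<le> Fp r - Fg r" "Fg r \<le> Fp r" "0 \<le> D" "D \<le> 1"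
    using S(1,2,5,6) by (simp_all add: cdf_def h_def)
qed

lemma T_ge: "0 < r \<Longrightarrow> r \<le> T r"
  using T_less_iff[of r r] cdf_excess(2)[of r] by force

text \<open>
  As \<open>exp (- v)\<close> is nonincreasing, the mass of \<open>{..r}\<close> is at least the value it would have if \<open>exp (- v)\<close>
  were constant and equal to \<open>exp (- v r)\<close>, which is \<open>r g r / n\<close>.
\<close>

lemma radius_density_le:
  assumes "0 < r" shows "r * g r \<le> real n"
proof -
  have "Fg 0 - \<kappa> * exp (- v r) * 0 ^ n / n \<le> Fg r - \<kappa> * exp (- v r) * r ^ n / n"
  proof (rule DERIV_nonneg_imp_increasing_open[where f="\<lambda>s. Fg s - \<kappa> * exp (- v r) * s ^ n / n"])
    fix s assume s: "0 < s" "s < r"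
    have "((\<lambda>s. Fg s - \<kappa> * exp (- v r) * s ^ n / n) has_real_derivative
        g s - \<kappa> * exp (- v r) * s ^ (n - 1)) (at s)"
      using n by (auto intro!: derivative_eq_intros tgt.cdf_DERIV s)
    moreover have "\<kappa> * exp (- v r) * s ^ (n - 1) \<le> g s"
      using v_mono[of s r] s kappa by (simp add: g_eq mult_ac mult_left_mono)
    ultimately show "\<exists>y. ((\<lambda>s. Fg s - \<kappa> * exp (- v r) * s ^ n / n) has_real_derivative y) (at s) \<and> 0 \<le> y"
      by fastforce
  next
    show "continuous_on {0..r} (\<lambda>s. Fg s - \<kappa> * exp (- v r) * s ^ n / n)"
      using tgt.cdf_isCont n by (intro continuous_intros) (auto simp: continuous_at_imp_continuous_on)
  qed (use assms in auto)
  then have "\<kappa> * exp (- v r) * r ^ n / n \<le> Fg r" using n tgt.cdf_nonpos[of 0] by (simp add: power_0_left)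
  also have "\<dots> \<le> 1" by (rule tgt.law.cdf_bounded_prob)
  finally have "\<kappa> * exp (- v r) * r ^ n \<le> n" using n by (simp add: field_simps)
  moreover have "r ^ n = r * r ^ (n - 1)" using n by (cases n) auto
  ultimately show ?thesis by (simp add: g_eq mult_ac)
qed

lemma cdf_le_log_ratio:
  assumes "0 < r" "r \<le> t" shows "Fg t - Fg r \<le> n * ln (t / r)"
proof -
  have "n * ln r - Fg r \<le> n * ln t - Fg t"
  proof (rule DERIV_nonneg_imp_nondecreasing[OF assms(2)])
    fix s assume s: "r \<le> s" "s \<le> t"
    then have s0: "0 < s" using assms by simp
    have "((\<lambda>s. n * ln s - Fg s) has_real_derivative n * (1 / s) - g s) (at s)"
      using s0 by (auto intro!: derivative_eq_intros tgt.cdf_DERIV)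
    moreover have "0 \<le> n * (1 / s) - g s" using radius_density_le[OF s0] s0 by (simp add: field_simps)
    ultimately show "\<exists>y. ((\<lambda>s. n * ln s - Fg s) has_real_derivative y) (at s) \<and> 0 \<le> y" by blast
  qed
  then show ?thesis using assms by (simp add: ln_div algebra_simps)
qed

text \<open>
  The function \<open>gap\<close> collects \<open>\<phi>\<close> of the eigenvalues of the derivative of the transport map on \<open>\<real>\<^sup>n\<close>, for
  \<open>\<phi> x = x - 1 - ln x\<close>. The function \<open>flux\<close> is the one whose boundary values appear in the integration
  by parts, and \<open>dflux\<close> is its derivative off \<open>N\<close>.
\<close>

definition "dT r = p r / g (T r)"
definition "gap r = (dT r - 1 - ln (dT r)) + (real n - 1) * (T r / r - 1 - ln (T r / r))"
definition "flux r = (T r - r) * p r"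
definition "dflux r = (dT r - 1) * p r + (T r - r) * (p r * ((real n - 1) / r - dv r - q r))"

lemma T_DERIV_dT: "0 < r \<Longrightarrow> (T has_real_derivative dT r) (at r)"
  unfolding dT_def by (rule T_DERIV)

lemma dT_pos: "0 < r \<Longrightarrow> 0 < dT r"
  using p_pos g_pos T_transports by (simp add: dT_def)

lemma flux_DERIV:
  assumes "0 < r" "r \<notin> N" shows "(flux has_real_derivative dflux r) (at r)"
proof -
  have pow: "real (n - 1) * r ^ (n - 1 - 1) = r ^ (n - 1) * ((real n - 1) / r)"
    using assms n by (cases "n - 1") (auto simp: of_nat_diff)
  have "((\<lambda>r. \<kappa> * r ^ (n - 1) * exp (- v r) * exp (- w r)) has_real_derivative
     \<kappa> * (real (n - 1) * r ^ (n - 1 - 1)) * exp (- v r) * exp (- w r)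
     - \<kappa> * r ^ (n - 1) * exp (- v r) * exp (- w r) * (dv r + q r)) (at r)"
    by (rule derivative_eq_intros v_deriv[of r] N(2)[OF assms(2)] refl)+ (simp add: algebra_simps)
  then have "((\<lambda>r. \<kappa> * r ^ (n - 1) * exp (- v r) * exp (- w r)) has_real_derivative
      p r * ((real n - 1) / r - dv r - q r)) (at r)"
    unfolding pow by (simp add: p_eq g_eq algebra_simps)
  moreover have "(\<lambda>r. \<kappa> * r ^ (n - 1) * exp (- v r) * exp (- w r)) = p"
    by (rule ext) (simp add: p_eq g_eq)
  ultimately have "(p has_real_derivative p r * ((real n - 1) / r - dv r - q r)) (at r)" by simp
  from DERIV_mult[OF DERIV_diff[OF T_DERIV[OF assms(1)] DERIV_ident] this]
  show ?thesis unfolding flux_def[abs_def] dflux_def dT_def by (simp add: mult.commute)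
qed

text \<open>
  The pointwise form of the transport proof of the log-Sobolev inequality. The transport equation
  expresses \<open>w\<close> through \<open>v\<close> at \<open>r\<close> and \<open>T r\<close> and through the logarithms in \<open>gap\<close>; convexity bounds
  \<open>v (T r) - v r\<close> from below; the terms with \<open>T r - r\<close> and \<open>q r\<close> that \<open>dflux\<close> does not absorb complete a
  square.
\<close>

lemma deficit_integrand_ge:
  assumes r: "0 < r"
  shows "gap r * p r - dflux r \<le> ((q r)\<^sup>2 / (2 * c) + w r) * p r"
proof -
  let ?t = "T r"
  have t: "0 < ?t" using T_transports r by simp
  have "dT r = (r / ?t) ^ (n - 1) * exp (v ?t - v r - w r)"
    using kappa t r by (simp add: dT_def p_eq g_eq power_divide exp_diff exp_add exp_minus field_simps)
  then have "ln (dT r) = (real n - 1) * ln (r / ?t) + (v ?t - v r - w r)"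
    using t r n by (simp add: ln_mult ln_realpow of_nat_diff)
  then have ln: "w r = - ln (dT r) - (real n - 1) * ln (?t / r) + v ?t - v r"
    using t r by (simp add: ln_div algebra_simps)
  \<comment> \<open>the square of \<open>q r - c (T r - r)\<close>, divided by \<open>2 c\<close>\<close>
  have amgm: "0 \<le> (q r)\<^sup>2 / (2 * c) + c / 2 * (?t - r)\<^sup>2 - q r * (?t - r)"
  proof -
    have "(q r)\<^sup>2 / (2 * c) + c / 2 * (?t - r)\<^sup>2 - q r * (?t - r) = (q r - c * (?t - r))\<^sup>2 / (2 * c)"
      using c by (simp add: power2_eq_square field_simps)
    then show ?thesis using c by simp
  qed
  have "gap r - ((dT r - 1) + (?t - r) * ((real n - 1) / r - dv r - q r)) 
    = - ln (dT r) - (real n - 1) * ln (?t / r) + (?t - r) * (dv r + q r)"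
    using r by (simp add: gap_def field_simps)
  also have "\<dots> \<le> (q r)\<^sup>2 / (2 * c) + w r"
    using amgm v_convex[of r ?t] unfolding ln by (simp add: algebra_simps)
  finally have "(gap r - ((dT r - 1) + (?t - r) * ((real n - 1) / r - dv r - q r))) * p r
      \<le> ((q r)\<^sup>2 / (2 * c) + w r) * p r"
    using p_pos[OF r] by (intro mult_right_mono) auto
  then show ?thesis by (simp add: dflux_def algebra_simps)
qed

lemma T_cont: "continuous_on {0<..} T"
  using T_DERIV by (meson DERIV_isCont continuous_at_imp_continuous_on greaterThan_iff)

lemma dT_cont: "continuous_on {0<..} dT"
  unfolding dT_def[abs_def]
  by (intro continuous_intros continuous_on_compose2[OF g_cont T_cont] continuous_on_subset[OF p_cont])
    (use g_pos T_transports in \<open>fastforce\<close>)+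

lemma flux_lipschitz:
  assumes "0 < a" shows "\<exists>L. L-lipschitz_on {a..b} flux"
proof -
  have sub: "{a..b} \<subseteq> {0<..}" using assms by auto
  have "\<exists>L. L-lipschitz_on {a..b} (\<lambda>r. T r - r)"
    by (rule C1_imp_lipschitz[where f'="\<lambda>r. dT r - 1"])
      (use assms in \<open>auto intro!: derivative_eq_intros T_DERIV_dT continuous_intros
         continuous_on_subset[OF dT_cont sub]\<close>)
  moreover have "\<exists>L. L-lipschitz_on {a..b} g"
    unfolding g_def
    by (rule C1_imp_lipschitz[where f'="\<lambda>r. \<kappa> * (real (n - 1) * r ^ (n - 1 - 1)) * exp (- v r)
          + \<kappa> * r ^ (n - 1) * (exp (- v r) * (- dv r))"])
      (auto intro!: derivative_eq_intros v_deriv continuous_intros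
         continuous_on_subset[OF v_cont] continuous_on_subset[OF dv_cont] simp: algebra_simps)
  moreover have "\<exists>L. L-lipschitz_on {a..b} (\<lambda>r. exp (- w r))"
    by (rule lipschitz_exp_minus[OF subgradient_lipschitz[OF w_sub]])
  ultimately have "\<exists>L. L-lipschitz_on {a..b} (\<lambda>r. (T r - r) * (g r * exp (- w r)))"
    by (intro lipschitz_mult)
  then show ?thesis by (simp add: flux_def[abs_def] p_eq)
qed

lemma flux_tendsto_0: "(flux \<longlongrightarrow> 0) (at_right 0)"
proof -
  have "(p \<longlongrightarrow> p 0) (at_right 0)"
    using p_cont by (simp add: continuous_on_eq_continuous_at continuous_at filterlim_at_split)
  then have "((\<lambda>r. (T r - r) * p r) \<longlongrightarrow> (0 - 0) * p 0) (at_right 0)"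
    by (intro tendsto_intros T_tendsto_0)
  then show ?thesis by (simp add: flux_def[abs_def])
qed

text \<open>
  If the flux stayed above \<open>e\<close>, then \<open>T r * p r\<close>, which dominates it, would not be integrable; but the
  integral of \<open>T r * p r\<close> is the first moment of the law with density \<open>g\<close>.
\<close>

lemma flux_small_somewhere:
  assumes "0 < e" shows "\<exists>b\<ge>R. 0 < b \<and> flux b < e"
proof (rule ccontr)
  assume "\<not> ?thesis"
  then have big: "e \<le> flux b" if "R \<le> b" "0 < b" for b using that by force
  define m where "m = (\<lambda>x. x * g x)"
  define Mo where "Mo = (\<lambda>s. integral {0..s} m)"
  have mc: "continuous_on UNIV m" unfolding m_def by (intro continuous_intros g_cont)
  have Mo_DERIV: "(Mo has_real_derivative m s) (at s)" if "0 < s" for s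
  proof -
    have "((\<lambda>x. integral {0..x} m) has_real_derivative m s) (at s within {0..s+1})"
      using that by (intro integral_has_real_derivative continuous_on_subset[OF mc]) auto
    then show ?thesis unfolding Mo_def using that at_within_interior[of s "{0..s+1}"] by simp
  qed
  define K where "K = (LINT r|lborel. indicator {0<..} r * (r * g r))"
  have Mo_le: "Mo s \<le> K" for s
  proof -
    have i: "set_integrable lborel {0..s} m"
      by (rule borel_integrable_atLeastAtMost') (rule continuous_on_subset[OF mc], simp)
    have "Mo s = (LINT x|lborel. indicator {0..s} x *\<^sub>R m x)"
      unfolding Mo_def using set_borel_integral_eq_integral(2)[OF i] by (simp add: set_lebesgue_integral_def)
    also have "\<dots> \<le> K" unfolding K_def
      by (rule integral_mono[OF i[unfolded set_integrable_def] moment])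
        (use g_pos in \<open>auto simp: m_def indicator_def intro!: mult_nonneg_nonneg less_imp_le\<close>)
    finally show ?thesis .
  qed
  define R0 where "R0 = max R 1"
  \<comment> \<open>far enough for a growth of at least \<open>e\<close> per unit length to exceed the total moment \<open>K\<close>\<close>
  define b where "b = R0 + (K - Mo (T R0) + 1) / e"
  have "Mo (T R0) \<le> K" by (rule Mo_le)
  then have b: "R0 \<le> b" using assms by (simp add: b_def)
  have "Mo (T R0) - e * R0 \<le> Mo (T b) - e * b"
  proof (rule DERIV_nonneg_imp_nondecreasing[OF b])
    fix r assume r: "R0 \<le> r" "r \<le> b"
    then have r0: "0 < r" "R \<le> r" by (auto simp: R0_def)
    have "((\<lambda>r. Mo (T r) - e * r) has_real_derivative m (T r) * dT r - e) (at r)"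
      by (rule DERIV_diff DERIV_cmult_Id DERIV_chain2[OF Mo_DERIV] T_DERIV_dT T_transports(1) r0)+
    moreover have "m (T r) * dT r = T r * p r" using g_pos[OF T_transports(1)[OF r0(1)]] by (simp add: m_def dT_def)
    moreover have "flux r \<le> T r * p r" using r0 p_pos[of r] by (simp add: flux_def mult_right_mono)
    ultimately show "\<exists>y. ((\<lambda>r. Mo (T r) - e * r) has_real_derivative y) (at r) \<and> 0 \<le> y"
      using big[of r] r0 by fastforce
  qed
  then have "Mo (T R0) + e * (b - R0) \<le> K" using Mo_le[of "T b"] by (simp add: algebra_simps)
  then show False using assms by (simp add: b_def)
qed

text \<open>
  The function \<open>w exp (- w)\<close> is bounded, as \<open>w\<close> is bounded below on the half-line.
\<close>

lemma w_exp_integrable: "integrable \<mu>\<^sub>g (\<lambda>r. w r * exp (- w r))"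
proof (rule Bochner_Integration.integrable_bound)
  show "integrable \<mu>\<^sub>g (\<lambda>r. 1 + \<bar>w 0\<bar> * exp (- w 0))" by simp
  show "AE r in \<mu>\<^sub>g. norm (w r * exp (- w r)) \<le> norm (1 + \<bar>w 0\<bar> * exp (- w 0))"
    using tgt.AE_law_pos
  proof eventually_elim
    case (elim r)
    have w0: "w 0 \<le> w r" using w_mono[of 0 r] elim by simp
    show ?case
    proof (cases "0 \<le> w r")
      case True
      have "w r \<le> exp (w r)" using exp_ge_add_one_self[of "w r"] by linarith
      then have "w r * exp (- w r) \<le> 1" by (simp add: exp_minus field_simps)
      then show ?thesis using True by (simp add: abs_mult add_increasing2)
    next
      case False
      then have "\<bar>w r\<bar> * exp (- w r) \<le> \<bar>w 0\<bar> * exp (- w 0)" using w0 by (intro mult_mono) auto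
      then show ?thesis by (simp add: abs_mult)
    qed
  qed
qed simp

text \<open>
  Integrating \<open>deficit_integrand_ge\<close> reduces a lower bound of the deficit to a lower bound of \<open>gap r * p r\<close>
  by a derivative \<open>Q'\<close>: the bound is the growth of \<open>Q\<close> from \<open>0\<close> to infinity. At infinity \<open>Q\<close> may
  be replaced by a minorant \<open>Q1\<close> whose limit is known.
\<close>

lemma deficit_lower_bound_from_primitive:
  assumes int: "integrable \<mu>\<^sub>g (\<lambda>r. (q r)\<^sup>2 * exp (- w r))"
    and Q: "\<And>r. 0 < r \<Longrightarrow> (Q has_real_derivative Q' r) (at r)" "continuous_on {0<..} Q'"
    and Q_le: "\<And>r. 0 < r \<Longrightarrow> Q' r \<le> gap r * p r"
    and Q0: "(Q \<longlongrightarrow> 0) (at_right 0)"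
    and Q1: "\<And>r. 0 < r \<Longrightarrow> Q1 r \<le> Q r" "(Q1 \<longlongrightarrow> l) at_top"
  shows "l \<le> (LINT r|\<mu>\<^sub>g. ((q r)\<^sup>2 / (2 * c) + w r) * exp (- w r))"
proof -
  let ?U = "\<lambda>r. ((q r)\<^sup>2 / (2 * c) + w r) * exp (- w r)"
  have U: "integrable \<mu>\<^sub>g ?U"
  proof -
    have "integrable \<mu>\<^sub>g (\<lambda>r. (q r)\<^sup>2 * exp (- w r) / (2 * c) + w r * exp (- w r))" using int w_exp_integrable by simp
    then show ?thesis by (simp add: algebra_simps)
  qed
  have local: "Q b - Q a - flux b + flux a \<le> (LINT r|\<mu>\<^sub>g. indicator {a..b} r * ?U r)"
    if ab: "0 < a" "a \<le> b" for a b
  proof -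
    define X where "X = (\<lambda>r. Q r - flux r)"
    define X' where "X' = (\<lambda>r. indicator {0<..} r * (Q' r - dflux r))"
    have sub: "{a..b+1} \<subseteq> {0<..}" using ab by auto
    obtain L1 L2 where "L1-lipschitz_on {a..b+1} Q" "L2-lipschitz_on {a..b+1} flux"
      using C1_imp_lipschitz[of a "b+1" Q Q'] Q continuous_on_subset[OF Q(2) sub] flux_lipschitz[OF ab(1)] ab
      by force
    then have lip: "(L1 + L2)-lipschitz_on {a..b+1} X" unfolding X_def by (rule lipschitz_on_diff)
    have dm: "(\<lambda>r. indicator {0<..} r * dT r) \<in> borel_measurable borel"
      using borel_measurable_continuous_on_indicator[OF _ dT_cont] by simp
    have tm: "(\<lambda>r. indicator {0<..} r * T r) \<in> borel_measurable borel"
      using borel_measurable_continuous_on_indicator[OF _ T_cont] by simp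
    have qm: "(\<lambda>r. indicator {0<..} r * Q' r) \<in> borel_measurable borel"
      using borel_measurable_continuous_on_indicator[OF _ Q(2)] by simp
    have [measurable]: "dv \<in> borel_measurable borel" using dv_cont by (rule borel_measurable_continuous_onI)
    have "X' = (\<lambda>r. indicator {0<..} r * Q' r - ((indicator {0<..} r * dT r - indicator {0<..} r) * p r
       + (indicator {0<..} r * T r - indicator {0<..} r * r) * (p r * ((real n - 1) / r - dv r - q r))))"
      by (auto simp: X'_def dflux_def fun_eq_iff indicator_def)
    also have "\<dots> \<in> borel_measurable borel" using dm tm qm by measurable
    finally have X'm[measurable]: "X' \<in> borel_measurable borel" .
    have "AE x in lborel. x \<notin> N" by (rule AE_not_in[OF countable_imp_null_set_lborel[OF N(1)]])
    then have der: "AE x in lborel. x \<in> {a..b} \<longrightarrow> (X has_real_derivative X' x) (at x)"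
    proof eventually_elim
      case (elim x)
      show ?case
      proof
        assume "x \<in> {a..b}"
        then have "0 < x" using ab by auto
        then show "(X has_real_derivative X' x) (at x)"
          unfolding X_def X'_def using Q(1) flux_DERIV[OF _ elim] by (auto intro!: derivative_intros)
      qed
    qed
    note ftc = lipschitz_FTC[OF ab(2) _ lip der X'm]
    have conv: "(LINT r|\<mu>\<^sub>g. indicator {a..b} r * ?U r) = (LBINT x:{a..b}. ((q x)\<^sup>2 / (2 * c) + w x) * p x)"
      and ci: "set_integrable lborel {a..b} (\<lambda>x. ((q x)\<^sup>2 / (2 * c) + w x) * p x)"
    proof -
      have e: "indicator {0<..} x * g x * (indicator {a..b} x * ?U x)
         = indicator {a..b} x * (((q x)\<^sup>2 / (2 * c) + w x) * p x)" for x
        using ab by (auto simp: indicator_def p_eq)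
      have nn: "AE x in lborel. 0 \<le> indicator {0<..} x * g x"
        by (rule AE_I2) (use g_pos in \<open>auto simp: indicator_def less_imp_le\<close>)
      show "(LINT r|\<mu>\<^sub>g. indicator {a..b} r * ?U r) = (LBINT x:{a..b}. ((q x)\<^sup>2 / (2 * c) + w x) * p x)"
        unfolding tgt.law_def set_lebesgue_integral_def
        by (subst integral_density) (use nn in \<open>auto simp: e\<close>)
      have "integrable \<mu>\<^sub>g (\<lambda>r. indicator {a..b} r * ?U r)"
        using integrable_mult_indicator[OF _ U, of "{a..b}"] by simp
      then show "set_integrable lborel {a..b} (\<lambda>x. ((q x)\<^sup>2 / (2 * c) + w x) * p x)"
        unfolding tgt.law_def set_integrable_def
        by (subst (asm) integrable_density) (use nn in \<open>auto simp: e\<close>)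
    qed
    have "X b - X a = (LBINT x:{a..b}. X' x)" using ftc(2) by simp
    also have "\<dots> \<le> (LBINT x:{a..b}. ((q x)\<^sup>2 / (2 * c) + w x) * p x)"
    proof (rule set_integral_mono[OF _ ci])
      show "set_integrable lborel {a..b} X'" using ftc(1) by simp
      fix x assume "x \<in> {a..b}"
      then have "0 < x" using ab by auto
      then show "X' x \<le> ((q x)\<^sup>2 / (2 * c) + w x) * p x"
        using deficit_integrand_ge[of x] Q_le[of x] by (simp add: X'_def)
    qed
    finally show ?thesis using conv by (simp add: X_def)
  qed
  have "\<exists>b\<ge>real (Suc k). 0 < b \<and> flux b < 1 / real (Suc k)" for k
    by (rule flux_small_somewhere) simp
  then obtain b where b: "\<And>k. real (Suc k) \<le> b k" "\<And>k. 0 < b k" "\<And>k. flux (b k) < 1 / real (Suc k)"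
    by metis
  define a where "a = (\<lambda>k. 1 / real (Suc k))"
  have a: "0 < a k" "a k \<le> b k" for k
  proof -
    show "0 < a k" by (simp add: a_def)
    have "a k \<le> 1" by (simp add: a_def)
    then show "a k \<le> b k" using b(1)[of k] by linarith
  qed
  have a0: "a \<longlonglongrightarrow> 0" unfolding a_def by real_asymp
  then have a_at: "filterlim a (at_right 0) sequentially"
    using a(1) by (auto simp: filterlim_at less_imp_neq[symmetric])
  have bt: "filterlim b at_top sequentially"
  proof (rule filterlim_at_top_mono)
    show "filterlim (\<lambda>k. real (Suc k)) at_top sequentially" by real_asymp
  qed (use b(1) in simp)
  have lower: "(\<lambda>k. Q1 (b k) - Q (a k) - 1 / real (Suc k) + flux (a k)) \<longlonglongrightarrow> l - 0 - 0 + 0"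
    by (intro tendsto_intros filterlim_compose[OF Q1(2) bt] filterlim_compose[OF Q0 a_at]
        filterlim_compose[OF flux_tendsto_0 a_at]) real_asymp
  have upper: "(\<lambda>k. LINT r|\<mu>\<^sub>g. indicator {a k..b k} r * ?U r) \<longlonglongrightarrow> (LINT r|\<mu>\<^sub>g. ?U r)"
  proof (rule integral_dominated_convergence[where w="\<lambda>r. norm (?U r)"])
    show "AE r in \<mu>\<^sub>g. (\<lambda>k. indicator {a k..b k} r * ?U r) \<longlonglongrightarrow> ?U r"
      using tgt.AE_law_pos
    proof eventually_elim
      case (elim r)
      have "\<forall>\<^sub>F k in sequentially. a k < r" using order_tendstoD(2)[OF a0 elim] .
      moreover have "\<forall>\<^sub>F k in sequentially. r \<le> b k" using bt by (simp add: filterlim_at_top)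
      ultimately have "\<forall>\<^sub>F k in sequentially. indicator {a k..b k} r * ?U r = ?U r"
        by eventually_elim simp
      then show ?case by (rule tendsto_eventually)
    qed
  qed (use U in \<open>auto simp: indicator_def\<close>)
  have "l - 0 - 0 + 0 \<le> (LINT r|\<mu>\<^sub>g. ?U r)"
  proof (rule LIMSEQ_le[OF lower upper])
    have "Q1 (b k) - Q (a k) - 1 / real (Suc k) + flux (a k) \<le> (LINT r|\<mu>\<^sub>g. indicator {a k..b k} r * ?U r)" for k
      using local[OF a, of k] Q1(1)[OF b(2)[of k]] b(3)[of k] by linarith
    then show "\<exists>N. \<forall>k\<ge>N. Q1 (b k) - Q (a k) - 1 / real (Suc k) + flux (a k) \<le> (LINT r|\<mu>\<^sub>g. indicator {a k..b k} r * ?U r)"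
      by blast
  qed
  then show ?thesis by simp
qed

lemma gap_split:
  assumes "0 < r"
  shows "dT r - 1 - ln (dT r) \<le> gap r" "(real n - 1) * (T r / r - 1 - ln (T r / r)) \<le> gap r"
proof -
  have "0 \<le> dT r - 1 - ln (dT r)" using ln_le_minus_one[OF dT_pos[OF assms]] by simp
  moreover have "0 \<le> T r / r - 1 - ln (T r / r)" using ln_le_minus_one[of "T r / r"] T_transports(1)[OF assms] assms by simp
  then have "0 \<le> (real n - 1) * (T r / r - 1 - ln (T r / r))" using n by (intro mult_nonneg_nonneg) auto
  ultimately show "dT r - 1 - ln (dT r) \<le> gap r" "(real n - 1) * (T r / r - 1 - ln (T r / r)) \<le> gap r"
    by (simp_all add: gap_def)
qed

lemma Fp_tendsto_0: "(Fp \<longlongrightarrow> 0) (at_right 0)"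
  using src.cdf_isCont[of 0] src.cdf_nonpos[of 0] by (simp add: continuous_at filterlim_at_split)

lemma Fp_cont: "continuous_on S Fp"
  using src.cdf_isCont by (simp add: continuous_at_imp_continuous_on)

text \<open>
  The second eigenvalue alone is enough: \<open>ln (T r / r) \<ge> D / n * Fp (1 - Fp)\<close>, and the square of the
  right-hand side has \<open>p\<close>-integral \<open>(D / n)\<^sup>2 / 30\<close>, as \<open>Fp\<close> is uniformly distributed on the unit interval.
\<close>

lemma deficit_bound_higher:
  assumes int: "integrable \<mu>\<^sub>g (\<lambda>r. (q r)\<^sup>2 * exp (- w r))" and n2: "2 \<le> n"
  shows "D\<^sup>2 / (60 * n\<^sup>2) \<le> (LINT r|\<mu>\<^sub>g. ((q r)\<^sup>2 / (2 * c) + w r) * exp (- w r))"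
proof -
  define A where "A = D\<^sup>2 / (2 * n\<^sup>2)"
  \<comment> \<open>a primitive of \<open>(u (1 - u))\<^sup>2\<close>, evaluated at \<open>u = Fp r\<close>\<close>
  define Q where "Q = (\<lambda>r. A * (Fp r ^ 3 / 3 - Fp r ^ 4 / 2 + Fp r ^ 5 / 5))"
  define Q' where "Q' = (\<lambda>r. A * (Fp r * (1 - Fp r))\<^sup>2 * p r)"
  have lim: "(Q \<longlongrightarrow> A * (1 ^ 3 / 3 - 1 ^ 4 / 2 + 1 ^ 5 / 5)) at_top"
    unfolding Q_def by (intro tendsto_intros src.law.cdf_lim_at_top_prob) auto
  have "A * (1 ^ 3 / 3 - 1 ^ 4 / 2 + 1 ^ 5 / 5) \<le> (LINT r|\<mu>\<^sub>g. ((q r)\<^sup>2 / (2 * c) + w r) * exp (- w r))"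
  proof (rule deficit_lower_bound_from_primitive[OF int _ _ _ _ _ lim])
    fix r :: real assume r: "0 < r"
    show "(Q has_real_derivative Q' r) (at r)"
      unfolding Q_def Q'_def
      by (auto intro!: derivative_eq_intros src.cdf_DERIV[OF r] simp: power2_eq_square algebra_simps eval_nat_numeral)
    have t: "0 < T r" "r \<le> T r" "Fg (T r) = Fp r" using T_transports r T_ge by auto
    have F01: "0 \<le> Fp r * (1 - Fp r)" using src.cdf_pos[OF r] src.cdf_less_one[of r] by simp
    have "D * (Fp r * (1 - Fp r)) \<le> n * ln (T r / r)"
      using cdf_excess(1)[OF r] cdf_le_log_ratio[OF r t(2)] t by simp
    then have "D / n * (Fp r * (1 - Fp r)) \<le> ln (T r / r)" using n by (simp add: field_simps)
    moreover have "0 \<le> D / n * (Fp r * (1 - Fp r))" using cdf_excess(3)[OF r] F01 by simp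
    ultimately have "(D / n * (Fp r * (1 - Fp r)))\<^sup>2 \<le> (ln (T r / r))\<^sup>2" by (rule power_mono)
    then have "A * (Fp r * (1 - Fp r))\<^sup>2 \<le> (ln (T r / r))\<^sup>2 / 2"
      by (simp add: A_def power_mult_distrib power_divide)
    also have "\<dots> \<le> T r / r - 1 - ln (T r / r)"
      by (rule half_square_le_log_gap) (use t r in simp)
    also have "\<dots> \<le> (real n - 1) * (T r / r - 1 - ln (T r / r))"
      using n2 ln_le_minus_one[of "T r / r"] t r by (simp add: mult_le_cancel_right1)
    also have "\<dots> \<le> gap r" by (rule gap_split(2)[OF r])
    finally show "Q' r \<le> gap r * p r" using p_pos[OF r] by (simp add: Q'_def mult_right_mono)
  next
    show "continuous_on {0<..} Q'" unfolding Q'_def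
      by (intro continuous_intros Fp_cont continuous_on_subset[OF p_cont]) auto
    have "(Q \<longlongrightarrow> A * (0 ^ 3 / 3 - 0 ^ 4 / 2 + 0 ^ 5 / 5)) (at_right 0)"
      unfolding Q_def by (intro tendsto_intros Fp_tendsto_0) auto
    then show "(Q \<longlongrightarrow> 0) (at_right 0)" by simp
  qed simp
  then show ?thesis by (simp add: A_def)
qed

text \<open>
  A log-concave \<open>p\<close> on the half-line satisfies \<open>p (r + s) p 0 \<le> p r p s\<close>. Integrating over \<open>s\<close> bounds the tail.
\<close>

lemma log_concave_tail:
  assumes n1: "n = 1" and r: "0 < r"
  shows "p 0 * (1 - Fp r) \<le> p r"
proof -
  define u where "u = (\<lambda>r. v r + w r)"
  have p_u: "p r = \<kappa> * exp (- u r)" for r by (simp add: p_eq g_eq n1 u_def exp_add exp_diff exp_minus field_simps)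
  have four: "u r + u s \<le> u (r + s) + u 0" if s: "0 < s" for s
  proof -
    define d where "d = (\<lambda>r. dv r + q r)"
    have sub: "u x + d x * (y - x) \<le> u y" for x y
    proof -
      have "0 \<le> c / 2 * (y - x)\<^sup>2" using c by simp
      then show ?thesis
        using v_convex[of x y] w_sub[of x y] unfolding u_def d_def distrib_right by linarith
    qed
    have "r * (u r + d r * s) + s * (u r + d r * (0 - r)) \<le> r * u (r + s) + s * u 0"
      using sub[of r "r + s"] sub[of r 0] r s by (intro add_mono mult_left_mono) auto
    moreover have "s * (u s + d s * r) + r * (u s + d s * (0 - s)) \<le> s * u (r + s) + r * u 0"
      using sub[of s "r + s"] sub[of s 0] r s by (intro add_mono mult_left_mono) auto
    ultimately have "(r + s) * (u r + u s) \<le> (r + s) * (u (r + s) + u 0)" by (simp add: algebra_simps)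
    then show ?thesis using r s by simp
  qed
  have ratio: "p (r + s) * p 0 \<le> p r * p s" if "0 < s" for s
    using four[OF that] kappa by (simp add: p_u flip: exp_add)
  have step: "p 0 * (Fp (r + s) - Fp r) \<le> p r * Fp s" if s: "0 \<le> s" for s
  proof -
    have "p r * Fp 0 - p 0 * Fp (r + 0) \<le> p r * Fp s - p 0 * Fp (r + s)"
    proof (rule DERIV_nonneg_imp_increasing_open[OF s, where f="\<lambda>s. p r * Fp s - p 0 * Fp (r + s)"])
      fix x assume x: "0 < x" "x < s"
      have "((\<lambda>s. Fp (r + s)) has_real_derivative p (r + x) * (0 + 1)) (at x)"
        using x r by (intro DERIV_chain2[OF src.cdf_DERIV] DERIV_add DERIV_const DERIV_ident) auto
      then have "((\<lambda>s. p r * Fp s - p 0 * Fp (r + s)) has_real_derivative p r * p x - p 0 * (p (r + x) * (0 + 1))) (at x)"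
        by (intro DERIV_diff DERIV_cmult src.cdf_DERIV x)
      then show "\<exists>y. ((\<lambda>s. p r * Fp s - p 0 * Fp (r + s)) has_real_derivative y) (at x) \<and> 0 \<le> y"
        using ratio[OF x(1)] by (auto simp: mult_ac)
    qed (intro continuous_intros Fp_cont continuous_on_compose2[OF Fp_cont[of UNIV]]; simp)
    then show ?thesis using src.cdf_nonpos[of 0] by (simp add: algebra_simps)
  qed
  have "((\<lambda>s. p 0 * (Fp (r + s) - Fp r)) \<longlongrightarrow> p 0 * (1 - Fp r)) at_top"
    by (intro tendsto_intros filterlim_compose[OF src.law.cdf_lim_at_top_prob]) real_asymp
  moreover have "((\<lambda>s. p r * Fp s) \<longlongrightarrow> p r * 1) at_top"
    by (intro tendsto_intros src.law.cdf_lim_at_top_prob)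
  moreover have "\<forall>\<^sub>F s in at_top. p 0 * (Fp (r + s) - Fp r) \<le> p r * Fp s"
    using eventually_ge_at_top[of 0] by eventually_elim (rule step)
  ultimately show ?thesis using tendsto_le[of at_top] by force
qed

text \<open>
  In dimension one \<open>gap\<close> only involves \<open>dT\<close>. It is bounded below by a linear function of \<open>dT\<close> with slope
  \<open>e k\<close>, where \<open>k p = p 0 (1 - Fp)\<close>; the tail bound gives \<open>k \<le> 1\<close>. The choice of \<open>k\<close> makes the derivative
  of \<open>k p\<close> equal to \<open>- p 0 p\<close>, so that an integration by parts leaves \<open>p 0 \<integral> (T r - r) p dr\<close>, and
  \<open>p 0 (T r - r)\<close> dominates the mass between \<open>r\<close> and \<open>T r\<close>. The quadratic loss is
  \<open>2 e\<^sup>2\<close>, the gain is \<open>e D / 6\<close>, and \<open>e = D / 24\<close> is the best choice.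
\<close>

lemma deficit_bound_one:
  assumes int: "integrable \<mu>\<^sub>g (\<lambda>r. (q r)\<^sup>2 * exp (- w r))" and n1: "n = 1"
  shows "D\<^sup>2 / 288 \<le> (LINT r|\<mu>\<^sub>g. ((q r)\<^sup>2 / (2 * c) + w r) * exp (- w r))"
proof -
  define e where "e = D / 24"
  have e: "0 \<le> e" "e \<le> 1/2" using cdf_excess(3,4)[of 1] by (auto simp: e_def)
  have g0: "g r \<le> g 0" if "0 \<le> r" for r using v_mono[of 0 r] that kappa by (simp add: g_eq n1)
  \<comment> \<open>The density \<open>exp (- w)\<close> has mean one and is largest at the origin.\<close>
  have p0: "g 0 \<le> p 0" "0 < g 0"
  proof -
    show "0 < g 0" using kappa by (simp add: g_eq n1)
    have "(LINT r|\<mu>\<^sub>g. exp (- w r)) \<le> (LINT r|\<mu>\<^sub>g. exp (- w 0))"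
    proof (rule integral_mono_AE[OF integral_h(1)])
      show "AE r in \<mu>\<^sub>g. exp (- w r) \<le> exp (- w 0)"
        using tgt.AE_law_pos by eventually_elim (simp add: w_mono)
    qed simp
    then have "1 \<le> exp (- w 0)" using integral_h(2) tgt.law.prob_space by simp
    then show "g 0 \<le> p 0" using \<open>0 < g 0\<close> by (simp add: p_eq)
  qed
  define Q where "Q = (\<lambda>r. e * p 0 * ((1 - Fp r) * (T r - r)) + e * D * (Fp r ^ 2 / 2 - Fp r ^ 3 / 3) - 2 * e\<^sup>2 * Fp r)"
  define Q' where "Q' = (\<lambda>r. e * p 0 * ((1 - Fp r) * (dT r - 1) - p r * (T r - r))
      + e * D * (Fp r * (1 - Fp r) * p r) - 2 * e\<^sup>2 * p r)"
  define Q1 where "Q1 = (\<lambda>r. e * D * (Fp r ^ 2 / 2 - Fp r ^ 3 / 3) - 2 * e\<^sup>2 * Fp r)"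
  have lim: "(Q1 \<longlongrightarrow> e * D * (1 ^ 2 / 2 - 1 ^ 3 / 3) - 2 * e\<^sup>2 * 1) at_top"
    unfolding Q1_def by (intro tendsto_intros src.law.cdf_lim_at_top_prob) auto
  have "e * D * (1 ^ 2 / 2 - 1 ^ 3 / 3) - 2 * e\<^sup>2 * 1 \<le> (LINT r|\<mu>\<^sub>g. ((q r)\<^sup>2 / (2 * c) + w r) * exp (- w r))"
  proof (rule deficit_lower_bound_from_primitive[OF int _ _ _ _ _ lim])
    fix r :: real assume r: "0 < r"
    have t: "0 < T r" "r \<le> T r" "Fg (T r) = Fp r" using T_transports r T_ge by auto
    have F01: "0 < Fp r" "Fp r < 1" using src.cdf_pos[OF r] src.cdf_less_one[of r] by auto
    show "(Q has_real_derivative Q' r) (at r)"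
      unfolding Q_def Q'_def
      by (auto intro!: derivative_eq_intros src.cdf_DERIV[OF r] T_DERIV_dT[OF r]
          simp: power2_eq_square algebra_simps eval_nat_numeral)
    show "Q1 r \<le> Q r" unfolding Q_def Q1_def using e p0 F01 t by simp
    have shift: "D * (Fp r * (1 - Fp r)) \<le> p 0 * (T r - r)"
    proof -
      have "D * (Fp r * (1 - Fp r)) \<le> Fg (T r) - Fg r" using cdf_excess(1)[OF r] t by simp
      also have "\<dots> \<le> g 0 * (T r - r)"
      proof -
        have "g 0 * r - Fg r \<le> g 0 * T r - Fg (T r)"
        proof (rule DERIV_nonneg_imp_nondecreasing[OF t(2)])
          fix s assume "r \<le> s" "s \<le> T r"
          then have s: "0 < s" using r by simp
          have "((\<lambda>s. g 0 * s - Fg s) has_real_derivative g 0 - g s) (at s)"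
            by (auto intro!: derivative_eq_intros tgt.cdf_DERIV s)
          then show "\<exists>y. ((\<lambda>s. g 0 * s - Fg s) has_real_derivative y) (at s) \<and> 0 \<le> y"
            using g0[of s] s by force
        qed
        then show ?thesis by (simp add: algebra_simps)
      qed
      also have "\<dots> \<le> p 0 * (T r - r)" using p0 t by (intro mult_right_mono) auto
      finally show ?thesis .
    qed
    define a where "a = e * (p 0 * (1 - Fp r) / p r)"
    have k: "0 \<le> p 0 * (1 - Fp r) / p r" "p 0 * (1 - Fp r) / p r \<le> 1"
      using log_concave_tail[OF n1 r] p_pos[OF r] p0 F01 by auto
    have a: "0 \<le> a" "a \<le> e"
      unfolding a_def using mult_nonneg_nonneg[OF e(1) k(1)] mult_left_mono[OF k(2) e(1)] by simp_all
    have "a\<^sup>2 \<le> e\<^sup>2" using a by (intro power_mono) auto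
    then have "a * (dT r - 1) - 2 * e\<^sup>2 \<le> a * (dT r - 1) - 2 * a\<^sup>2" by simp
    also have "\<dots> \<le> dT r - 1 - ln (dT r)"
      using a e by (intro linear_le_log_gap dT_pos r) auto
    also have "\<dots> \<le> gap r" by (rule gap_split(1)[OF r])
    finally have "(a * (dT r - 1) - 2 * e\<^sup>2) * p r \<le> gap r * p r"
      using p_pos[OF r] by (intro mult_right_mono) auto
    moreover have "(a * (dT r - 1) - 2 * e\<^sup>2) * p r = e * p 0 * ((1 - Fp r) * (dT r - 1)) - 2 * e\<^sup>2 * p r"
      using p_pos[OF r] by (simp add: a_def field_simps)
    moreover have "e * p r * (D * (Fp r * (1 - Fp r))) \<le> e * p r * (p 0 * (T r - r))"
      using shift e p_pos[OF r] by (intro mult_left_mono) auto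
    ultimately show "Q' r \<le> gap r * p r" by (simp add: Q'_def algebra_simps)
  next
    show "continuous_on {0<..} Q'" unfolding Q'_def
      by (intro continuous_intros Fp_cont T_cont dT_cont continuous_on_subset[OF p_cont]) auto
    have "(Q \<longlongrightarrow> e * p 0 * ((1 - 0) * (0 - 0)) + e * D * (0 ^ 2 / 2 - 0 ^ 3 / 3) - 2 * e\<^sup>2 * 0) (at_right 0)"
      unfolding Q_def by (intro tendsto_intros Fp_tendsto_0 T_tendsto_0) auto
    then show "(Q \<longlongrightarrow> 0) (at_right 0)" by simp
  qed
  then show ?thesis by (simp add: e_def power2_eq_square field_simps)
qed

theorem deficit_bound:
  assumes int: "integrable \<mu>\<^sub>g (\<lambda>r. (q r)\<^sup>2 * exp (- w r))"
  shows "D\<^sup>2 / (288 * n\<^sup>2) \<le> (LINT r|\<mu>\<^sub>g. ((q r)\<^sup>2 / (2 * c) + w r) * exp (- w r))"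
proof (cases "n = 1")
  case True
  then show ?thesis using deficit_bound_one[OF int] by simp
next
  case False
  then have n2: "2 \<le> n" using n by simp
  have "D\<^sup>2 / (288 * n\<^sup>2) \<le> D\<^sup>2 / (60 * n\<^sup>2)"
    using n by (intro divide_left_mono) auto
  then show ?thesis using deficit_bound_higher[OF int n2] by linarith
qed

end

section \<open>Weak gradients\<close>

lemma partial_derivative_eq:
  assumes "(h has_derivative h') (at x)" shows "partial_derivative i h x = h' (axis i 1)"
  unfolding partial_derivative_def using frechet_derivative_at[OF assms] by simp

lemma C1_I:
  fixes h :: "real^'n::finite \<Rightarrow> real"
  assumes "\<And>x. (h has_derivative h' x) (at x)" "\<And>i. continuous_on UNIV (\<lambda>x. h' x (axis i 1))"
  shows "C_k 1 h"
  using assms partial_derivative_eq[OF assms(1)]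
  by (auto simp: differentiable_on_def differentiable_def has_derivative_at_withinI)

lemma C1_has_derivative:
  assumes "C_k 1 h" shows "(h has_derivative frechet_derivative h (at x)) (at x)"
  using assms by (simp add: differentiable_on_def frechet_derivative_works[symmetric])

lemma C1_partial_continuous: "C_k 1 h \<Longrightarrow> continuous_on UNIV (partial_derivative i h)"
  by simp

lemma C1_continuous: "C_k 1 h \<Longrightarrow> continuous_on S h"
  using C1_has_derivative by (meson continuous_at_imp_continuous_on has_derivative_continuous)

lemma C1_frechet_continuous:
  "C_k 1 h \<Longrightarrow> continuous_on UNIV (\<lambda>x. frechet_derivative h (at x) (axis i 1))"
  using C1_partial_continuous[of h i] unfolding partial_derivative_def[abs_def] by simp

lemma C1_const: "C_k 1 (\<lambda>x. c)"
  by (rule C1_I[where h'="\<lambda>_ _. 0"]) auto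

lemma C1_mult:
  assumes "C_k 1 f" "C_k 1 h" shows "C_k 1 (\<lambda>x. f x * h x)"
proof (rule C1_I)
  show "((\<lambda>x. f x * h x) has_derivative
      (\<lambda>y. f x * frechet_derivative h (at x) y + frechet_derivative f (at x) y * h x)) (at x)" for x
    by (intro has_derivative_mult C1_has_derivative assms)
  show "continuous_on UNIV (\<lambda>x. f x * frechet_derivative h (at x) (axis i 1)
      + frechet_derivative f (at x) (axis i 1) * h x)" for i
    by (intro continuous_on_add continuous_on_mult C1_frechet_continuous[OF assms(1)]
        C1_frechet_continuous[OF assms(2)] C1_continuous[OF assms(1)] C1_continuous[OF assms(2)])
qed

lemma C1_prod:
  assumes "finite J" "\<And>j. j \<in> J \<Longrightarrow> C_k 1 (f j)" shows "C_k 1 (\<lambda>x. \<Prod>j\<in>J. f j x)"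
  using assms
proof (induction J)
  case empty
  then show ?case using C1_const by simp
next
  case (insert j J)
  then have "C_k 1 (\<lambda>x. f j x * (\<Prod>j\<in>J. f j x))" by (intro C1_mult) blast+
  then show ?case using insert by simp
qed

lemma C1_compose:
  fixes h :: "real^'n::finite \<Rightarrow> real"
  assumes "C_k 1 h" "\<And>t. (\<beta> has_real_derivative \<beta>' t) (at t)" "continuous_on UNIV \<beta>'"
  shows "C_k 1 (\<lambda>x. \<beta> (h x))"
proof (rule C1_I)
  show "((\<lambda>x. \<beta> (h x)) has_derivative (\<lambda>y. \<beta>' (h x) * frechet_derivative h (at x) y)) (at x)" for x
    by (rule has_derivative_compose[OF C1_has_derivative[OF assms(1)]
          assms(2)[unfolded has_field_derivative_def]])
  show "continuous_on UNIV (\<lambda>x. \<beta>' (h x) * frechet_derivative h (at x) (axis i 1))" for i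
    by (intro continuous_on_mult C1_frechet_continuous[OF assms(1)]
        continuous_on_compose2[OF assms(3) C1_continuous[OF assms(1)]]) simp
qed

lemma C1_coordinate: "C_k 1 (\<lambda>x::real^'n::finite. x $ j)"
  by (rule C1_I[where h'="\<lambda>_ y. y $ j"]) (auto intro: bounded_linear_imp_has_derivative[OF bounded_linear_vec_nth])

lemma positive_part_square_DERIV:
  "((\<lambda>s::real. (max 0 s)\<^sup>2) has_real_derivative 2 * max 0 s) (at s)"
proof -
  have "((\<lambda>t. ((max 0 t)\<^sup>2 - (max 0 s)\<^sup>2) / (t - s)) \<longlongrightarrow> 2 * max 0 s) (at s)"
  proof (rule Lim_transform_eventually)
    show "((\<lambda>t. if t = s then 2 * max 0 s else ((max 0 t)\<^sup>2 - (max 0 s)\<^sup>2) / (t - s)) \<longlongrightarrow> 2 * max 0 s) (at s)"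
    proof (rule metric_tendsto_imp_tendsto[where f="\<lambda>t. t" and a=s])
      have "\<bar>((max 0 t)\<^sup>2 - (max 0 s)\<^sup>2) / (t - s) - 2 * max 0 s\<bar> \<le> \<bar>t - s\<bar>" if "t \<noteq> s" for t
      proof -
        have "\<bar>(max 0 t)\<^sup>2 - (max 0 s)\<^sup>2 - 2 * max 0 s * (t - s)\<bar> \<le> (t - s)\<^sup>2"
        proof (cases "0 \<le> s"; cases "0 \<le> t")
          assume "0 \<le> s" "\<not> 0 \<le> t"
          then have st: "0 \<le> - (s * t)" and m: "max 0 t = 0" "max 0 s = s"
            by (simp_all add: mult_nonneg_nonpos)
          have e: "0\<^sup>2 - s\<^sup>2 - 2 * s * (t - s) = s\<^sup>2 + 2 * - (s * t)" "(t - s)\<^sup>2 = t\<^sup>2 + (s\<^sup>2 + 2 * - (s * t))"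
            by (simp_all add: power2_eq_square algebra_simps)
          have "0 \<le> s\<^sup>2 + 2 * - (s * t)" by (rule add_nonneg_nonneg) (use st in auto)
          then show ?thesis unfolding m e by simp
        next
          assume "\<not> 0 \<le> s" "0 \<le> t"
          then have "t\<^sup>2 \<le> (t - s)\<^sup>2" by (intro power_mono) auto
          then show ?thesis using \<open>\<not> 0 \<le> s\<close> \<open>0 \<le> t\<close> by (simp add: max_def)
        next
          assume "0 \<le> s" "0 \<le> t"
          then have "(max 0 t)\<^sup>2 - (max 0 s)\<^sup>2 - 2 * max 0 s * (t - s) = (t - s)\<^sup>2"
            by (simp add: power2_eq_square algebra_simps)
          then show ?thesis by simp
        next
          assume "\<not> 0 \<le> s" "\<not> 0 \<le> t"
          then show ?thesis by (simp add: max_def)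
        qed
        then have "\<bar>(max 0 t)\<^sup>2 - (max 0 s)\<^sup>2 - 2 * max 0 s * (t - s)\<bar> / \<bar>t - s\<bar> \<le> (t - s)\<^sup>2 / \<bar>t - s\<bar>"
          by (rule divide_right_mono) simp
        moreover have "((max 0 t)\<^sup>2 - (max 0 s)\<^sup>2) / (t - s) - 2 * max 0 s
           = ((max 0 t)\<^sup>2 - (max 0 s)\<^sup>2 - 2 * max 0 s * (t - s)) / (t - s)"
          using that by (simp add: field_simps)
        moreover have "(t - s)\<^sup>2 / \<bar>t - s\<bar> = \<bar>t - s\<bar>"
          by (metis abs_mult_self_eq nonzero_mult_div_cancel_left power2_eq_square div_0 abs_0_eq mult_zero_left)
        ultimately show ?thesis by (simp add: abs_divide)
      qed
      then show "\<forall>\<^sub>F t in at s. dist (if t = s then 2 * max 0 s else ((max 0 t)\<^sup>2 - (max 0 s)\<^sup>2) / (t - s)) (2 * max 0 s)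
          \<le> dist t s"
        by (intro always_eventually) (auto simp: dist_real_def)
    qed simp
    show "\<forall>\<^sub>F t in at s. (if t = s then 2 * max 0 s else ((max 0 t)\<^sup>2 - (max 0 s)\<^sup>2) / (t - s))
        = ((max 0 t)\<^sup>2 - (max 0 s)\<^sup>2) / (t - s)"
      by (simp add: eventually_at_filter)
  qed
  then show ?thesis by (simp add: has_field_derivative_iff)
qed

text \<open>
  The product of \<open>(max 0 (x\<^sub>j - a\<^sub>j))\<^sup>2\<close> and \<open>(max 0 (b\<^sub>j - x\<^sub>j))\<^sup>2\<close> over all coordinates is a \<open>C\<^sup>1\<close> function \<open>\<rho>\<close>
  that is positive exactly on the open box; the functions \<open>1 - exp (- k \<rho>)\<close> increase to its indicator.
\<close>

lemma box_indicator_approximation: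
  fixes a b :: "real^'n::finite"
  obtains \<phi> :: "nat \<Rightarrow> real^'n \<Rightarrow> real"
  where "\<And>k. C_k 1 (\<phi> k)" "\<And>k. {x. \<phi> k x \<noteq> 0} \<subseteq> cbox a b" "\<And>k x. \<bar>\<phi> k x\<bar> \<le> 1"
    "\<And>x. (\<lambda>k. \<phi> k x) \<longlonglongrightarrow> indicator (box a b) x"
proof -
  define \<sigma> :: "real \<Rightarrow> real" where "\<sigma> s = (max 0 s)\<^sup>2" for s
  have \<sigma>0: "0 \<le> \<sigma> s" "\<sigma> s \<noteq> 0 \<longleftrightarrow> 0 < s" for s by (auto simp: \<sigma>_def max_def)
  have \<sigma>_DERIV: "(\<sigma> has_real_derivative 2 * max 0 s) (at s)" for s
    unfolding \<sigma>_def[abs_def] by (rule positive_part_square_DERIV)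
  define \<rho> :: "real^'n \<Rightarrow> real" where "\<rho> x = (\<Prod>j\<in>UNIV. \<sigma> (x $ j - a $ j) * \<sigma> (b $ j - x $ j))" for x
  have lin: "C_k 1 (\<lambda>x::real^'n. \<sigma> (s * (x $ j) + t))" for j s t
  proof (rule C1_compose[OF C1_coordinate, where \<beta>'="\<lambda>y. 2 * max 0 (s * y + t) * s"])
    show "((\<lambda>y. \<sigma> (s * y + t)) has_real_derivative 2 * max 0 (s * y + t) * s) (at y)" for y
      by (rule DERIV_chain2[OF \<sigma>_DERIV]) (auto intro!: derivative_eq_intros)
  qed (intro continuous_intros)
  have "C_k 1 (\<lambda>x::real^'n. \<sigma> (x $ j - a $ j))" "C_k 1 (\<lambda>x::real^'n. \<sigma> (b $ j - x $ j))" for j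
    using lin[of 1 j "- a $ j"] lin[of "-1" j "b $ j"] by simp_all
  then have \<rho>: "C_k 1 \<rho>" unfolding \<rho>_def[abs_def] by (intro C1_prod C1_mult) auto
  have \<rho>0: "0 \<le> \<rho> x" for x unfolding \<rho>_def by (intro prod_nonneg) (simp add: \<sigma>0)
  have \<rho>1: "\<rho> x \<noteq> 0 \<longleftrightarrow> x \<in> box a b" for x
  proof -
    have "\<rho> x \<noteq> 0 \<longleftrightarrow> (\<forall>j. \<sigma> (x $ j - a $ j) \<noteq> 0 \<and> \<sigma> (b $ j - x $ j) \<noteq> 0)" by (simp add: \<rho>_def)
    also have "\<dots> \<longleftrightarrow> (\<forall>j. a $ j < x $ j \<and> x $ j < b $ j)" unfolding \<sigma>0(2) by simp
    finally show ?thesis by (simp add: mem_box_cart)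
  qed
  show thesis
  proof
    fix k :: nat and x
    show "C_k 1 (\<lambda>x. 1 - exp (- (real k * \<rho> x)))"
      by (rule C1_compose[OF \<rho>, where \<beta>="\<lambda>y. 1 - exp (- (real k * y))" and \<beta>'="\<lambda>y. real k * exp (- (real k * y))"])
        (auto intro!: derivative_eq_intros continuous_intros)
    show "{x. 1 - exp (- (real k * \<rho> x)) \<noteq> 0} \<subseteq> cbox a b"
      using \<rho>1 box_subset_cbox[of a b] by auto
    show "\<bar>1 - exp (- (real k * \<rho> x))\<bar> \<le> 1"
    proof -
      have "0 \<le> real k * \<rho> x" using \<rho>0[of x] by simp
      then have "exp (- (real k * \<rho> x)) \<le> 1" by simp
      then show ?thesis by simp
    qed
    show "(\<lambda>k. 1 - exp (- (real k * \<rho> x))) \<longlonglongrightarrow> indicator (box a b) x"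
    proof (cases "x \<in> box a b")
      case True
      then have "0 < \<rho> x" using \<rho>1 \<rho>0[of x] by (simp add: less_le)
      then have "(\<lambda>k. 1 - exp (- (real k * \<rho> x))) \<longlonglongrightarrow> 1" by real_asymp
      then show ?thesis using True by simp
    next
      case False
      then have "\<rho> x = 0" using \<rho>1 by blast
      then show ?thesis using False by simp
    qed
  qed
qed

text \<open>
  By the approximation above the integral of \<open>u\<close> vanishes over every box. Hence the measures with the
  positive and the negative part of \<open>u\<close> as densities agree on boxes, which generate the Borel sets.
\<close>

lemma AE_zero_by_testing:
  fixes u :: "real^'n::finite \<Rightarrow> real"
  assumes loc: "locally_integrable u"
    and test: "\<And>\<phi>. C_k 1 \<phi> \<Longrightarrow> compact (closure {x. \<phi> x \<noteq> 0}) \<Longrightarrow> (LINT x|lborel. u x * \<phi> x) = 0"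
  shows "AE x in lborel. u x = 0"
proof -
  have [measurable]: "u \<in> borel_measurable borel" using loc by (simp add: locally_integrable_def)
  have int: "integrable lborel (\<lambda>x. indicator (cbox a b) x * u x)" for a b
    using loc by (auto simp: locally_integrable_def set_integrable_def)
  have intb: "integrable lborel (\<lambda>x. indicator (box a b) x * u x)" for a b
    using set_integrable_subset[of lborel "cbox a b" u "box a b"] int[of a b] box_subset_cbox[of a b]
    by (simp add: set_integrable_def)
  have box: "(LINT x|lborel. indicator (box a b) x * u x) = 0" for a b
  proof -
    obtain \<phi> :: "nat \<Rightarrow> real^'n \<Rightarrow> real" where \<phi>: "\<And>k. C_k 1 (\<phi> k)" "\<And>k. {x. \<phi> k x \<noteq> 0} \<subseteq> cbox a b"
      "\<And>k x. \<bar>\<phi> k x\<bar> \<le> 1" "\<And>x. (\<lambda>k. \<phi> k x) \<longlonglongrightarrow> indicator (box a b) x"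
      using box_indicator_approximation[of a b] by metis
    have [measurable]: "\<phi> k \<in> borel_measurable borel" for k
      by (rule borel_measurable_continuous_onI[OF C1_continuous[OF \<phi>(1)]])
    have "(\<lambda>k. LINT x|lborel. u x * \<phi> k x) \<longlonglongrightarrow> (LINT x|lborel. u x * indicator (box a b) x)"
    proof (rule integral_dominated_convergence[where w="\<lambda>x. \<bar>indicator (cbox a b) x * u x\<bar>"])
      show "AE x in lborel. norm (u x * \<phi> k x) \<le> \<bar>indicator (cbox a b) x * u x\<bar>" for k
      proof (rule AE_I2)
        fix x
        show "norm (u x * \<phi> k x) \<le> \<bar>indicator (cbox a b) x * u x\<bar>"
          using \<phi>(2)[of k] \<phi>(3)[of k x] by (cases "\<phi> k x = 0") (auto simp: abs_mult mult_left_le)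
      qed
      show "integrable lborel (\<lambda>x. \<bar>indicator (cbox a b) x * u x\<bar>)"
        using int by (rule integrable_abs)
    qed (use \<phi>(4) in \<open>auto intro!: AE_I2 tendsto_intros\<close>)
    moreover have "(LINT x|lborel. u x * \<phi> k x) = 0" for k
    proof (rule test[OF \<phi>(1)])
      have "closure {x. \<phi> k x \<noteq> 0} \<subseteq> cbox a b" using \<phi>(2) by (intro closure_minimal) auto
      then show "compact (closure {x. \<phi> k x \<noteq> 0})"
        using compact_Int_closed[OF compact_cbox[of a b] closed_closure] by (metis inf.absorb2)
    qed
    ultimately show ?thesis using LIMSEQ_unique[OF _ tendsto_const[of 0]] by (simp add: mult.commute)
  qed
  have "density lborel (\<lambda>x. ennreal (u x)) = density lborel (\<lambda>x. ennreal (- u x))"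
  proof (rule measure_eqI_generator_eq[where E="range (\<lambda>(a, b). box a b)" and \<Omega>=UNIV
        and A="\<lambda>i. box (- (real i *\<^sub>R One)) (real i *\<^sub>R One)"])
    have pos: "(\<integral>\<^sup>+x. ennreal (s * u x) * indicator (box a b) x \<partial>lborel)
        = (\<integral>\<^sup>+x. ennreal (s * (indicator (box a b) x * u x)) \<partial>lborel)" for s a b
      by (intro nn_integral_cong) (auto simp: indicator_def)
    have fin: "(\<integral>\<^sup>+x. ennreal (s * (indicator (box a b) x * u x)) \<partial>lborel) \<noteq> \<infinity>" if "s = 1 \<or> s = -1" for s a b
    proof -
      show ?thesis using intb[of a b] that by (auto simp: real_integrable_def)
    qed
    have em: "emeasure (density lborel (\<lambda>x. ennreal (s * u x))) (box a b)
        = (\<integral>\<^sup>+x. ennreal (s * (indicator (box a b) x * u x)) \<partial>lborel)" for s a b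
      by (subst emeasure_density) (auto simp: pos)
    show "emeasure (density lborel (\<lambda>x. ennreal (u x))) X = emeasure (density lborel (\<lambda>x. ennreal (- u x))) X"
      if "X \<in> range (\<lambda>(a, b). box a b)" for X
    proof -
      from that obtain ab where "X = (\<lambda>(a, b). box a b) ab" by (rule rangeE)
      then obtain a b where X: "X = box a b" by (cases ab) simp
      have "0 = enn2real (\<integral>\<^sup>+x. ennreal (indicator (box a b) x * u x) \<partial>lborel)
        - enn2real (\<integral>\<^sup>+x. ennreal (- (indicator (box a b) x * u x)) \<partial>lborel)"
        using real_lebesgue_integral_def[OF intb[of a b]] box by simp
      then have "(\<integral>\<^sup>+x. ennreal (indicator (box a b) x * u x) \<partial>lborel)
        = (\<integral>\<^sup>+x. ennreal (- (indicator (box a b) x * u x)) \<partial>lborel)"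
        using ennreal_enn2real[of "\<integral>\<^sup>+x. ennreal (indicator (box a b) x * u x) \<partial>lborel"]
          ennreal_enn2real[of "\<integral>\<^sup>+x. ennreal (- (indicator (box a b) x * u x)) \<partial>lborel"]
          fin[of 1 a b] fin[of "-1" a b] by (simp add: less_top)
      then show ?thesis using em[of 1 a b] em[of "-1" a b] by (simp add: X)
    qed
    show "emeasure (density lborel (\<lambda>x. ennreal (u x))) (box (- (real i *\<^sub>R One)) (real i *\<^sub>R One)) \<noteq> \<infinity>" for i
      using em[of 1] fin[of 1] by simp
    show "Int_stable (range (\<lambda>(a, b). box a b) :: (real^'n) set set)"
      by (auto simp: Int_stable_def box_Int_box)
    show "sets (density lborel (\<lambda>x. ennreal (u x))) = sigma_sets UNIV (range (\<lambda>(a, b). box a b))"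
      "sets (density lborel (\<lambda>x. ennreal (- u x))) = sigma_sets UNIV (range (\<lambda>(a, b). box a b))"
      by (simp_all add: borel_eq_box)
    show "(\<Union>i::nat. box (- (real i *\<^sub>R One)) (real i *\<^sub>R One) :: (real^'n) set) = UNIV"
      by (rule UN_box_eq_UNIV)
    show "range (\<lambda>i::nat. box (- (real i *\<^sub>R One)) (real i *\<^sub>R One) :: (real^'n) set) \<subseteq> range (\<lambda>(a, b). box a b)"
      by auto
  qed simp
  then have "AE x in lborel. ennreal (u x) = ennreal (- u x)"
    by (subst (asm) sigma_finite_measure.density_unique_iff[OF sigma_finite_lborel]) auto
  then show ?thesis
  proof eventually_elim
    case (elim x)
    show ?case
    proof (cases "0 \<le> u x")
      case True
      then have "ennreal (u x) = 0" using elim ennreal_neg[of "- u x"] by simp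
      then show ?thesis using True by simp
    next
      case False
      then have "ennreal (- u x) = 0" using elim ennreal_neg[of "u x"] by simp
      then show ?thesis using False by simp
    qed
  qed
qed

lemma borel_measurable_component:
  fixes g :: "'a \<Rightarrow> real^'n::finite"
  assumes [measurable]: "g \<in> borel_measurable M" shows "(\<lambda>x. g x $ i) \<in> borel_measurable M"
  unfolding cart_eq_inner_axis by measurable

lemma weak_gradient_locally_integrable: "has_weak_gradient f g \<Longrightarrow> locally_integrable g"
  unfolding has_weak_gradient_def by (elim conjE)

lemma weak_gradient_test:
  assumes "has_weak_gradient f g" "C_k 1 \<phi>" "compact (closure {x. \<phi> x \<noteq> 0})"
  shows "(LINT x|lborel. f x * partial_derivative i \<phi> x) = - (LINT x|lborel. g x $ i * \<phi> x)"
  using assms unfolding has_weak_gradient_def by blast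

lemma weak_gradient_unique:
  fixes f :: "real^'n::finite \<Rightarrow> real"
  assumes "has_weak_gradient f g1" "has_weak_gradient f g2"
  shows "AE x in lborel. g1 x = g2 x"
proof -
  have comp: "AE x in lborel. g1 x $ i - g2 x $ i = 0" for i
  proof (rule AE_zero_by_testing)
    have l: "locally_integrable g1" "locally_integrable g2" by (rule weak_gradient_locally_integrable[OF assms(1)], rule weak_gradient_locally_integrable[OF assms(2)])
    have li: "set_integrable lborel K (\<lambda>x. g x $ i)" if "locally_integrable g" "compact K" for g :: "real^'n \<Rightarrow> real^'n" and K
      using integrable_bounded_linear[OF bounded_linear_vec_nth, of lborel "\<lambda>x. indicator K x *\<^sub>R g x" i] that
      by (simp add: locally_integrable_def set_integrable_def)
    show "locally_integrable (\<lambda>x. g1 x $ i - g2 x $ i)"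
      unfolding locally_integrable_def
    proof (intro conjI allI impI)
      have [measurable]: "g1 \<in> borel_measurable borel" "g2 \<in> borel_measurable borel"
        using l by (simp_all only: locally_integrable_def)
      show "(\<lambda>x. g1 x $ i - g2 x $ i) \<in> borel_measurable borel"
        by (intro borel_measurable_diff borel_measurable_component) fact+
      show "set_integrable lborel K (\<lambda>x. g1 x $ i - g2 x $ i)" if "compact K" for K
        by (rule set_integral_diff(1)[OF li[OF l(1) that] li[OF l(2) that]])
    qed
    fix \<phi> :: "real^'n \<Rightarrow> real" assume \<phi>: "C_k 1 \<phi>" "compact (closure {x. \<phi> x \<noteq> 0})"
    have [measurable]: "\<phi> \<in> borel_measurable borel"
      by (rule borel_measurable_continuous_onI[OF C1_continuous[OF \<phi>(1)]])
    let ?K = "closure {x. \<phi> x \<noteq> 0}"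
    have "bounded (\<phi> ` ?K)"
      by (intro compact_imp_bounded compact_continuous_image C1_continuous \<phi>)
    then obtain B where B: "\<And>x. x \<in> ?K \<Longrightarrow> norm (\<phi> x) \<le> B" unfolding bounded_iff by (metis image_eqI)
    have int: "integrable lborel (\<lambda>x. g x $ i * \<phi> x)" if g: "locally_integrable g" for g :: "real^'n \<Rightarrow> real^'n"
    proof (rule Bochner_Integration.integrable_bound[where f="\<lambda>x. B * (indicator ?K x *\<^sub>R g x $ i)"])
      have [measurable]: "g \<in> borel_measurable borel" using g by (simp only: locally_integrable_def)
      show "(\<lambda>x. g x $ i * \<phi> x) \<in> borel_measurable lborel"
        by (intro borel_measurable_times borel_measurable_component) simp_all
      show "integrable lborel (\<lambda>x. B * (indicator ?K x *\<^sub>R g x $ i))"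
        using li[OF g \<phi>(2)] by (simp add: set_integrable_def)
      show "AE x in lborel. norm (g x $ i * \<phi> x) \<le> norm (B * (indicator ?K x *\<^sub>R g x $ i))"
      proof (rule AE_I2)
        fix x
        show "norm (g x $ i * \<phi> x) \<le> norm (B * (indicator ?K x *\<^sub>R g x $ i))"
        proof (cases "\<phi> x = 0")
          case False
          then have "x \<in> ?K" using closure_subset[of "{x. \<phi> x \<noteq> 0}"] by auto
          then have "\<bar>\<phi> x\<bar> \<le> \<bar>B\<bar>" using B[of x] by simp
          then have "\<bar>\<phi> x\<bar> * \<bar>g x $ i\<bar> \<le> \<bar>B\<bar> * \<bar>g x $ i\<bar>" by (rule mult_right_mono) simp
          then show ?thesis using \<open>x \<in> ?K\<close> by (simp add: abs_mult ac_simps)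
        qed simp
      qed
    qed
    have "(LINT x|lborel. g1 x $ i * \<phi> x) = (LINT x|lborel. g2 x $ i * \<phi> x)"
    proof -
      have "(LINT x|lborel. f x * partial_derivative i \<phi> x) = - (LINT x|lborel. g x $ i * \<phi> x)"
        if "has_weak_gradient f g" for g
        using weak_gradient_test[OF that \<phi>] .
      from this[OF assms(1)] this[OF assms(2)] show ?thesis by (simp only: neg_equal_iff_equal)
    qed
    then show "(LINT x|lborel. (g1 x $ i - g2 x $ i) * \<phi> x) = 0"
      using int[OF l(1)] int[OF l(2)] by (simp add: left_diff_distrib)
  qed
  have "AE x in lborel. \<forall>i\<in>UNIV. g1 x $ i - g2 x $ i = 0"
    by (rule AE_finite_allI[OF finite]) (rule comp)
  then show ?thesis by eventually_elim (simp add: vec_eq_iff)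
qed

lemma has_weak_gradient_weak_grad:
  assumes "has_weak_gradient f g" shows "has_weak_gradient f (weak_grad f)"
  using someI[of "has_weak_gradient f" g, OF assms] by (simp only: weak_grad_def)

lemma weak_grad_eq:
  assumes "has_weak_gradient f g" shows "AE x in lborel. weak_grad f x = g x"
  by (rule weak_gradient_unique[OF has_weak_gradient_weak_grad[OF assms] assms])

section \<open>Radial functions\<close>

lemma AE_norm_notin_countable:
  fixes N :: "real set"
  assumes "countable N"
  shows "AE x in lborel. norm (x :: real^'n::finite) \<notin> N"
proof -
  have "sphere (0 :: real^'n) r \<in> null_sets lborel" for r
    using negligible_sphere[of "0 :: real^'n" r]
    by (simp add: null_sets_completion_iff negligible_iff_null_sets)
  then have "(\<Union>r\<in>N. sphere (0 :: real^'n) r) \<in> null_sets lborel"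
    using assms by (intro null_sets_UN') auto
  then have "AE x in lborel. x \<notin> (\<Union>r\<in>N. sphere (0 :: real^'n) r)" by (rule AE_not_in)
  then show ?thesis by eventually_elim (auto simp: dist_norm)
qed

lemma radial_DERIV:
  fixes x :: "real^'n::finite"
  assumes "(F has_real_derivative F') (at (norm x))" "x \<noteq> 0"
  shows "((\<lambda>x. F (norm x)) has_derivative (\<lambda>y. F' * (sgn x \<bullet> y))) (at x)"
  using has_derivative_compose[OF has_derivative_norm[OF assms(2)] assms(1)[unfolded has_field_derivative_def]]
  by (simp add: inner_commute)

lemma directional_DERIV:
  fixes h :: "real^'n::finite \<Rightarrow> real"
  assumes "(h has_derivative h') (at (x + t *\<^sub>R e))"
  shows "((\<lambda>t. h (x + t *\<^sub>R e)) has_real_derivative h' e) (at t)"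
proof -
  have "((\<lambda>t. x + t *\<^sub>R e) has_derivative (\<lambda>s. s *\<^sub>R e)) (at t)"
    by (auto intro!: derivative_eq_intros)
  from has_derivative_compose[OF this assms]
  have "((\<lambda>t. h (x + t *\<^sub>R e)) has_derivative (\<lambda>s. h' (s *\<^sub>R e))) (at t)" .
  moreover have "h' (s *\<^sub>R e) = h' e * s" for s
    using linear_scale[OF has_derivative_linear[OF assms]] by simp
  ultimately show ?thesis by (simp add: has_field_derivative_def)
qed

lemma lborel_integral_translate:
  fixes f :: "'a::euclidean_space \<Rightarrow> real"
  assumes [measurable]: "f \<in> borel_measurable borel"
  shows "(LINT x|lborel. f (c + x)) = (LINT x|lborel. f x)"
    "integrable lborel (\<lambda>x. f (c + x)) \<longleftrightarrow> integrable lborel f"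
proof -
  have "(LINT x|lborel. f x) = (LINT x|distr lborel borel ((+) c). f x)" by (simp add: lborel_distr_plus)
  also have "\<dots> = (LINT x|lborel. f (c + x))" by (rule integral_distr) auto
  finally show "(LINT x|lborel. f (c + x)) = (LINT x|lborel. f x)" ..
  have "integrable lborel f \<longleftrightarrow> integrable (distr lborel borel ((+) c)) f" by (simp add: lborel_distr_plus)
  also have "\<dots> \<longleftrightarrow> integrable lborel (\<lambda>x. f (c + x))" by (rule integrable_distr_eq) auto
  finally show "integrable lborel (\<lambda>x. f (c + x)) \<longleftrightarrow> integrable lborel f" ..
qed

lemma test_function_bounds:
  fixes \<phi> :: "real^'n::finite \<Rightarrow> real"
  assumes "C_k 1 \<phi>" "compact (closure {x. \<phi> x \<noteq> 0})"
  obtains R B where "0 \<le> R" "0 \<le> B" "\<And>x. R < norm x \<Longrightarrow> \<phi> x = 0" "\<And>x. \<bar>\<phi> x\<bar> \<le> B"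
    "\<And>x i. \<bar>partial_derivative i \<phi> x\<bar> \<le> B"
proof -
  let ?K = "closure {x. \<phi> x \<noteq> 0}"
  obtain R where R: "\<And>x. x \<in> ?K \<Longrightarrow> norm x \<le> R"
    using compact_imp_bounded[OF assms(2)] unfolding bounded_iff by blast
  have out: "\<phi> x = 0" if "max 0 R < norm x" for x
    using R[of x] that closure_subset[of "{x. \<phi> x \<noteq> 0}"] by fastforce
  have bdd: "\<exists>B. \<forall>x\<in>cball 0 (max 0 R). \<bar>h x\<bar> \<le> B" if "continuous_on UNIV h" for h :: "real^'n \<Rightarrow> real"
  proof -
    have "bounded (h ` cball 0 (max 0 R))"
      by (intro compact_imp_bounded compact_continuous_image continuous_on_subset[OF that]) auto
    then show ?thesis unfolding bounded_iff by (metis image_eqI real_norm_def)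
  qed
  obtain B0 where B0: "\<And>x. x \<in> cball 0 (max 0 R) \<Longrightarrow> \<bar>\<phi> x\<bar> \<le> B0"
    using bdd[OF C1_continuous[OF assms(1)]] by blast
  have "\<forall>i. \<exists>B. \<forall>x\<in>cball 0 (max 0 R). \<bar>partial_derivative i \<phi> x\<bar> \<le> B"
    using bdd[OF C1_partial_continuous[OF assms(1)]] by blast
  then obtain B1 where B1: "\<And>i x. x \<in> cball 0 (max 0 R) \<Longrightarrow> \<bar>partial_derivative i \<phi> x\<bar> \<le> B1 i"
    by metis
  define B where "B = \<bar>B0\<bar> + (\<Sum>i\<in>UNIV. \<bar>B1 i\<bar>)"
  have s: "0 \<le> (\<Sum>i\<in>UNIV. \<bar>B1 i\<bar>)" by (intro sum_nonneg) simp
  have s1: "\<bar>B1 i\<bar> \<le> (\<Sum>i\<in>UNIV. \<bar>B1 i\<bar>)" for i by (intro member_le_sum) auto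
  show thesis
  proof
    show "0 \<le> max 0 R" "0 \<le> B" using s by (auto simp: B_def)
    show "\<phi> x = 0" if "max 0 R < norm x" for x using out[OF that] .
    show "\<bar>\<phi> x\<bar> \<le> B" for x
    proof (cases "norm x \<le> max 0 R")
      case True
      then have "\<bar>\<phi> x\<bar> \<le> B0" by (intro B0) simp
      then show ?thesis using s unfolding B_def by linarith
    next
      case False
      then have "\<phi> x = 0" by (intro out) (simp only: not_le)
      then show ?thesis using s by (simp add: B_def)
    qed
    show "\<bar>partial_derivative i \<phi> x\<bar> \<le> B" for x i
    proof (cases "norm x \<le> max 0 R")
      case True
      then show ?thesis using B1[of x i] s1[of i] by (simp add: B_def)
    next
      case False
      have zero: "0 = \<phi> y" if "y \<in> - cball 0 (max 0 R)" for y
        using that out[of y] by (simp only: Compl_iff mem_cball_0 not_le)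
      have "((\<lambda>x. 0) has_derivative (\<lambda>y. 0)) (at x)" by simp
      then have "(\<phi> has_derivative (\<lambda>y. 0)) (at x)"
      proof (rule has_derivative_transform_within_open[where s="- cball 0 (max 0 R)"])
        show "open (- cball (0 :: real^'n) (max 0 R))" by (rule open_Compl[OF closed_cball])
        show "x \<in> - cball 0 (max 0 R)" using False by simp
      qed (rule zero)
      then show ?thesis using partial_derivative_eq s by (fastforce simp: B_def)
    qed
  qed
qed

text \<open>
  Moving a difference quotient from the test function to \<open>F \<bar>x\<bar>\<close> is an exact identity, by translation
  invariance of Lebesgue measure. Both sides converge by dominated convergence: the test function is
  \<open>C\<^sup>1\<close> with compact support, and \<open>F \<bar>x\<bar>\<close> is Lipschitz on bounded sets and differentiable off countably
  many spheres.
\<close>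

lemma radial_has_weak_gradient:
  fixes F F' :: "real \<Rightarrow> real"
  assumes lip: "\<And>R. \<exists>L. L-lipschitz_on {0..R} F"
    and N: "countable N" and der: "\<And>r. 0 < r \<Longrightarrow> r \<notin> N \<Longrightarrow> (F has_real_derivative F' r) (at r)"
    and [measurable]: "F' \<in> borel_measurable borel"
    and bdd: "\<And>R. \<exists>B. \<forall>r\<in>{0..R}. \<bar>F' r\<bar> \<le> B"
  shows "has_weak_gradient (\<lambda>x::real^'n::finite. F (norm x)) (\<lambda>x. F' (norm x) *\<^sub>R sgn x)"
proof -
  let ?f = "\<lambda>x::real^'n. F (norm x)" and ?g = "\<lambda>x::real^'n. F' (norm x) *\<^sub>R sgn x"
  have lip': "\<exists>L\<ge>0. \<forall>x y. norm x \<le> R \<longrightarrow> norm y \<le> R \<longrightarrow> \<bar>?f x - ?f y\<bar> \<le> L * norm (x - y)" for R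
  proof -
    obtain L where L: "L-lipschitz_on {0..R} F" using lip by blast
    have "\<bar>?f x - ?f y\<bar> \<le> L * norm (x - y)" if "norm x \<le> R" "norm y \<le> R" for x y
    proof -
      have "\<bar>?f x - ?f y\<bar> \<le> L * \<bar>norm x - norm y\<bar>"
        using lipschitz_onD[OF L, of "norm x" "norm y"] that by (simp add: dist_real_def)
      also have "\<dots> \<le> L * norm (x - y)"
        using lipschitz_on_nonneg[OF L] norm_triangle_ineq3 by (intro mult_left_mono) auto
      finally show ?thesis .
    qed
    then show ?thesis using lipschitz_on_nonneg[OF L] by blast
  qed
  have fc: "continuous_on UNIV ?f"
  proof -
    have "isCont ?f x" for x
    proof -
      have "continuous_on {0..norm x + 1} F" using lip lipschitz_on_continuous_on by blast
      then have "continuous_on (cball 0 (norm x + 1)) ?f"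
        by (rule continuous_on_compose2) (auto intro!: continuous_intros)
      then show ?thesis by (rule continuous_on_interior) auto
    qed
    then show ?thesis by (simp add: continuous_at_imp_continuous_on)
  qed
  have fm[measurable]: "?f \<in> borel_measurable borel" by (rule borel_measurable_continuous_onI[OF fc])
  have gm[measurable]: "?g \<in> borel_measurable borel" unfolding sgn_div_norm by measurable
  have "locally_integrable ?f"
    unfolding locally_integrable_def set_integrable_def
    by (intro conjI allI impI fm borel_integrable_compact continuous_on_subset[OF fc]) simp_all
  moreover have "locally_integrable ?g"
    unfolding locally_integrable_def
  proof (intro conjI allI impI gm)
    fix K :: "(real^'n) set" assume K: "compact K"
    obtain R where R: "\<And>x. x \<in> K \<Longrightarrow> norm x \<le> R"
      using compact_imp_bounded[OF K] unfolding bounded_iff by blast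
    obtain B where B: "\<And>r. r \<in> {0..R} \<Longrightarrow> \<bar>F' r\<bar> \<le> B" using bdd by blast
    have [measurable]: "K \<in> sets borel" using K by (simp add: compact_imp_closed borel_closed)
    show "set_integrable lborel K ?g" unfolding set_integrable_def
    proof (rule Bochner_Integration.integrable_bound[where f="\<lambda>x. indicator K x *\<^sub>R B"])
      show "integrable lborel (\<lambda>x. indicator K x *\<^sub>R B)"
        using emeasure_compact_finite[OF K]
        by (intro integrable_scaleR_left) (simp add: integrable_indicator_iff)
      show "AE x in lborel. norm (indicator K x *\<^sub>R ?g x) \<le> norm (indicator K x *\<^sub>R B)"
      proof (rule AE_I2)
        fix x
        show "norm (indicator K x *\<^sub>R ?g x) \<le> norm (indicator K x *\<^sub>R B)"
          using B[of "norm x"] R[of x] by (cases "x \<in> K") (auto simp: norm_sgn)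
      qed
    qed simp
  qed
  moreover have "(LINT x|lborel. ?f x * partial_derivative i \<phi> x) = - (LINT x|lborel. ?g x $ i * \<phi> x)"
    if \<phi>: "C_k 1 \<phi>" "compact (closure {x. \<phi> x \<noteq> 0})" for \<phi> i
  proof -
    obtain R B where RB: "0 \<le> R" "0 \<le> B" "\<And>x. R < norm x \<Longrightarrow> \<phi> x = 0" "\<And>x. \<bar>\<phi> x\<bar> \<le> B"
      "\<And>x i. \<bar>partial_derivative i \<phi> x\<bar> \<le> B" using test_function_bounds[OF \<phi>] by blast
    have pc: "continuous_on UNIV \<phi>" by (rule C1_continuous[OF \<phi>(1)])
    have [measurable]: "\<phi> \<in> borel_measurable borel" by (rule borel_measurable_continuous_onI[OF pc])
    let ?e = "axis i 1 :: real^'n"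
    define h where "h k = 1 / real (Suc k)" for k
    have h: "0 < h k" "h k \<le> 1" for k by (auto simp: h_def)
    have h0: "h \<longlonglongrightarrow> 0" unfolding h_def by real_asymp
    have hat: "filterlim h (at 0) sequentially"
      using h0 h(1) by (auto simp: filterlim_at less_imp_neq[symmetric])
    define K where "K = cball (0 :: real^'n) (R + 1)"
    have fK: "integrable lborel (\<lambda>x. indicator K x *\<^sub>R ?f x)"
      unfolding K_def by (intro borel_integrable_compact continuous_on_subset[OF fc]) auto
    have K1: "integrable lborel (\<lambda>x. indicator K x *\<^sub>R (c::real))" for c
      using emeasure_compact_finite[OF compact_cball, of "0 :: real^'n" "R + 1"]
      unfolding K_def by (intro integrable_scaleR_left) (simp add: integrable_indicator_iff)
    let ?A = "\<lambda>k x. ?f x * ((\<phi> (x + h k *\<^sub>R ?e) - \<phi> x) / h k)"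
    let ?B = "\<lambda>k x. (?f (x + (- h k) *\<^sub>R ?e) - ?f x) / h k * \<phi> x"
    have A_lim: "(\<lambda>k. LINT x|lborel. ?A k x) \<longlonglongrightarrow> (LINT x|lborel. ?f x * partial_derivative i \<phi> x)"
    proof (rule integral_dominated_convergence[where w="\<lambda>x. \<bar>indicator K x *\<^sub>R ?f x\<bar> * B"])
      have "partial_derivative i \<phi> \<in> borel_measurable borel"
        by (rule borel_measurable_continuous_onI[OF C1_partial_continuous[OF \<phi>(1)]])
      then show "(\<lambda>x. ?f x * partial_derivative i \<phi> x) \<in> borel_measurable lborel" by simp
      show "integrable lborel (\<lambda>x. \<bar>indicator K x *\<^sub>R ?f x\<bar> * B)" using fK by simp
      show "AE x in lborel. (\<lambda>k. ?A k x) \<longlonglongrightarrow> ?f x * partial_derivative i \<phi> x"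
      proof (rule AE_I2)
        fix x
        have "((\<lambda>t. \<phi> (x + t *\<^sub>R ?e)) has_real_derivative partial_derivative i \<phi> x) (at 0)"
          unfolding partial_derivative_def
          by (rule directional_DERIV) (use C1_has_derivative[OF \<phi>(1)] in simp)
        then have "((\<lambda>t. (\<phi> (x + t *\<^sub>R ?e) - \<phi> x) / t) \<longlongrightarrow> partial_derivative i \<phi> x) (at 0)"
          by (simp add: has_field_derivative_iff)
        from filterlim_compose[OF this hat]
        show "(\<lambda>k. ?A k x) \<longlonglongrightarrow> ?f x * partial_derivative i \<phi> x" by (rule tendsto_mult_left)
      qed
      show "AE x in lborel. norm (?A k x) \<le> \<bar>indicator K x *\<^sub>R ?f x\<bar> * B" for k
      proof (rule AE_I2)
        fix x
        have q: "\<bar>(\<phi> (x + h k *\<^sub>R ?e) - \<phi> x) / h k\<bar> \<le> B"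
        proof -
          have "\<bar>\<phi> (x + h k *\<^sub>R ?e) - \<phi> (x + 0 *\<^sub>R ?e)\<bar> \<le> B * \<bar>h k - 0\<bar>"
          proof (rule field_differentiable_bound[where S=UNIV and f'="\<lambda>t. partial_derivative i \<phi> (x + t *\<^sub>R ?e)"
                and f="\<lambda>t. \<phi> (x + t *\<^sub>R ?e)", unfolded real_norm_def])
            show "((\<lambda>t. \<phi> (x + t *\<^sub>R ?e)) has_real_derivative partial_derivative i \<phi> (x + t *\<^sub>R ?e)) (at t within UNIV)" for t
              unfolding partial_derivative_def by (rule directional_DERIV[OF C1_has_derivative[OF \<phi>(1)]])
          qed (use RB in auto)
          then show ?thesis using h[of k] by (simp add: abs_divide field_simps)
        qed
        show "norm (?A k x) \<le> \<bar>indicator K x *\<^sub>R ?f x\<bar> * B"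
        proof (cases "x \<in> K")
          case True
          have "\<bar>?f x\<bar> * \<bar>(\<phi> (x + h k *\<^sub>R ?e) - \<phi> x) / h k\<bar> \<le> \<bar>?f x\<bar> * B"
            by (rule mult_left_mono[OF q]) simp
          then show ?thesis using True unfolding real_norm_def abs_mult by simp
        next
          case False
          then have x: "R + 1 < norm x" by (simp add: K_def)
          have "norm x \<le> norm (x + h k *\<^sub>R ?e) + norm (h k *\<^sub>R ?e)"
            by (metis add_diff_cancel_right' norm_triangle_ineq4)
          moreover have "norm (h k *\<^sub>R ?e) \<le> 1" using h[of k] by simp
          ultimately have "\<phi> (x + h k *\<^sub>R ?e) = 0" "\<phi> x = 0" using RB(3) x by auto
          then show ?thesis using RB(2) by simp
        qed
      qed
    qed measurable
    have B_lim: "(\<lambda>k. LINT x|lborel. ?B k x) \<longlonglongrightarrow> (LINT x|lborel. - (?g x $ i * \<phi> x))"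
    proof -
      obtain L where L: "0 \<le> L" "\<And>x y. norm x \<le> R + 1 \<Longrightarrow> norm y \<le> R + 1 \<Longrightarrow> \<bar>?f x - ?f y\<bar> \<le> L * norm (x - y)"
        using lip'[of "R + 1"] by blast
      show ?thesis
      proof (rule integral_dominated_convergence[where w="\<lambda>x. indicator K x *\<^sub>R (L * B)"])
        show "(\<lambda>x. - (?g x $ i * \<phi> x)) \<in> borel_measurable lborel"
          using borel_measurable_component[of ?g lborel i] gm by simp
        show "integrable lborel (\<lambda>x. indicator K x *\<^sub>R (L * B))" by (rule K1)
        show "AE x in lborel. (\<lambda>k. ?B k x) \<longlonglongrightarrow> - (?g x $ i * \<phi> x)"
          using AE_norm_notin_countable[OF countable_insert[OF N, of 0]]
        proof eventually_elim
          case (elim x)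
          then have x: "x \<noteq> 0" "norm x \<notin> N" by auto
          have "(?f has_derivative (\<lambda>y. F' (norm x) * (sgn x \<bullet> y))) (at x)"
            by (rule radial_DERIV) (use x der in auto)
          then have "((\<lambda>t. ?f (x + t *\<^sub>R ?e)) has_real_derivative F' (norm x) * (sgn x \<bullet> ?e)) (at 0)"
            by (intro directional_DERIV) simp
          then have "((\<lambda>t. (?f (x + t *\<^sub>R ?e) - ?f x) / t) \<longlongrightarrow> ?g x $ i) (at 0)"
            by (simp add: has_field_derivative_iff cart_eq_inner_axis[symmetric])
          moreover have "filterlim (\<lambda>k. - h k) (at 0) sequentially"
            using tendsto_minus[OF h0] h(1) by (auto simp: filterlim_at less_imp_neq[symmetric])
          ultimately have "(\<lambda>k. (?f (x + (- h k) *\<^sub>R ?e) - ?f x) / (- h k)) \<longlonglongrightarrow> ?g x $ i"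
            by (rule filterlim_compose)
          then have "(\<lambda>k. - ((?f (x + (- h k) *\<^sub>R ?e) - ?f x) / (- h k)) * \<phi> x) \<longlonglongrightarrow> - (?g x $ i) * \<phi> x"
            by (intro tendsto_intros)
          then show ?case by simp
        qed
        show "AE x in lborel. norm (?B k x) \<le> indicator K x *\<^sub>R (L * B)" for k
        proof (rule AE_I2)
          fix x
          show "norm (?B k x) \<le> indicator K x *\<^sub>R (L * B)"
          proof (cases "norm x \<le> R")
            case True
            have "norm (x + (- h k) *\<^sub>R ?e) \<le> R + 1"
              using norm_triangle_ineq4[of x "h k *\<^sub>R ?e"] True h[of k] by simp
            then have "\<bar>?f (x + (- h k) *\<^sub>R ?e) - ?f x\<bar> \<le> L * norm (x + (- h k) *\<^sub>R ?e - x)"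
              using True by (intro L(2)) auto
            then have "\<bar>(?f (x + (- h k) *\<^sub>R ?e) - ?f x) / h k\<bar> \<le> L"
              using h[of k] by (simp add: abs_divide field_simps)
            then have "\<bar>(?f (x + (- h k) *\<^sub>R ?e) - ?f x) / h k\<bar> * \<bar>\<phi> x\<bar> \<le> L * B"
              using RB(4)[of x] L(1) by (intro mult_mono) auto
            then show ?thesis using True by (simp add: K_def abs_mult)
          next
            case False
            then show ?thesis using RB(2,3) L(1) by (simp add: K_def)
          qed
        qed
      qed measurable
    qed
    have "(LINT x|lborel. ?A k x) = (LINT x|lborel. ?B k x)" for k
    proof -
      have int1: "integrable lborel (\<lambda>x. ?f (c + x) * \<phi> x)" for c
      proof -
        have "integrable lborel (\<lambda>x. indicator K x *\<^sub>R (?f (c + x) * \<phi> x))"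
          unfolding K_def
          by (intro borel_integrable_compact continuous_on_mult continuous_on_subset[OF pc]
              continuous_on_compose2[OF fc]) (auto intro!: continuous_intros)
        moreover have "(\<lambda>x. indicator K x *\<^sub>R (?f (c + x) * \<phi> x)) = (\<lambda>x. ?f (c + x) * \<phi> x)"
          using RB(3) by (auto simp: K_def fun_eq_iff indicator_def)
        ultimately show ?thesis by simp
      qed
      let ?c = "h k *\<^sub>R ?e"
      define G where "G = (\<lambda>y. ?f (- ?c + y) * \<phi> y)"
      have [measurable]: "G \<in> borel_measurable borel" unfolding G_def by measurable
      have G: "G (?c + x) = ?f x * \<phi> (x + ?c)" for x by (simp add: G_def add.commute)
      have 1: "(LINT x|lborel. ?f x * \<phi> (x + ?c)) = (LINT x|lborel. G x)"
        using lborel_integral_translate(1)[of G ?c] by (simp add: G)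
      have 2: "integrable lborel (\<lambda>x. ?f x * \<phi> (x + ?c))"
        using lborel_integral_translate(2)[of G ?c] int1[of "- ?c"] by (simp add: G) (simp add: G_def)
      have 3: "integrable lborel G" unfolding G_def by (rule int1)
      have 4: "integrable lborel (\<lambda>x. ?f x * \<phi> x)" using int1[of 0] by simp
      have "(LINT x|lborel. ?A k x) = (LINT x|lborel. (?f x * \<phi> (x + ?c) - ?f x * \<phi> x) / h k)"
        by (rule Bochner_Integration.integral_cong) (simp_all add: right_diff_distrib)
      also have "\<dots> = ((LINT x|lborel. G x) - (LINT x|lborel. ?f x * \<phi> x)) / h k"
        using 1 2 4 by simp
      also have "\<dots> = (LINT x|lborel. (G x - ?f x * \<phi> x) / h k)" using 3 4 by simp
      also have "\<dots> = (LINT x|lborel. ?B k x)"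
        by (rule Bochner_Integration.integral_cong) (simp_all add: G_def left_diff_distrib)
      finally show ?thesis .
    qed
    then have eq: "(\<lambda>k. LINT x|lborel. ?A k x) = (\<lambda>k. LINT x|lborel. ?B k x)" by (rule ext)
    have "(LINT x|lborel. ?f x * partial_derivative i \<phi> x) = (LINT x|lborel. - (?g x $ i * \<phi> x))"
      by (rule LIMSEQ_unique[OF A_lim[unfolded eq] B_lim])
    then show ?thesis by (simp only: integral_minus)
  qed
  ultimately show ?thesis
    unfolding has_weak_gradient_def by (intro conjI allI impI) (assumption | elim conjE)+
qed

text \<open>
  Integration in polar coordinates for radial functions. Both measures give the half-line \<open>{..r}\<close> the
  volume of the ball of radius \<open>r\<close>.
\<close>

lemma distr_norm_lborel:
  fixes \<kappa> :: real
  defines "\<kappa> \<equiv> CARD('n) * unit_ball_vol (CARD('n))"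
  shows "distr lborel borel (norm :: real^'n::finite \<Rightarrow> real)
     = density lborel (\<lambda>r. ennreal (indicator {0<..} r * (\<kappa> * r ^ (CARD('n) - 1))))"
proof (rule measure_eqI_generator_eq[where E="range atMost" and \<Omega>=UNIV and A="\<lambda>i. {..real i}"])
  let ?n = "CARD('n)"
  have n: "?n > 0" by simp
  have cball: "emeasure (distr lborel borel (norm :: real^'n \<Rightarrow> real)) {..r}
      = (if 0 \<le> r then ennreal (unit_ball_vol ?n * r ^ ?n) else 0)" for r
  proof -
    have "emeasure (distr lborel borel (norm :: real^'n \<Rightarrow> real)) {..r} = emeasure lborel (norm -` {..r} :: (real^'n) set)"
      by (subst emeasure_distr) auto
    also have "(norm -` {..r} :: (real^'n) set) = cball 0 r" by auto
    finally show ?thesis using emeasure_cball[of r "0 :: real^'n"] by auto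
  qed
  have dens: "emeasure (density lborel (\<lambda>r. ennreal (indicator {0<..} r * (\<kappa> * r ^ (?n - 1))))) {..r}
      = (if 0 \<le> r then ennreal (unit_ball_vol ?n * r ^ ?n) else 0)" for r
  proof -
    have "emeasure (density lborel (\<lambda>r. ennreal (indicator {0<..} r * (\<kappa> * r ^ (?n - 1))))) {..r}
      = (\<integral>\<^sup>+s. ennreal (indicator {0<..} s * (\<kappa> * s ^ (?n - 1))) * indicator {..r} s \<partial>lborel)"
      by (subst emeasure_density) auto
    also have "\<dots> = (\<integral>\<^sup>+s. ennreal (\<kappa> * s ^ (?n - 1)) * indicator {0..r} s \<partial>lborel)"
      using AE_lborel_singleton[of 0] by (intro nn_integral_cong_AE) (auto elim!: eventually_mono simp: indicator_def)
    also have "\<dots> = (if 0 \<le> r then ennreal (unit_ball_vol ?n * r ^ ?n) else 0)"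
    proof (cases "0 \<le> r")
      case True
      have "(\<integral>\<^sup>+s. ennreal (\<kappa> * s ^ (?n - 1)) * indicator {0..r} s \<partial>lborel)
         = ennreal (unit_ball_vol ?n * r ^ ?n - unit_ball_vol ?n * 0 ^ ?n)"
        by (rule nn_integral_FTC_Icc[OF _ _ _ True])
          (auto intro!: derivative_eq_intros simp: \<kappa>_def)
      then show ?thesis using True n by (simp add: power_0_left)
    qed simp
    finally show ?thesis .
  qed
  show "emeasure (distr lborel borel (norm :: real^'n \<Rightarrow> real)) X
     = emeasure (density lborel (\<lambda>r. ennreal (indicator {0<..} r * (\<kappa> * r ^ (?n - 1))))) X"
    if "X \<in> range atMost" for X
    using that cball dens by auto
  show "emeasure (distr lborel borel (norm :: real^'n \<Rightarrow> real)) {..real i} \<noteq> \<infinity>" for i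
    using cball by simp
  show "Int_stable (range atMost :: real set set)" by (auto simp: Int_stable_def)
  show "(\<Union>i. {..real i}) = UNIV" using real_arch_simple by auto
qed (auto simp: borel_eq_atMost)

lemma distr_norm_radial_density:
  fixes v :: "real \<Rightarrow> real"
  defines "\<kappa> \<equiv> CARD('n) * unit_ball_vol (CARD('n))"
  assumes [measurable]: "v \<in> borel_measurable borel"
  shows "distr (density lborel (\<lambda>x::real^'n::finite. ennreal (exp (- v (norm x))))) borel norm
    = density lborel (\<lambda>r. ennreal (indicator {0<..} r * (\<kappa> * r ^ (CARD('n) - 1) * exp (- v r))))"
proof -
  have k: "0 \<le> \<kappa>" by (simp add: \<kappa>_def)
  have "distr (density lborel (\<lambda>x::real^'n. ennreal (exp (- v (norm x))))) borel norm
     = density (distr lborel borel (norm :: real^'n \<Rightarrow> real)) (\<lambda>r. ennreal (exp (- v r)))"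
    by (subst density_distr) auto
  also have "\<dots> = density lborel (\<lambda>r. ennreal (indicator {0<..} r * (\<kappa> * r ^ (CARD('n) - 1))) * ennreal (exp (- v r)))"
    unfolding distr_norm_lborel \<kappa>_def by (subst density_density_eq) auto
  also have "(\<lambda>r. ennreal (indicator {0<..} r * (\<kappa> * r ^ (CARD('n) - 1))) * ennreal (exp (- v r)))
     = (\<lambda>r. ennreal (indicator {0<..} r * (\<kappa> * r ^ (CARD('n) - 1) * exp (- v r))))"
  proof
    fix r :: real
    show "ennreal (indicator {0<..} r * (\<kappa> * r ^ (CARD('n) - 1))) * ennreal (exp (- v r))
      = ennreal (indicator {0<..} r * (\<kappa> * r ^ (CARD('n) - 1) * exp (- v r)))"
      using k by (cases "0 < r") (simp_all flip: ennreal_mult)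
  qed
  finally show ?thesis .
qed

lemma radial_eq_axis:
  fixes h :: "real^'n::finite \<Rightarrow> real"
  assumes "radial h" shows "h x = h (norm x *\<^sub>R axis i 1)"
proof -
  have "norm x = norm (norm x *\<^sub>R axis i (1::real) :: real^'n)" by simp
  then obtain \<tau> where t: "orthogonal_transformation \<tau>" "\<tau> x = norm x *\<^sub>R axis i (1 :: real)"
    by (rule orthogonal_transformation_exists)
  have "h (\<tau> x) = h x" using assms t(1) unfolding radial_def by simp
  then show ?thesis by (simp only: t(2))
qed

lemma radial_profile_even:
  fixes h :: "real^'n::finite \<Rightarrow> real"
  assumes "radial h" shows "h ((- r) *\<^sub>R axis i 1) = h (r *\<^sub>R axis i 1)"
proof -
  have "norm ((- r) *\<^sub>R (axis i 1 :: real^'n)) = norm (r *\<^sub>R (axis i 1 :: real^'n))" by simp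
  then show ?thesis
    unfolding radial_eq_axis[OF assms, of "(- r) *\<^sub>R axis i 1" i]
      radial_eq_axis[OF assms, of "r *\<^sub>R axis i 1" i] by (simp only:)
qed

text \<open>
  Along the axis \<open>i\<close> the second derivative of \<open>V\<close> is a diagonal entry of the Hessian, so it is at least
  \<open>c\<close>, and \<open>v r - c / 2 * r\<^sup>2\<close> is convex; its tangent inequality is the claim.
\<close>

lemma hessian_bound_radial_profile:
  fixes V :: "real^'n::finite \<Rightarrow> real" and i :: 'n
  assumes V: "C_k 2 V" and hess: "\<And>x. pos_semidef (hessian V x - c *\<^sub>R mat 1)"
  defines "v \<equiv> \<lambda>r. V (r *\<^sub>R axis i 1)" and "dv \<equiv> \<lambda>r. partial_derivative i V (r *\<^sub>R axis i 1)"
  shows "(v has_real_derivative dv r) (at r)" "continuous_on UNIV dv"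
    "v r + dv r * (s - r) + c / 2 * (s - r)\<^sup>2 \<le> v s"
proof -
  have V2: "V differentiable_on UNIV" "C_k 1 (partial_derivative i V)"
    using V unfolding numeral_2_eq_2 One_nat_def C_k.simps(2)[of "Suc 0"] by blast+
  define ddv where "ddv = (\<lambda>r. partial_derivative i (partial_derivative i V) (r *\<^sub>R axis i 1))"
  have dv: "(v has_real_derivative dv r) (at r)" for r
    using directional_DERIV[of V "frechet_derivative V (at (r *\<^sub>R axis i 1))" 0 r "axis i 1"]
      V2(1) unfolding v_def dv_def partial_derivative_def
    by (simp add: differentiable_on_def frechet_derivative_works[symmetric])
  have ddv: "(dv has_real_derivative ddv r) (at r)" for r
    using directional_DERIV[of "partial_derivative i V" _ 0 r "axis i 1"] C1_has_derivative[OF V2(2)]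
    unfolding dv_def ddv_def partial_derivative_def[of i "partial_derivative i V"] by simp
  have ge: "c \<le> ddv r" for r
  proof -
    have "0 \<le> axis i 1 \<bullet> ((hessian V (r *\<^sub>R axis i 1) - c *\<^sub>R mat 1) *v axis i 1)"
      using hess by (simp add: pos_semidef_def)
    also have "\<dots> = ddv r - c"
      unfolding matrix_vector_mult_basis
      by (simp add: inner_axis' column_def hessian_def ddv_def mat_def)
    finally show ?thesis by simp
  qed
  show "(v has_real_derivative dv r) (at r)" by (rule dv)
  show "continuous_on UNIV dv" using ddv by (meson DERIV_isCont continuous_at_imp_continuous_on)
  \<comment> \<open>completing the square turns the tangent inequality for \<open>u\<close> into the one for \<open>v\<close>\<close>
  define u where "u = (\<lambda>x. v x - c / 2 * x\<^sup>2)"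
  have du: "(u has_real_derivative dv x - c * x) (at x)" for x
    unfolding u_def by (auto intro!: derivative_eq_intros dv)
  have "convex_on UNIV u"
    by (rule f''_ge0_imp_convex[where f'="\<lambda>x. dv x - c * x" and f''="\<lambda>x. ddv x - c"])
      (use du ge in \<open>auto intro!: derivative_eq_intros ddv\<close>)
  from convex_on_imp_above_tangent[OF this _ _ _ du[of r], of s]
  have "(dv r - c * r) * (s - r) \<le> u s - u r" by simp
  then show "v r + dv r * (s - r) + c / 2 * (s - r)\<^sup>2 \<le> v s"
    by (simp add: u_def power2_eq_square field_simps)
qed

lemma exp_convex_weak_gradient:
  fixes u d :: "real \<Rightarrow> real"
  assumes sub: "\<And>x y. u x + d x * (y - x) \<le> u y"
  defines "f \<equiv> \<lambda>x::real^'n::finite. exp (- u (norm x))"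
  shows "has_weak_gradient f (\<lambda>x. (exp (- u (norm x)) * - d (norm x)) *\<^sub>R sgn x)"
    "AE x in lborel. (norm (weak_grad f x))\<^sup>2 = (d (norm x))\<^sup>2 * (exp (- u (norm x)))\<^sup>2"
proof -
  have dm: "mono d" by (rule subgradient_mono[OF sub])
  have uc: "continuous_on UNIV u"
    using subgradient_continuous[OF sub] by (simp add: continuous_at_imp_continuous_on)
  have [measurable]: "d \<in> borel_measurable borel" by (rule borel_measurable_mono[OF dm])
  have [measurable]: "u \<in> borel_measurable borel" by (rule borel_measurable_continuous_onI[OF uc])
  show w: "has_weak_gradient f (\<lambda>x. (exp (- u (norm x)) * - d (norm x)) *\<^sub>R sgn x)"
    unfolding f_def
  proof (rule radial_has_weak_gradient[where N="{r. \<not> isCont d r}" and F="\<lambda>r. exp (- u r)"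
        and F'="\<lambda>r. exp (- u r) * - d r"])
    show "\<exists>L. L-lipschitz_on {0..R} (\<lambda>r. exp (- u r))" for R
      by (rule lipschitz_exp_minus[OF subgradient_lipschitz[OF sub]])
    show "countable {r. \<not> isCont d r}" by (rule mono_ctble_discont[OF dm])
    show "((\<lambda>r. exp (- u r)) has_real_derivative exp (- u r) * - d r) (at r)"
      if "r \<notin> {r. \<not> isCont d r}" for r
    proof -
      have "(u has_real_derivative d r) (at r)" by (rule subgradient_DERIV[OF sub]) (use that in simp)
      then show ?thesis by (auto intro!: derivative_eq_intros)
    qed
    show "\<exists>B. \<forall>r\<in>{0..R}. \<bar>exp (- u r) * - d r\<bar> \<le> B" for R
    proof -
      have "bounded ((\<lambda>r. exp (- u r)) ` {0..R})"
        by (intro compact_imp_bounded compact_continuous_image continuous_intros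
            continuous_on_subset[OF uc]) auto
      then obtain B where B: "\<And>r. r \<in> {0..R} \<Longrightarrow> norm (exp (- u r)) \<le> B"
        unfolding bounded_iff by (metis image_eqI)
      have "\<bar>exp (- u r) * - d r\<bar> \<le> B * max \<bar>d 0\<bar> \<bar>d R\<bar>" if r: "r \<in> {0..R}" for r
      proof -
        have "\<bar>d r\<bar> \<le> max \<bar>d 0\<bar> \<bar>d R\<bar>"
          using monoD[OF dm, of 0 r] monoD[OF dm, of r R] r by auto
        then have "exp (- u r) * \<bar>d r\<bar> \<le> B * max \<bar>d 0\<bar> \<bar>d R\<bar>"
          using B[OF r] order_trans[OF exp_ge_zero B[OF r, unfolded real_norm_def abs_exp_cancel]]
          by (intro mult_mono) auto
        then show ?thesis by (simp add: abs_mult)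
      qed
      then show ?thesis by blast
    qed
  qed measurable
  show "AE x in lborel. (norm (weak_grad f x))\<^sup>2 = (d (norm x))\<^sup>2 * (exp (- u (norm x)))\<^sup>2"
    using weak_grad_eq[OF w] AE_lborel_singleton[of "0 :: real^'n"]
    by eventually_elim (simp add: norm_sgn power_mult_distrib)
qed

section \<open>The deficit of a radial log-concave function\<close>

lemma half_gaussian_moments:
  "integrable lborel (\<lambda>r::real. indicator {0<..} r * (r ^ k * exp (- r\<^sup>2)))"
proof -
  have "integrable lborel (\<lambda>r::real. indicator {0..} r *\<^sub>R (exp (- r\<^sup>2) * r ^ k))"
  proof (cases "even k")
    case True
    then obtain j where "k = 2 * j" by (elim evenE)
    then show ?thesis using gaussian_moment_even_pos[of j] by (simp add: has_bochner_integral_iff)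
  next
    case False
    then obtain j where "k = 2 * j + 1" by (elim oddE)
    then show ?thesis using gaussian_moment_odd_pos[of j] by (simp add: has_bochner_integral_iff)
  qed
  from integrable_mult_indicator[OF _ this, of "{0<..}"]
  show ?thesis
    by (rule Bochner_Integration.integrable_cong[THEN iffD1, rotated 2]) (auto simp: indicator_def)
qed

lemma half_gaussian_moments_scaled:
  assumes "0 < a"
  shows "integrable lborel (\<lambda>r::real. indicator {0<..} r * (r ^ k * exp (- (a * r\<^sup>2))))"
proof -
  have s: "sqrt a \<noteq> 0" "0 < sqrt a" using assms by auto
  have "integrable lborel (\<lambda>r. indicator {0<..} (0 + sqrt a * r) * ((0 + sqrt a * r) ^ k * exp (- (0 + sqrt a * r)\<^sup>2)))"
    by (rule lborel_integrable_real_affine[OF half_gaussian_moments s(1)])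
  then have "integrable lborel (\<lambda>r. (1 / sqrt a ^ k) * (indicator {0<..} (0 + sqrt a * r) * ((0 + sqrt a * r) ^ k * exp (- (0 + sqrt a * r)\<^sup>2))))"
    by (rule integrable_mult_right)
  then show ?thesis
    by (rule Bochner_Integration.integrable_cong[THEN iffD1, rotated 2])
      (use s assms in \<open>auto simp: indicator_def power_mult_distrib zero_less_mult_iff\<close>)
qed

text \<open>
  In terms of the profiles the energy and the entropy are multiples of the integrals of
  \<open>q\<^sup>2 exp (- w)\<close> and \<open>w exp (- w)\<close>, and the deficit is exactly the quantity bounded in \<open>radial_transport.deficit_bound\<close>, and the
  \<open>L\<^sup>1\<close> distance is twice \<open>radial_transport.D\<close>.
\<close>

theorem LSI_deficit_ge_L1_distance_square:
  fixes V f :: "real^'n::finite \<Rightarrow> real"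
  assumes adm: "admissible V c f"
  shows "(L1_distance V f)\<^sup>2 / (1152 * (real CARD('n))\<^sup>2) \<le> LSI_deficit V c f"
proof -
  define i :: 'n where "i = undefined"
  define n where "n = CARD('n)"
  define \<kappa> where "\<kappa> = real n * unit_ball_vol (real n)"
  have c: "0 < c" and V: "C_k 2 V" "radial V" "\<And>x. pos_semidef (hessian V x - c *\<^sub>R mat 1)"
    and prob: "prob_space (\<mu> V)" and f: "f \<in> W12 (\<mu> V)" "\<And>x. 0 < f x" "log_concave f" "radial f"
    using adm unfolding admissible_def by blast+
  have n1: "1 \<le> n" by (simp add: n_def Suc_leI)
  have kappa: "0 < \<kappa>" using n1 by (simp add: \<kappa>_def)
  interpret M: prob_space "\<mu> V" by (rule prob)
  have sets_M[measurable_cong, simp]: "sets (\<mu> V) = sets borel" by (simp add: \<mu>_def)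
  define v where "v = (\<lambda>r. V (r *\<^sub>R axis i 1))"
  define dv where "dv = (\<lambda>r. partial_derivative i V (r *\<^sub>R axis i 1))"
  have vp: "(v has_real_derivative dv r) (at r)" "continuous_on UNIV dv"
    "v r + dv r * (s - r) + c / 2 * (s - r)\<^sup>2 \<le> v s" for r s
    unfolding v_def dv_def by (rule hessian_bound_radial_profile[OF V(1,3)])+
  have V_eq: "V x = v (norm x)" for x unfolding v_def by (rule radial_eq_axis[OF V(2)])
  have v_even: "v (- r) = v r" for r unfolding v_def by (rule radial_profile_even[OF V(2)])
  have v_sub: "v x + dv x * (y - x) \<le> v y" for x y
  proof -
    have "0 \<le> c / 2 * (y - x)\<^sup>2" using c by simp
    then show ?thesis using vp(3)[of x y] by linarith
  qed
  have v_cont: "continuous_on UNIV v"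
    using vp(1) by (meson DERIV_isCont continuous_at_imp_continuous_on)
  have vm[measurable]: "v \<in> borel_measurable borel" by (rule borel_measurable_continuous_onI[OF v_cont])

  define u where "u = (\<lambda>r. - ln (f (r *\<^sub>R axis i 1)))"
  have f_eq: "f = (\<lambda>x. exp (- u (norm x)))"
    using f(2) radial_eq_axis[OF f(4)] by (simp add: fun_eq_iff u_def)
  have u_even: "u (- r) = u r" for r unfolding u_def by (simp only: radial_profile_even[OF f(4)])
  have "convex_on UNIV u"
  proof (rule convex_onI)
    fix t x y :: real assume t: "0 < t" "t < 1"
    have cc: "convex_on UNIV (\<lambda>x. - ln (f x))" using f(3) by (simp add: log_concave_def concave_on_def)
    have "((1 - t) *\<^sub>R x + t *\<^sub>R y) *\<^sub>R axis i 1
       = (1 - t) *\<^sub>R (x *\<^sub>R axis i 1) + t *\<^sub>R (y *\<^sub>R (axis i 1 :: real^'n))"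
      by (simp add: scaleR_add_left)
    then show "u ((1 - t) *\<^sub>R x + t *\<^sub>R y) \<le> (1 - t) * u x + t * u y"
      unfolding u_def using convex_onD[OF cc, of t "x *\<^sub>R axis i 1" "y *\<^sub>R axis i 1"] t by simp
  qed simp
  then obtain d where d: "\<And>x y. u x + d x * (y - x) \<le> u y" using convex_subgradient by blast

  define \<alpha> where "\<alpha> = (LINT x|\<mu> V. (f x)\<^sup>2)"
  have fL2: "f \<in> borel_measurable (\<mu> V)" "integrable (\<mu> V) (\<lambda>x. (f x)\<^sup>2)"
    "integrable (\<mu> V) (\<lambda>x. (norm (weak_grad f x))\<^sup>2)"
    using f(1) unfolding W12_def L2_def by simp_all
  have [measurable]: "f \<in> borel_measurable borel"
    using fL2(1) unfolding measurable_cong_sets[OF sets_M refl] .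
  have alpha: "0 < \<alpha>"
    unfolding \<alpha>_def
    by (intro integral_strict_pos fL2(2) zero_less_power f(2)) (simp add: M.emeasure_space_1)

  define w where "w = (\<lambda>r. 2 * u r + ln \<alpha>)"
  define q where "q = (\<lambda>r. 2 * d r)"
  have f2: "(f x)\<^sup>2 = \<alpha> * exp (- w (norm x))" for x
    using alpha by (simp add: f_eq w_def exp_diff exp_minus power2_eq_square field_simps flip: exp_add)
  have w_sub: "w x + q x * (y - x) \<le> w y" for x y
    using d[of x y] by (simp add: w_def q_def)
  have q_mono: "mono q" by (rule subgradient_mono[OF w_sub])
  have [measurable]: "q \<in> borel_measurable borel" by (rule borel_measurable_mono[OF q_mono])
  have w_cont: "continuous_on UNIV w"
    using subgradient_continuous[OF w_sub] by (simp add: continuous_at_imp_continuous_on)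
  have wm[measurable]: "w \<in> borel_measurable borel" by (rule borel_measurable_continuous_onI[OF w_cont])

  define g where "g = (\<lambda>r. \<kappa> * r ^ (n - 1) * exp (- v r))"
  define p where "p = (\<lambda>r. g r * exp (- w r))"
  define \<mu>g where "\<mu>g = density lborel (\<lambda>r. ennreal (indicator {0<..} r * g r))"
  have law_g: "distr (\<mu> V) borel norm = \<mu>g"
    using distr_norm_radial_density[OF vm, where 'n='n]
    unfolding \<mu>_def V_eq[abs_def] \<mu>g_def g_def \<kappa>_def n_def .
  have prob_g: "prob_space \<mu>g"
    unfolding law_g[symmetric] by (rule M.prob_space_distr) measurable
  have prob_p: "prob_space (density lborel (\<lambda>r. ennreal (indicator {0<..} r * p r)))"
  proof -
    let ?\<nu> = "density lborel (\<lambda>x::real^'n. ennreal (exp (- (v (norm x) + w (norm x)))))"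
    have "prob_space ?\<nu>"
    proof (rule prob_spaceI)
      have "emeasure ?\<nu> (space ?\<nu>) = (\<integral>\<^sup>+x. ennreal (exp (- (v (norm x) + w (norm x)))) \<partial>(lborel :: (real^'n) measure))"
        by (simp add: emeasure_density)
      also have "\<dots> = (\<integral>\<^sup>+x. ennreal (exp (- V x)) * ennreal ((f x)\<^sup>2 / \<alpha>) \<partial>lborel)"
        using alpha by (intro nn_integral_cong) (simp add: V_eq f2 exp_add[symmetric] flip: ennreal_mult)
      also have "\<dots> = (\<integral>\<^sup>+x. ennreal ((f x)\<^sup>2 / \<alpha>) \<partial>\<mu> V)"
        unfolding \<mu>_def by (subst nn_integral_density) (auto simp: V_eq)
      also have "\<dots> = ennreal (LINT x|\<mu> V. (f x)\<^sup>2 / \<alpha>)"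
        using fL2(2) alpha by (intro nn_integral_eq_integral) auto
      also have "\<dots> = 1" using alpha by (simp add: \<alpha>_def)
      finally show "emeasure ?\<nu> (space ?\<nu>) = 1" .
    qed
    then interpret \<nu>: prob_space ?\<nu> .
    have "prob_space (distr ?\<nu> borel norm)" by (rule \<nu>.prob_space_distr) measurable
    moreover have "distr ?\<nu> borel norm = density lborel (\<lambda>r. ennreal (indicator {0<..} r * p r))"
    proof -
      have "(\<lambda>r. v r + w r) \<in> borel_measurable borel" by measurable
      from distr_norm_radial_density[OF this, where 'n='n] show ?thesis
        by (simp add: p_def g_def \<kappa>_def n_def exp_diff exp_minus exp_add field_simps)
    qed
    ultimately show ?thesis by simp
  qed
  have moment: "integrable lborel (\<lambda>r. indicator {0<..} r * (r * g r))"
  proof (rule Bochner_Integration.integrable_bound)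
    show "integrable lborel (\<lambda>r. \<kappa> * exp (- v 0) * (indicator {0<..} r * (r ^ n * exp (- (c / 2 * r\<^sup>2)))))"
      by (intro integrable_mult_right half_gaussian_moments_scaled) (use c in auto)
    show "(\<lambda>r. indicator {0<..} r * (r * g r)) \<in> borel_measurable lborel" unfolding g_def by measurable
    show "AE r in lborel. norm (indicator {0<..} r * (r * g r))
        \<le> norm (\<kappa> * exp (- v 0) * (indicator {0<..} r * (r ^ n * exp (- (c / 2 * r\<^sup>2)))))"
    proof (rule AE_I2)
      fix r :: real
      show "norm (indicator {0<..} r * (r * g r))
        \<le> norm (\<kappa> * exp (- v 0) * (indicator {0<..} r * (r ^ n * exp (- (c / 2 * r\<^sup>2)))))"
      proof (cases "0 < r")
        case True
        \<comment> \<open>The linear terms in the convexity inequalities at \<open>r\<close> and \<open>- r\<close> cancel, as \<open>v\<close> is even.\<close>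
        have "v 0 + c / 2 * r\<^sup>2 \<le> v r"
          using vp(3)[of 0 r] vp(3)[of 0 "- r"] v_even[of r] by simp
        then have "exp (- v r) \<le> exp (- v 0) * exp (- (c / 2 * r\<^sup>2))" by (simp flip: exp_add)
        then have "\<kappa> * r ^ n * exp (- v r) \<le> \<kappa> * r ^ n * (exp (- v 0) * exp (- (c / 2 * r\<^sup>2)))"
          using kappa True by (intro mult_left_mono) auto
        moreover have "r * g r = \<kappa> * r ^ n * exp (- v r)"
          using n1 by (cases n) (auto simp: g_def)
        ultimately show ?thesis using True kappa by (simp add: abs_mult mult_ac)
      qed simp
    qed
  qed

  interpret R: radial_transport n \<kappa> c v dv w q g p "{r. \<not> isCont q r}"
  proof (rule radial_transport.intro)
    show "countable {r. \<not> isCont q r}" by (rule mono_ctble_discont[OF q_mono])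
    show "(w has_real_derivative q r) (at r)" if "r \<notin> {r. \<not> isCont q r}" for r
      by (rule subgradient_DERIV[OF w_sub]) (use that in simp)
    show "v r \<le> v s" if "0 \<le> r" "r \<le> s" for r s by (rule even_convex_mono[OF v_sub v_even that])
    show "w r \<le> w s" if "0 \<le> r" "r \<le> s" for r s
      by (rule even_convex_mono[OF w_sub _ that]) (simp add: w_def u_even)
  qed (fact n1 kappa c vp g_def p_def prob_g[unfolded \<mu>g_def] prob_p moment w_sub)+

  have law: "R.tgt.law = distr (\<mu> V) borel norm" unfolding law_g \<mu>g_def R.tgt.law_def ..
  have norm_m: "norm \<in> measurable (\<mu> V) borel" by measurable
  have transfer: "integrable R.tgt.law h \<longleftrightarrow> integrable (\<mu> V) (\<lambda>x. h (norm x))"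
    "(LINT r|R.tgt.law. h r) = (LINT x|\<mu> V. h (norm x))"
    if "h \<in> borel_measurable borel" for h :: "real \<Rightarrow> real"
    unfolding law using integrable_distr_eq[OF norm_m that] integral_distr[OF norm_m that] by auto

  have grad: "AE x in \<mu> V. (norm (weak_grad f x))\<^sup>2 = \<alpha> / 4 * ((q (norm x))\<^sup>2 * exp (- w (norm x)))"
  proof -
    have "AE x in lborel. (norm (weak_grad f x))\<^sup>2 = (d (norm x))\<^sup>2 * (exp (- u (norm x)))\<^sup>2"
      unfolding f_eq by (rule exp_convex_weak_gradient(2)[OF d])
    then have "AE x in lborel. (norm (weak_grad f x))\<^sup>2 = \<alpha> / 4 * ((q (norm x))\<^sup>2 * exp (- w (norm x)))"
    proof eventually_elim
      case (elim x)
      have "(exp (- u (norm x)))\<^sup>2 = \<alpha> * exp (- w (norm x))" using f2[of x] by (simp add: f_eq)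
      then show ?case using elim by (simp add: q_def power_mult_distrib)
    qed
    then show ?thesis unfolding \<mu>_def by (subst AE_density) (auto simp: V_eq elim!: eventually_mono)
  qed
  have grad_m: "(\<lambda>x. (norm (weak_grad f x))\<^sup>2) \<in> borel_measurable (\<mu> V)" using fL2(3) by simp
  have "integrable (\<mu> V) (\<lambda>x. \<alpha> / 4 * ((q (norm x))\<^sup>2 * exp (- w (norm x))))"
    using fL2(3) by (subst (asm) integrable_cong_AE[OF grad_m _ grad]) auto
  then have "integrable (\<mu> V) (\<lambda>x. 4 / \<alpha> * (\<alpha> / 4 * ((q (norm x))\<^sup>2 * exp (- w (norm x)))))"
    by (rule integrable_mult_right)
  then have int_q: "integrable (\<mu> V) (\<lambda>x. (q (norm x))\<^sup>2 * exp (- w (norm x)))"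
    by (rule Bochner_Integration.integrable_cong[THEN iffD1, rotated 2]) (use alpha in auto)
  have Fisher: "(LINT x|\<mu> V. (norm (weak_grad f x))\<^sup>2) = \<alpha> / 4 * (LINT x|\<mu> V. (q (norm x))\<^sup>2 * exp (- w (norm x)))"
    by (subst integral_cong_AE[OF grad_m _ grad]) auto
  have int_qR: "integrable R.tgt.law (\<lambda>r. (q r)\<^sup>2 * exp (- w r))"
    using int_q by (subst transfer(1)) auto
  have int_w: "integrable (\<mu> V) (\<lambda>x. w (norm x) * exp (- w (norm x)))"
    using R.w_exp_integrable by (subst (asm) transfer(1)) auto
  have int_e: "integrable (\<mu> V) (\<lambda>x. exp (- w (norm x)))" "(LINT x|\<mu> V. exp (- w (norm x))) = 1"
  proof -
    have em: "(\<lambda>r. exp (- w r)) \<in> borel_measurable borel" by measurable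
    show "integrable (\<mu> V) (\<lambda>x. exp (- w (norm x)))" "(LINT x|\<mu> V. exp (- w (norm x))) = 1"
      using R.integral_h unfolding transfer[OF em] .
  qed
  have Ent: "Ent_sq (\<mu> V) f = - \<alpha> * (LINT x|\<mu> V. w (norm x) * exp (- w (norm x)))"
  proof -
    have "(f x)\<^sup>2 * ln ((f x)\<^sup>2) = \<alpha> * ln \<alpha> * exp (- w (norm x)) - \<alpha> * (w (norm x) * exp (- w (norm x)))" for x
    proof -
      have ln: "ln (\<alpha> * exp (- w (norm x))) = ln \<alpha> - w (norm x)" using alpha by (simp add: ln_mult)
      show ?thesis unfolding f2 ln by (simp add: algebra_simps)
    qed
    then have "(LINT x|\<mu> V. (f x)\<^sup>2 * ln ((f x)\<^sup>2))
       = (LINT x|\<mu> V. \<alpha> * ln \<alpha> * exp (- w (norm x)) - \<alpha> * (w (norm x) * exp (- w (norm x))))" by (simp only:)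
    also have "\<dots> = \<alpha> * ln \<alpha> * 1 - \<alpha> * (LINT x|\<mu> V. w (norm x) * exp (- w (norm x)))"
      using int_w int_e by simp
    finally show ?thesis unfolding Ent_sq_def \<alpha>_def[symmetric] by simp
  qed
  have "LSI_deficit V c f = (LINT x|\<mu> V. (q (norm x))\<^sup>2 * exp (- w (norm x))) / (2 * c)
      + (LINT x|\<mu> V. w (norm x) * exp (- w (norm x)))"
    unfolding LSI_deficit_def Ent Fisher \<alpha>_def[symmetric] using alpha c by (simp add: field_simps)
  also have "\<dots> = (LINT x|\<mu> V. (q (norm x))\<^sup>2 * exp (- w (norm x)) / (2 * c) + w (norm x) * exp (- w (norm x)))"
    using int_q int_w by simp
  also have "\<dots> = (LINT r|R.tgt.law. (q r)\<^sup>2 * exp (- w r) / (2 * c) + w r * exp (- w r))"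
    by (subst transfer(2)) auto
  also have "\<dots> = (LINT r|R.tgt.law. ((q r)\<^sup>2 / (2 * c) + w r) * exp (- w r))"
    by (simp add: algebra_simps)
  finally have deficit: "R.D\<^sup>2 / (288 * n\<^sup>2) \<le> LSI_deficit V c f" using R.deficit_bound[OF int_qR] by simp
  have "L1_distance V f = (LINT x|\<mu> V. \<bar>exp (- w (norm x)) - 1\<bar>)"
    unfolding L1_distance_def Let_def \<alpha>_def[symmetric] unfolding f2 using alpha by simp
  also have "\<dots> = 2 * R.D" unfolding R.D_def by (subst transfer(2)) auto
  finally show ?thesis using deficit by (simp add: n_def power_mult_distrib)
qed

section \<open>Gaussian functions and the optimal exponent\<close>

lemma gaussian_norm_moments:
  "integrable lborel (\<lambda>x::real^'n::finite. norm x ^ m * exp (- (norm x)\<^sup>2))"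
proof -
  define k where "k = CARD('n) - 1"
  define \<kappa> where "\<kappa> = real CARD('n) * unit_ball_vol (real CARD('n))"
  have hm: "(\<lambda>r::real. r ^ m * exp (- r\<^sup>2)) \<in> borel_measurable borel" by measurable
  have nm: "(norm :: real^'n \<Rightarrow> real) \<in> measurable lborel borel" by measurable
  have "integrable lborel (\<lambda>r. \<kappa> * (indicator {0<..} r * (r ^ (m + k) * exp (- r\<^sup>2))))"
    by (intro integrable_mult_right half_gaussian_moments)
  then have "integrable lborel (\<lambda>r. indicator {0<..} r * (\<kappa> * r ^ k) * (r ^ m * exp (- r\<^sup>2)))"
    by (rule Bochner_Integration.integrable_cong[THEN iffD1, rotated 2]) (simp_all add: power_add mult_ac)
  then have "integrable (density lborel (\<lambda>r. ennreal (indicator {0<..} r * (\<kappa> * r ^ k)))) (\<lambda>r. r ^ m * exp (- r\<^sup>2))"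
    by (subst integrable_density) (auto simp: indicator_def \<kappa>_def)
  then show ?thesis
    unfolding \<kappa>_def k_def distr_norm_lborel[symmetric] integrable_distr_eq[OF nm hm] .
qed

text \<open>
  Jensen's inequality for \<open>t ln t\<close>, through its tangent line at \<open>\<alpha>\<close>, the integral of \<open>f\<^sup>2\<close>.
\<close>

lemma Ent_sq_nonneg:
  assumes "prob_space M" and int: "integrable M (\<lambda>x. (f x)\<^sup>2)" "integrable M (\<lambda>x. (f x)\<^sup>2 * ln ((f x)\<^sup>2))"
    and pos: "\<And>x. 0 < f x" "0 < (LINT x|M. (f x)\<^sup>2)"
  shows "0 \<le> Ent_sq M f"
proof -
  interpret prob_space M by fact
  define \<alpha> where "\<alpha> = (LINT x|M. (f x)\<^sup>2)"
  have "(LINT x|M. (1 + ln \<alpha>) * (f x)\<^sup>2 - \<alpha>) \<le> (LINT x|M. (f x)\<^sup>2 * ln ((f x)\<^sup>2))"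
  proof (rule integral_mono)
    fix x
    have t: "0 < (f x)\<^sup>2" using pos(1)[of x] by simp
    have "ln (\<alpha> / (f x)\<^sup>2) \<le> \<alpha> / (f x)\<^sup>2 - 1" using t pos(2) by (intro ln_le_minus_one) (simp add: \<alpha>_def)
    then have "(f x)\<^sup>2 * (ln \<alpha> - ln ((f x)\<^sup>2)) \<le> (f x)\<^sup>2 * (\<alpha> / (f x)\<^sup>2 - 1)"
      using t pos(2) by (intro mult_left_mono) (simp_all add: ln_div \<alpha>_def)
    also have "\<dots> = \<alpha> - (f x)\<^sup>2" using t by (simp add: right_diff_distrib)
    finally show "(1 + ln \<alpha>) * (f x)\<^sup>2 - \<alpha> \<le> (f x)\<^sup>2 * ln ((f x)\<^sup>2)" by (simp add: algebra_simps)
  qed (use int in simp_all)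
  also have "(LINT x|M. (1 + ln \<alpha>) * (f x)\<^sup>2 - \<alpha>) = (1 + ln \<alpha>) * \<alpha> - \<alpha>"
    using int by (simp add: \<alpha>_def prob_space)
  finally show ?thesis unfolding Ent_sq_def \<alpha>_def[symmetric] by (simp add: algebra_simps)
qed

lemma measure_ball_pos:
  fixes V :: "real^'n::finite \<Rightarrow> real"
  assumes "prob_space (\<mu> V)" and [measurable]: "V \<in> borel_measurable borel" and "0 < r"
  shows "0 < measure (\<mu> V) (ball a r)"
proof -
  interpret prob_space "\<mu> V" by fact
  have [measurable]: "ball a r \<in> sets borel" by simp
  have "emeasure (\<mu> V) (ball a r) \<noteq> 0"
  proof
    assume "emeasure (\<mu> V) (ball a r) = 0"
    then have "(\<integral>\<^sup>+x. ennreal (exp (- V x)) * indicator (ball a r) x \<partial>lborel) = 0"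
      unfolding \<mu>_def by (subst (asm) emeasure_density) auto
    moreover have m: "(\<lambda>x. ennreal (exp (- V x)) * indicator (ball a r) x) \<in> borel_measurable lborel"
      by measurable
    ultimately have "AE x in lborel. ennreal (exp (- V x)) * indicator (ball a r) x = 0"
      using nn_integral_0_iff_AE[OF m] by simp
    then have "AE x in lborel. x \<notin> ball a r"
      by eventually_elim (auto simp: indicator_def split: if_splits)
    then have "emeasure lborel (ball a r) = 0"
      by (subst AE_iff_measurable[symmetric, where P="\<lambda>x. x \<notin> ball a r"]) auto
    then show False using emeasure_ball[of r a] unit_ball_vol_pos[of "real CARD('n)"] assms(3) by simp
  qed
  then show ?thesis by (simp add: emeasure_eq_measure zero_less_measure_iff)
qed

lemma convex_norm_square: "convex_on UNIV (\<lambda>x::'a::real_inner. (norm x)\<^sup>2)"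
proof (rule convex_onI)
  fix t :: real and x y :: 'a assume t: "0 < t" "t < 1"
  have "(1 - t) * (norm x)\<^sup>2 + t * (norm y)\<^sup>2 - (norm ((1 - t) *\<^sub>R x + t *\<^sub>R y))\<^sup>2 = (1 - t) * t * (norm (x - y))\<^sup>2"
    by (simp add: power2_norm_eq_inner inner_simps inner_commute algebra_simps)
  moreover have "0 \<le> (1 - t) * t * (norm (x - y))\<^sup>2" using t by simp
  ultimately show "(norm ((1 - t) *\<^sub>R x + t *\<^sub>R y))\<^sup>2 \<le> (1 - t) * (norm x)\<^sup>2 + t * (norm y)\<^sup>2" by linarith
qed simp

lemma quadratic_potential:
  fixes b :: real
  defines "V \<equiv> \<lambda>x::real^'n::finite. (norm x)\<^sup>2 + b"
  shows "C_k 2 V" "radial V" "pos_semidef (hessian V x - 2 *\<^sub>R mat 1)"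
proof -
  have D: "(V has_derivative (\<lambda>y. 2 * (x \<bullet> y))) (at x)" for x
    unfolding V_def power2_norm_eq_inner
    by (auto intro!: derivative_eq_intros simp: inner_commute)
  have pd: "partial_derivative j V = (\<lambda>x. 2 * x $ j)" for j
    by (rule ext) (simp add: partial_derivative_eq[OF D] inner_axis)
  have diff: "V differentiable_on UNIV"
    using D by (auto simp: differentiable_on_def differentiable_def intro: has_derivative_at_withinI)
  have C1: "C_k 1 (partial_derivative j V)" for j
    unfolding pd by (rule C1_mult[OF C1_const C1_coordinate])
  show "C_k 2 V" unfolding numeral_2_eq_2 C_k.simps(2)[of "Suc 0"] using diff C1 unfolding One_nat_def by blast
  show "radial V" unfolding radial_def V_def by (simp add: orthogonal_transformation_norm)
  have "partial_derivative i (\<lambda>x. 2 * x $ j) x = 2 * axis i 1 $ j" for i j and x :: "real^'n"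
    by (rule partial_derivative_eq)
      (auto intro!: derivative_eq_intros bounded_linear_imp_has_derivative[OF bounded_linear_vec_nth])
  then have "hessian V x - 2 *\<^sub>R mat 1 = 0"
    unfolding hessian_def pd by (simp add: vec_eq_iff mat_def axis_def)
  then show "pos_semidef (hessian V x - 2 *\<^sub>R mat 1)"
    by (simp only:) (simp add: pos_semidef_def transpose_def vec_eq_iff)
qed

text \<open>
  The functions are \<open>f \<epsilon> = exp (- \<epsilon> / 2 * \<bar>x\<bar>\<^sup>2)\<close> for the Gaussian measure with potential
  \<open>\<bar>x\<bar>\<^sup>2 + const\<close>. Their gradient is \<open>- \<epsilon> x f \<epsilon> x\<close>, which gives the upper bound of the deficit. For the lower
  bound of the distance, \<open>(f \<epsilon>)\<^sup>2\<close> takes values above \<open>exp (- \<epsilon> / 2)\<close> on one fixed ball and below \<open>exp (- 4 \<epsilon>)\<close>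
  on another one, so on one of the two it differs from its mean by a multiple of \<open>\<epsilon>\<close>.
\<close>

lemma gaussian_family:
  obtains V :: "real^'n::finite \<Rightarrow> real" and f :: "real \<Rightarrow> real^'n \<Rightarrow> real" and K b :: real
  where "0 < K" "0 < b"
    "\<And>\<epsilon>. 0 < \<epsilon> \<Longrightarrow> \<epsilon> \<le> 1 \<Longrightarrow> admissible V 2 (f \<epsilon>)"
    "\<And>\<epsilon>. 0 < \<epsilon> \<Longrightarrow> \<epsilon> \<le> 1 \<Longrightarrow> LSI_deficit V 2 (f \<epsilon>) \<le> K * \<epsilon>\<^sup>2"
    "\<And>\<epsilon>. 0 < \<epsilon> \<Longrightarrow> \<epsilon> \<le> 1 \<Longrightarrow> b * \<epsilon> \<le> L1_distance V (f \<epsilon>)"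
proof -
  define Z where "Z = (LINT x|(lborel :: (real^'n) measure). exp (- (norm x)\<^sup>2))"
  have int0: "integrable (lborel :: (real^'n) measure) (\<lambda>x. exp (- (norm x)\<^sup>2))"
    using gaussian_norm_moments[of 0] by simp
  have Z: "0 < Z"
    unfolding Z_def using int0 by (intro integral_strict_pos) simp_all
  define V where "V = (\<lambda>x::real^'n. (norm x)\<^sup>2 + ln Z)"
  have eV: "exp (- V x) = exp (- (norm x)\<^sup>2) / Z" for x using Z by (simp add: V_def exp_diff)
  have Vm[measurable]: "V \<in> borel_measurable borel" unfolding V_def by measurable
  have prob: "prob_space (\<mu> V)"
  proof (rule prob_spaceI)
    have "emeasure (\<mu> V) (space (\<mu> V)) = (\<integral>\<^sup>+x. ennreal (exp (- (norm x)\<^sup>2) / Z) \<partial>(lborel :: (real^'n) measure))"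
      unfolding \<mu>_def by (simp add: emeasure_density eV)
    also have "\<dots> = ennreal (LINT x|(lborel :: (real^'n) measure). exp (- (norm x)\<^sup>2) / Z)"
      using int0 Z by (intro nn_integral_eq_integral) auto
    also have "\<dots> = 1" using Z by (simp add: Z_def)
    finally show "emeasure (\<mu> V) (space (\<mu> V)) = 1" .
  qed
  interpret prob_space "\<mu> V" by (rule prob)
  have sets_M[measurable_cong, simp]: "sets (\<mu> V) = sets borel" by (simp add: \<mu>_def)
  have int2: "integrable (\<mu> V) (\<lambda>x. (norm x)\<^sup>2)"
  proof -
    have "integrable (lborel :: (real^'n) measure) (\<lambda>x. (1 / Z) * (norm x ^ 2 * exp (- (norm x)\<^sup>2)))"
      by (intro integrable_mult_right gaussian_norm_moments)
    then show ?thesis unfolding \<mu>_def using Z by (subst integrable_density) (auto simp: eV mult_ac)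
  qed
  define M2 where "M2 = (LINT x|\<mu> V. (norm x)\<^sup>2)"
  have M2: "0 \<le> M2" by (simp add: M2_def)
  define f where "f = (\<lambda>\<epsilon> (x::real^'n). exp (- (\<epsilon> / 2 * (norm x)\<^sup>2)))"
  have f2: "(f \<epsilon> x)\<^sup>2 = exp (- (\<epsilon> * (norm x)\<^sup>2))" for \<epsilon> x
    by (simp add: f_def power2_eq_square flip: exp_add)
  have [measurable]: "f \<epsilon> \<in> borel_measurable borel" for \<epsilon> unfolding f_def by measurable
  have f2_le: "(f \<epsilon> x)\<^sup>2 \<le> 1" if "0 < \<epsilon>" for \<epsilon> x using that by (simp add: f2)
  have f2_int: "integrable (\<mu> V) (\<lambda>x. (f \<epsilon> x)\<^sup>2)" if "0 < \<epsilon>" for \<epsilon>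
    by (rule integrable_const_bound[where B=1]) (use f2_le[OF that] in auto)
  have f_pos: "0 < f \<epsilon> x" for \<epsilon> x by (simp add: f_def)

  define \<alpha> where "\<alpha> = (\<lambda>\<epsilon>. LINT x|\<mu> V. (f \<epsilon> x)\<^sup>2)"
  have \<alpha>_eq: "(LINT x|\<mu> V. (f \<epsilon> x)\<^sup>2) = \<alpha> \<epsilon>" for \<epsilon> by (simp add: \<alpha>_def)
  have \<alpha>_pos: "0 < \<alpha> \<epsilon>" if "0 < \<epsilon>" for \<epsilon>
    unfolding \<alpha>_def using f2_int[OF that] by (intro integral_strict_pos) (simp_all add: f2 emeasure_space_1)
  have \<alpha>_le: "\<alpha> \<epsilon> \<le> 1" if "0 < \<epsilon>" for \<epsilon>
  proof -
    have "\<alpha> \<epsilon> \<le> (LINT x|\<mu> V. 1)" unfolding \<alpha>_def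
      by (rule integral_mono[OF f2_int[OF that]]) (use f2_le[OF that] in auto)
    then show ?thesis by (simp add: prob_space)
  qed
  have \<alpha>_ge: "\<alpha> 1 \<le> \<alpha> \<epsilon>" if "0 < \<epsilon>" "\<epsilon> \<le> 1" for \<epsilon>
    unfolding \<alpha>_def
  proof (rule integral_mono[OF f2_int f2_int])
    show "(f 1 x)\<^sup>2 \<le> (f \<epsilon> x)\<^sup>2" for x
      using that by (simp add: f2 mult_left_le_one_le)
  qed (use that in auto)

  have sub: "\<epsilon> / 2 * x\<^sup>2 + \<epsilon> * x * (y - x) \<le> \<epsilon> / 2 * y\<^sup>2" if "0 < \<epsilon>" for \<epsilon> x y :: real
  proof -
    have "0 \<le> \<epsilon> / 2 * (y - x)\<^sup>2" using that by simp
    then show ?thesis by (simp add: power2_eq_square algebra_simps)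
  qed
  have weak: "has_weak_gradient (f \<epsilon>) (weak_grad (f \<epsilon>))"
    and grad: "AE x in lborel. (norm (weak_grad (f \<epsilon>) x))\<^sup>2 = \<epsilon>\<^sup>2 * ((norm x)\<^sup>2 * (f \<epsilon> x)\<^sup>2)" if "0 < \<epsilon>" for \<epsilon>
  proof -
    note W = exp_convex_weak_gradient[OF sub[OF that], where 'n='n]
    show "has_weak_gradient (f \<epsilon>) (weak_grad (f \<epsilon>))"
      unfolding f_def by (rule has_weak_gradient_weak_grad[OF W(1)])
    show "AE x in lborel. (norm (weak_grad (f \<epsilon>) x))\<^sup>2 = \<epsilon>\<^sup>2 * ((norm x)\<^sup>2 * (f \<epsilon> x)\<^sup>2)"
      unfolding f_def using W(2) by eventually_elim (simp add: power_mult_distrib mult_ac)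
  qed
  have grad_m: "(\<lambda>x. norm (weak_grad (f \<epsilon>) x)) \<in> borel_measurable borel" if "0 < \<epsilon>" for \<epsilon>
  proof -
    have "weak_grad (f \<epsilon>) \<in> borel_measurable borel"
      using weak_gradient_locally_integrable[OF weak[OF that]] unfolding locally_integrable_def by (rule conjunct1)
    then show ?thesis by measurable
  qed
  have gradM: "AE x in \<mu> V. (norm (weak_grad (f \<epsilon>) x))\<^sup>2 = \<epsilon>\<^sup>2 * ((norm x)\<^sup>2 * (f \<epsilon> x)\<^sup>2)" if "0 < \<epsilon>" for \<epsilon>
    using grad[OF that] unfolding \<mu>_def by (subst AE_density) (auto elim!: eventually_mono)
  have int_rf: "integrable (\<mu> V) (\<lambda>x. (norm x)\<^sup>2 * (f \<epsilon> x)\<^sup>2)"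
    and int_rf_le: "(LINT x|\<mu> V. (norm x)\<^sup>2 * (f \<epsilon> x)\<^sup>2) \<le> M2" if "0 < \<epsilon>" for \<epsilon>
  proof -
    have le: "(norm x)\<^sup>2 * (f \<epsilon> x)\<^sup>2 \<le> (norm x)\<^sup>2" for x
      using f2_le[OF that, of x] by (simp add: mult_left_le)
    show int: "integrable (\<mu> V) (\<lambda>x. (norm x)\<^sup>2 * (f \<epsilon> x)\<^sup>2)"
      by (rule Bochner_Integration.integrable_bound[OF int2]) (use le in auto)
    show "(LINT x|\<mu> V. (norm x)\<^sup>2 * (f \<epsilon> x)\<^sup>2) \<le> M2"
      unfolding M2_def by (rule integral_mono[OF int int2 le])
  qed
  have int_grad: "integrable (\<mu> V) (\<lambda>x. (norm (weak_grad (f \<epsilon>) x))\<^sup>2)"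
    and grad_le: "(LINT x|\<mu> V. (norm (weak_grad (f \<epsilon>) x))\<^sup>2) \<le> \<epsilon>\<^sup>2 * M2" if e: "0 < \<epsilon>" for \<epsilon>
  proof -
    have m: "(\<lambda>x. (norm (weak_grad (f \<epsilon>) x))\<^sup>2) \<in> borel_measurable (\<mu> V)"
      "(\<lambda>x. \<epsilon>\<^sup>2 * ((norm x)\<^sup>2 * (f \<epsilon> x)\<^sup>2)) \<in> borel_measurable (\<mu> V)"
      using grad_m[OF e] by measurable
    show "integrable (\<mu> V) (\<lambda>x. (norm (weak_grad (f \<epsilon>) x))\<^sup>2)"
      unfolding integrable_cong_AE[OF m gradM[OF e]] by (rule integrable_mult_right[OF int_rf[OF e]])
    show "(LINT x|\<mu> V. (norm (weak_grad (f \<epsilon>) x))\<^sup>2) \<le> \<epsilon>\<^sup>2 * M2"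
      unfolding integral_cong_AE[OF m gradM[OF e]] using int_rf_le[OF e] by (simp add: mult_left_mono)
  qed

  define K where "K = (M2 + 1) / \<alpha> 1"
  define b where "b = min (measure (\<mu> V) (ball 0 (1/2))) (measure (\<mu> V) (ball (3 *\<^sub>R axis undefined 1) 1)) * (exp (- 4) / 2)"
  show thesis
  proof
    show "0 < K" unfolding K_def using M2 \<alpha>_pos[of 1] by simp
    show "0 < b" unfolding b_def using measure_ball_pos[OF prob Vm] by simp
  next
    fix \<epsilon> :: real assume e: "0 < \<epsilon>" "\<epsilon> \<le> 1"
    show "admissible V 2 (f \<epsilon>)"
      unfolding admissible_def
    proof (intro conjI allI prob f_pos)
      show "C_k 2 V" "radial V" "pos_semidef (hessian V x - 2 *\<^sub>R mat 1)" for x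
        unfolding V_def by (rule quadratic_potential)+
      show "f \<epsilon> \<in> W12 (\<mu> V)"
        using f2_int[OF e(1)] weak[OF e(1)] grad_m[OF e(1)] int_grad[OF e(1)]
        by (auto simp: W12_def L2_def)
      show "log_concave (f \<epsilon>)"
        using convex_on_cmul[OF _ convex_norm_square[where 'a="real^'n"], of "\<epsilon> / 2"] e
        by (simp add: log_concave_def concave_on_def f_def)
      show "radial (f \<epsilon>)" unfolding radial_def f_def by (simp add: orthogonal_transformation_norm)
    qed simp
    show "LSI_deficit V 2 (f \<epsilon>) \<le> K * \<epsilon>\<^sup>2"
    proof -
      have "0 \<le> Ent_sq (\<mu> V) (f \<epsilon>)"
      proof (rule Ent_sq_nonneg[OF prob f2_int[OF e(1)] _ f_pos])
        have "integrable (\<mu> V) (\<lambda>x. - \<epsilon> * ((norm x)\<^sup>2 * (f \<epsilon> x)\<^sup>2))"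
          by (rule integrable_mult_right[OF int_rf[OF e(1)]])
        then show "integrable (\<mu> V) (\<lambda>x. (f \<epsilon> x)\<^sup>2 * ln ((f \<epsilon> x)\<^sup>2))"
          by (rule Bochner_Integration.integrable_cong[THEN iffD1, rotated 2]) (simp_all add: f2 mult_ac)
        show "0 < (LINT x|\<mu> V. (f \<epsilon> x)\<^sup>2)" using \<alpha>_pos[OF e(1)] by (simp add: \<alpha>_def)
      qed
      then have "LSI_deficit V 2 (f \<epsilon>) \<le> \<epsilon>\<^sup>2 * M2 / \<alpha> \<epsilon>"
        unfolding LSI_deficit_def \<alpha>_eq
        using grad_le[OF e(1)] \<alpha>_pos[OF e(1)] by (intro divide_right_mono) auto
      also have "\<dots> \<le> \<epsilon>\<^sup>2 * (M2 + 1) / \<alpha> 1"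
        using \<alpha>_ge[OF e] \<alpha>_pos[of 1] M2 by (intro frac_le mult_left_mono) auto
      finally show ?thesis by (simp add: K_def mult.commute)
    qed
    show "b * \<epsilon> \<le> L1_distance V (f \<epsilon>)"
    proof -
      have int1: "integrable (\<mu> V) (\<lambda>x. \<bar>(f \<epsilon> x)\<^sup>2 - \<alpha> \<epsilon>\<bar>)" using f2_int[OF e(1)] by simp
      have L1: "(LINT x|\<mu> V. \<bar>(f \<epsilon> x)\<^sup>2 - \<alpha> \<epsilon>\<bar>) \<le> L1_distance V (f \<epsilon>)"
        unfolding L1_distance_def Let_def \<alpha>_eq
      proof (rule integral_mono[OF int1])
        show "integrable (\<mu> V) (\<lambda>x. \<bar>(f \<epsilon> x)\<^sup>2 / \<alpha> \<epsilon> - 1\<bar>)" using f2_int[OF e(1)] by simp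
        fix x
        have "\<bar>(f \<epsilon> x)\<^sup>2 - \<alpha> \<epsilon>\<bar> = \<alpha> \<epsilon> * \<bar>(f \<epsilon> x)\<^sup>2 / \<alpha> \<epsilon> - 1\<bar>"
        proof -
          have "(f \<epsilon> x)\<^sup>2 - \<alpha> \<epsilon> = \<alpha> \<epsilon> * ((f \<epsilon> x)\<^sup>2 / \<alpha> \<epsilon> - 1)"
            using \<alpha>_pos[OF e(1)] by (simp add: right_diff_distrib)
          then show ?thesis using \<alpha>_pos[OF e(1)] by (simp only: abs_mult abs_of_pos)
        qed
        also have "\<dots> \<le> 1 * \<bar>(f \<epsilon> x)\<^sup>2 / \<alpha> \<epsilon> - 1\<bar>" using \<alpha>_le[OF e(1)] by (intro mult_right_mono) auto
        finally show "\<bar>(f \<epsilon> x)\<^sup>2 - \<alpha> \<epsilon>\<bar> \<le> \<bar>(f \<epsilon> x)\<^sup>2 / \<alpha> \<epsilon> - 1\<bar>" by simp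
      qed
      \<comment> \<open>Applied below with the exponents \<open>1 / 2, 1\<close> and \<open>1, 4\<close>.\<close>
      have gap: "exp (- 4) / 2 * \<epsilon> \<le> exp (- s * \<epsilon>) - exp (- t * \<epsilon>)" if st: "s + 1/2 \<le> t" "t \<le> 4" for s t :: real
      proof -
        have "exp (- 4) * (\<epsilon> / 2) \<le> exp (- t * \<epsilon>) * (exp ((t - s) * \<epsilon>) - 1)"
        proof (rule mult_mono)
          have "t * \<epsilon> \<le> 4 * \<epsilon>" using st e by (intro mult_right_mono) auto
          also have "\<dots> \<le> 4" using e by simp
          finally show "exp (- 4) \<le> exp (- t * \<epsilon>)" by simp
          have "1/2 * \<epsilon> \<le> (t - s) * \<epsilon>" using st e by (intro mult_right_mono) auto
          then show "\<epsilon> / 2 \<le> exp ((t - s) * \<epsilon>) - 1" using exp_ge_add_one_self[of "(t - s) * \<epsilon>"] by linarith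
        qed (use e in auto)
        also have "\<dots> = exp (- s * \<epsilon>) - exp (- t * \<epsilon>)" by (simp add: right_diff_distrib algebra_simps flip: exp_add)
        finally show ?thesis by simp
      qed
      have on_set: "measure (\<mu> V) A * (exp (- 4) / 2 * \<epsilon>) \<le> L1_distance V (f \<epsilon>)"
        if [measurable]: "A \<in> sets borel" and A: "\<And>x. x \<in> A \<Longrightarrow> exp (- 4) / 2 * \<epsilon> \<le> \<bar>(f \<epsilon> x)\<^sup>2 - \<alpha> \<epsilon>\<bar>" for A
      proof -
        have "measure (\<mu> V) A * (exp (- 4) / 2 * \<epsilon>) = (LINT x|\<mu> V. indicator A x * (exp (- 4) / 2 * \<epsilon>))"
          by (simp add: emeasure_eq_measure)
        also have "\<dots> \<le> (LINT x|\<mu> V. \<bar>(f \<epsilon> x)\<^sup>2 - \<alpha> \<epsilon>\<bar>)"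
        proof (rule integral_mono[OF _ int1])
          show "integrable (\<mu> V) (\<lambda>x. indicator A x * (exp (- 4) / 2 * \<epsilon>))"
            by (intro integrable_mult_left integrable_real_indicator) (auto simp: emeasure_eq_measure)
          show "indicator A x * (exp (- 4) / 2 * \<epsilon>) \<le> \<bar>(f \<epsilon> x)\<^sup>2 - \<alpha> \<epsilon>\<bar>" for x
            using A[of x] by (cases "x \<in> A") auto
        qed
        also note L1
        finally show ?thesis .
      qed
      show ?thesis
      proof (cases "\<alpha> \<epsilon> \<le> exp (- 1 * \<epsilon>)")
        case True
        have "measure (\<mu> V) (ball 0 (1/2)) * (exp (- 4) / 2 * \<epsilon>) \<le> L1_distance V (f \<epsilon>)"
        proof (rule on_set)
          fix x :: "real^'n" assume "x \<in> ball 0 (1/2)"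
          then have "(norm x)\<^sup>2 \<le> (1/2)\<^sup>2" by (intro power_mono) auto
          then have "(norm x)\<^sup>2 \<le> 1/2" by (simp add: power2_eq_square)
          then have "\<epsilon> * (norm x)\<^sup>2 \<le> 1/2 * \<epsilon>" using e by (simp add: mult.commute mult_left_mono)
          then have "exp (- (1/2) * \<epsilon>) \<le> (f \<epsilon> x)\<^sup>2" by (simp add: f2)
          then show "exp (- 4) / 2 * \<epsilon> \<le> \<bar>(f \<epsilon> x)\<^sup>2 - \<alpha> \<epsilon>\<bar>" using gap[of "1/2" 1] True by linarith
        qed simp
        moreover have "b * \<epsilon> \<le> measure (\<mu> V) (ball 0 (1/2)) * (exp (- 4) / 2 * \<epsilon>)"
          unfolding b_def mult.assoc using e by (intro mult_right_mono) auto
        ultimately show ?thesis by linarith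
      next
        case False
        have "measure (\<mu> V) (ball (3 *\<^sub>R axis undefined 1) 1) * (exp (- 4) / 2 * \<epsilon>) \<le> L1_distance V (f \<epsilon>)"
        proof (rule on_set)
          fix x :: "real^'n" assume "x \<in> ball (3 *\<^sub>R axis undefined 1) 1"
          then have "norm (3 *\<^sub>R axis undefined (1::real) - x) < 1" by (simp add: dist_norm)
          moreover have "norm (3 *\<^sub>R axis undefined (1::real) :: real^'n) \<le> norm (3 *\<^sub>R axis undefined (1::real) - x) + norm x"
            using norm_triangle_ineq[of "3 *\<^sub>R axis undefined (1::real) - x" x] by simp
          ultimately have "2 \<le> norm x" by simp
          then have "2\<^sup>2 \<le> (norm x)\<^sup>2" by (intro power_mono) auto
          then have "\<epsilon> * 4 \<le> \<epsilon> * (norm x)\<^sup>2" using e by (intro mult_left_mono) auto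
          then have "(f \<epsilon> x)\<^sup>2 \<le> exp (- 4 * \<epsilon>)" by (simp add: f2 mult.commute)
          then show "exp (- 4) / 2 * \<epsilon> \<le> \<bar>(f \<epsilon> x)\<^sup>2 - \<alpha> \<epsilon>\<bar>" using gap[of 1 4] False by linarith
        qed simp
        moreover have "b * \<epsilon> \<le> measure (\<mu> V) (ball (3 *\<^sub>R axis undefined 1) 1) * (exp (- 4) / 2 * \<epsilon>)"
          unfolding b_def mult.assoc using e by (intro mult_right_mono) auto
        ultimately show ?thesis by linarith
      qed
    qed
  qed
qed

theorem theorem1p2:
  shows "(\<exists>C>0. \<forall>(V :: real^'n::finite \<Rightarrow> real) c f. admissible V c f \<longrightarrow>
           L1_distance V f \<le> C * (LSI_deficit V c f) powr (1/2))
       \<and> \<not> (\<exists>\<eta>>1/2. \<exists>C>0. \<forall>(V :: real^'n \<Rightarrow> real) c f. admissible V c f \<longrightarrow>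
           L1_distance V f \<le> C * (LSI_deficit V c f) powr \<eta>)"
proof
  define C where "C = sqrt (1152 * (real CARD('n))\<^sup>2)"
  have "0 < C" by (simp add: C_def)
  moreover have "L1_distance V f \<le> C * (LSI_deficit V c f) powr (1/2)"
    if "admissible V c f" for V :: "real^'n \<Rightarrow> real" and c f
  proof -
    have ge: "(L1_distance V f)\<^sup>2 / (1152 * (real CARD('n))\<^sup>2) \<le> LSI_deficit V c f"
      by (rule LSI_deficit_ge_L1_distance_square[OF that])
    then have nonneg: "0 \<le> LSI_deficit V c f" by (rule order_trans[rotated]) simp
    have "(L1_distance V f)\<^sup>2 \<le> 1152 * (real CARD('n))\<^sup>2 * LSI_deficit V c f"
      using ge by (simp add: pos_divide_le_eq mult.commute)
    then have "L1_distance V f \<le> sqrt (1152 * (real CARD('n))\<^sup>2 * LSI_deficit V c f)"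
      by (rule real_le_rsqrt)
    then show ?thesis using nonneg by (simp add: C_def real_sqrt_mult powr_half_sqrt)
  qed
  ultimately show "\<exists>C>0. \<forall>(V :: real^'n \<Rightarrow> real) c f. admissible V c f \<longrightarrow>
      L1_distance V f \<le> C * (LSI_deficit V c f) powr (1/2)" by blast
  show "\<not> (\<exists>\<eta>>1/2. \<exists>C>0. \<forall>(V :: real^'n \<Rightarrow> real) c f. admissible V c f \<longrightarrow>
      L1_distance V f \<le> C * (LSI_deficit V c f) powr \<eta>)"
  proof
    assume "\<exists>\<eta>>1/2. \<exists>C>0. \<forall>(V :: real^'n \<Rightarrow> real) c f. admissible V c f \<longrightarrow>
      L1_distance V f \<le> C * (LSI_deficit V c f) powr \<eta>"
    then obtain \<eta> C where \<eta>: "1/2 < \<eta>" and C: "0 < C"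
      and le: "\<And>(V :: real^'n \<Rightarrow> real) c f. admissible V c f \<Longrightarrow> L1_distance V f \<le> C * (LSI_deficit V c f) powr \<eta>"
      by blast
    obtain K b :: real and V :: "real^'n \<Rightarrow> real" and f where fam: "0 < K" "0 < b"
      "\<And>\<epsilon>. 0 < \<epsilon> \<Longrightarrow> \<epsilon> \<le> 1 \<Longrightarrow> admissible V 2 (f \<epsilon>)"
      "\<And>\<epsilon>. 0 < \<epsilon> \<Longrightarrow> \<epsilon> \<le> 1 \<Longrightarrow> LSI_deficit V 2 (f \<epsilon>) \<le> K * \<epsilon>\<^sup>2"
      "\<And>\<epsilon>. 0 < \<epsilon> \<Longrightarrow> \<epsilon> \<le> 1 \<Longrightarrow> b * \<epsilon> \<le> L1_distance V (f \<epsilon>)"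
      by (rule gaussian_family) (rule that; assumption)
    have bound: "b \<le> C * K powr \<eta> * \<epsilon> powr (2 * \<eta> - 1)" if e: "0 < \<epsilon>" "\<epsilon> \<le> 1" for \<epsilon>
    proof -
      have nonneg: "0 \<le> LSI_deficit V 2 (f \<epsilon>)"
        using LSI_deficit_ge_L1_distance_square[OF fam(3)[OF e]] by (rule order_trans[rotated]) simp
      have "b * \<epsilon> \<le> C * (LSI_deficit V 2 (f \<epsilon>)) powr \<eta>"
        using fam(5)[OF e] le[OF fam(3)[OF e]] by linarith
      also have "\<dots> \<le> C * (K * \<epsilon>\<^sup>2) powr \<eta>"
        using fam(4)[OF e] nonneg C \<eta> by (intro mult_left_mono powr_mono2) auto
      also have "(K * \<epsilon>\<^sup>2) powr \<eta> = K powr \<eta> * (\<epsilon> powr (2 * \<eta> - 1) * \<epsilon>)"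
      proof -
        have "(\<epsilon>\<^sup>2) powr \<eta> = \<epsilon> powr (2 * \<eta>)" using e by (simp add: powr_powr flip: powr_numeral)
        also have "\<dots> = \<epsilon> powr (2 * \<eta> - 1) * \<epsilon>" using e powr_add[of \<epsilon> "2 * \<eta> - 1" 1] by simp
        finally show ?thesis using e fam(1) by (simp add: powr_mult)
      qed
      finally have "b * \<epsilon> \<le> C * K powr \<eta> * \<epsilon> powr (2 * \<eta> - 1) * \<epsilon>" by (simp only: mult.assoc)
      then show ?thesis using e by (simp only: mult_le_cancel_right_pos)
    qed
    have "(\<lambda>k. C * K powr \<eta> * (1 / real (Suc k)) powr (2 * \<eta> - 1)) \<longlonglongrightarrow> C * K powr \<eta> * 0"
    proof (intro tendsto_intros)
      show "(\<lambda>k. (1 / real (Suc k)) powr (2 * \<eta> - 1)) \<longlonglongrightarrow> 0"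
        using \<eta> by real_asymp
    qed
    then have "b \<le> C * K powr \<eta> * 0"
      by (rule LIMSEQ_le_const) (use bound in auto)
    then show False using fam(2) by simp
  qed
qed

end
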